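(* Let $H$ be a coalgebra and $n\ge0$. The following are exact sequences of complexes: $$CC(W_n(H)):\ \cdots\to W^b_n(H)\xrightarrow{t-1}W_n(H)\xrightarrow{N}W^b_n(H)\xrightarrow{t-1}W_n(H)\to\cdots$$ $$0\to W_n(H)_\natural\xrightarrow{N}W^b_n(H)\xrightarrow{t-1}W_n(H)\xrightarrow{N}W^b_n(H)\xrightarrow{t-1}W_n(H)\to\cdots$$ $$0\to I_n(H)_\natural\xrightarrow{N}I^b_n(H)\xrightarrow{t-1}I_n(H)\xrightarrow{N}I^b_n(H)\xrightarrow{t-1}I_n(H)\to\cdots$$
   Context: $H$ is a coalgebra over $\mathbb{C}$ with $\Delta(h)=\sum h_0\otimes h_1$. $W(H)$ is the non-commutative, non-unital DG algebra freely generated by symbols $h$ of degree 1 and $\omega_h$ of degree 2, linear in $h\in H$, with differential the graded derivation $\partial$: $\partial(h)=\omega_h-\sum h_0h_1$, $\partial(\omega_h)=\sum\omega_{h_0}h_1-\sum h_0\omega_{h_1}$. $\partial_0$ is the derivation with $\partial_0(h)=-\sum h_0h_1$, $\partial_0(\omega_h)=\partial(\omega_h)$. $I(H)$ is the ideal generated by the $\omega_h$; $I_n(H)=I(H)^{n+1}$ ($I(H)^0$ meaning $W(H)$ with unit adjoined), $W_n(H)=W(H)/I(H)^{n+1}$, both with differential $\partial$. With graded commutators, $W_n(H)_\natural=W_n(H)/[W_n(H),W_n(H)]$, $I_n(H)_\natural=I_n(H)/[I(H),I_{n-1}(H)]$. For a generator $a$ (of the form $h$ or $\omega_h$): $t(ax)=(-1)^{|a||x|}xa$,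 $b_t(ax)=t(\partial_0(a)x)$, $b=\partial+b_t$. On products of $p$ generators $t^p=1$ and $N=1+t+\cdots+t^{p-1}$. The operators $t,N,b$ preserve the powers of $I(H)$; $W_n^b(H)$ and $I_n^b(H)$ denote $W_n(H)$ and $I_n(H)$ equipped with the differential $b$ instead of $\partial$. *)

theory Defs
  imports
    "HOL-Library.Poly_Mapping"
    "HOL-Algebra.Module"
    "HOL-Algebra.QuotRing"
    "HOL-Algebra.Algebraic_Closure_Type"
begin

section \<open>Complex vector spaces\<close>

class complex_vector = ab_group_add +
  fixes scaleC :: "complex \<Rightarrow> 'a \<Rightarrow> 'a"  (infixr \<open>*\<^sub>C\<close> 75)
  assumes scaleC_add_right: "c *\<^sub>C (x + y) = c *\<^sub>C x + c *\<^sub>C y"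
    and scaleC_add_left: "(c + d) *\<^sub>C x = c *\<^sub>C x + d *\<^sub>C x"
    and scaleC_scaleC: "c *\<^sub>C d *\<^sub>C x = (c * d) *\<^sub>C x"
    and scaleC_one: "1 *\<^sub>C x = x"

global_interpretation cvs: vector_space "scaleC :: complex \<Rightarrow> 'a \<Rightarrow> 'a::complex_vector"
  defines cspan = cvs.span and csubspace = cvs.subspace
  by unfold_locales (simp_all add: scaleC_add_right scaleC_add_left scaleC_scaleC scaleC_one)

abbreviation clinear :: "('a::complex_vector \<Rightarrow> 'b::complex_vector) \<Rightarrow> bool" where
  "clinear \<equiv> Vector_Spaces.linear scaleC scaleC"

lemma clinearI:
  assumes "\<And>x y. f (x + y) = f x + f y" "\<And>c x. f (c *\<^sub>C x) = c *\<^sub>C f x"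
  shows "clinear f"
  using assms by unfold_locales auto

lemma clinear_add: "clinear f \<Longrightarrow> f (x + y) = f x + f y"
  by (rule Modules.module_hom.add[OF Vector_Spaces.linear.axioms(3)])

lemma clinear_scale: "clinear f \<Longrightarrow> f (c *\<^sub>C x) = c *\<^sub>C f x"
  by (rule Modules.module_hom.scale[OF Vector_Spaces.linear.axioms(3)])

lemma clinear_diff: "clinear f \<Longrightarrow> f (x - y) = f x - f y"
  by (rule Modules.module_hom.diff[OF Vector_Spaces.linear.axioms(3)])

lemma clinear_zero: "clinear f \<Longrightarrow> f 0 = 0"
  by (rule Modules.module_hom.zero[OF Vector_Spaces.linear.axioms(3)])

instantiation complex :: complex_vector
begin
definition scaleC_complex :: "complex \<Rightarrow> complex \<Rightarrow> complex" where
  "scaleC_complex = (*)"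
instance by standard (simp_all add: scaleC_complex_def algebra_simps)
end

text \<open>\<^typ>\<open>'x \<Rightarrow>\<^sub>0 complex\<close> is the vector space with basis \<^typ>\<open>'x\<close>.\<close>

instantiation poly_mapping :: (type, complex_vector) complex_vector
begin
lift_definition scaleC_poly_mapping :: "complex \<Rightarrow> ('a \<Rightarrow>\<^sub>0 'b) \<Rightarrow> 'a \<Rightarrow>\<^sub>0 'b"
  is "\<lambda>c p k. c *\<^sub>C p k"
  by (erule rev_finite_subset) (auto simp: cvs.scale_zero_right)
instance
  by standard (transfer; simp add: fun_eq_iff scaleC_add_right scaleC_add_left scaleC_scaleC
      scaleC_one)+
end

definition free_ext :: "('x \<Rightarrow> 'b::complex_vector) \<Rightarrow> ('x \<Rightarrow>\<^sub>0 complex) \<Rightarrow> 'b" where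
  "free_ext f p = (\<Sum>k\<in>Poly_Mapping.keys p. Poly_Mapping.lookup p k *\<^sub>C f k)"

lemma free_ext_superset:
  assumes "finite A" "Poly_Mapping.keys p \<subseteq> A"
  shows "free_ext f p = (\<Sum>k\<in>A. Poly_Mapping.lookup p k *\<^sub>C f k)"
  unfolding free_ext_def using assms
  by (intro sum.mono_neutral_left) (auto simp: in_keys_iff)

lemma clinear_free_ext: "clinear (free_ext f)"
proof (rule clinearI)
  fix p q :: "'a \<Rightarrow>\<^sub>0 complex" and c
  let ?A = "Poly_Mapping.keys p \<union> Poly_Mapping.keys q"
  have "Poly_Mapping.keys (p + q) \<subseteq> ?A" by (rule keys_add)
  then show "free_ext f (p + q) = free_ext f p + free_ext f q"
    by (simp add: free_ext_superset[of ?A] lookup_add scaleC_add_left sum.distrib)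
  have "Poly_Mapping.keys (c *\<^sub>C p) \<subseteq> Poly_Mapping.keys p"
    by transfer (auto simp: cvs.scale_zero_right)
  moreover have "Poly_Mapping.lookup (c *\<^sub>C p) k = c * Poly_Mapping.lookup p k" for k
    by transfer (simp add: scaleC_complex_def)
  ultimately show "free_ext f (c *\<^sub>C p) = c *\<^sub>C free_ext f p"
    by (simp add: free_ext_superset[of "Poly_Mapping.keys p"] cvs.scale_sum_right scaleC_scaleC)
qed

lemma free_ext_single: "free_ext f (Poly_Mapping.single k c) = c *\<^sub>C f k"
  by (simp add: free_ext_superset[of "{k}"])

lemma clinear_cspan_zero:
  assumes "clinear f" "\<And>x. x \<in> S \<Longrightarrow> f x = 0" "x \<in> cspan S"
  shows "f x = 0"
  using assms(3)
proof (induction rule: cvs.span_induct_alt)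
  case base show ?case by (rule clinear_zero[OF assms(1)])
next
  case (step c x y) then show ?case
    by (simp add: clinear_add[OF assms(1)] clinear_scale[OF assms(1)] assms(2) cvs.scale_zero_right)
qed

lemma scaleC_single:
  "c *\<^sub>C Poly_Mapping.single k (d::complex) = Poly_Mapping.single k (c * d)"
  by transfer (auto simp: fun_eq_iff when_def scaleC_complex_def)

lemma free_induct:
  assumes "P 0" "\<And>k c p. P p \<Longrightarrow> P (c *\<^sub>C Poly_Mapping.single k 1 + p)"
  shows "P (p :: 'x \<Rightarrow>\<^sub>0 complex)"
proof (induction "card (Poly_Mapping.keys p)" arbitrary: p)
  case 0 then show ?case using assms(1) by simp
next
  case (Suc n)
  then obtain k where k: "k \<in> Poly_Mapping.keys p" by fastforce
  define q where "q = p - Poly_Mapping.single k (Poly_Mapping.lookup p k)"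
  have "Poly_Mapping.keys q = Poly_Mapping.keys p - {k}"
    by (auto simp: q_def in_keys_iff lookup_minus lookup_single when_def split: if_splits)
  then have "P q" using Suc k by simp
  moreover have "p = Poly_Mapping.lookup p k *\<^sub>C Poly_Mapping.single k 1 + q"
    by (simp add: q_def scaleC_single)
  ultimately show ?case using assms(2) by metis
qed


section \<open>Tensor products and coalgebras\<close>

definition tensor_relations ::
    "('a::complex_vector \<times> 'b::complex_vector \<Rightarrow>\<^sub>0 complex) set" where
  "tensor_relations =
     {Poly_Mapping.single (x + x', y) 1 - Poly_Mapping.single (x, y) 1
        - Poly_Mapping.single (x', y) 1 | x x' y. True} \<union>
     {Poly_Mapping.single (x, y + y') 1 - Poly_Mapping.single (x, y) 1
        - Poly_Mapping.single (x, y') 1 | x y y'. True} \<union>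
     {Poly_Mapping.single (c *\<^sub>C x, y) 1 - Poly_Mapping.single (x, y) c | c x y. True} \<union>
     {Poly_Mapping.single (x, c *\<^sub>C y) 1 - Poly_Mapping.single (x, y) c | c x y. True}"

lemma equivp_cspan: "equivp (\<lambda>p q. p - q \<in> cspan S)"
proof (rule equivpI)
  show "reflp (\<lambda>p q. p - q \<in> cspan S)" by (auto simp: reflp_def cvs.span_zero)
  show "symp (\<lambda>p q. p - q \<in> cspan S)"
    unfolding symp_def by (metis cvs.span_neg minus_diff_eq)
  show "transp (\<lambda>p q. p - q \<in> cspan S)"
    unfolding transp_def by (metis cvs.span_add diff_add_cancel add_diff_eq)
qed

lemma cspan_cong:
  "p - p' \<in> cspan S \<Longrightarrow> q - q' \<in> cspan S \<Longrightarrow> (p + q) - (p' + q') \<in> cspan S"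
  "p - p' \<in> cspan S \<Longrightarrow> - p - (- p') \<in> cspan S"
  "p - p' \<in> cspan S \<Longrightarrow> q - q' \<in> cspan S \<Longrightarrow> (p - q) - (p' - q') \<in> cspan S"
  "p - p' \<in> cspan S \<Longrightarrow> c *\<^sub>C p - c *\<^sub>C p' \<in> cspan S"
  using cvs.span_add[of "p - p'" S "q - q'"] cvs.span_neg[of "p - p'" S]
    cvs.span_diff[of "p - p'" S "q - q'"] cvs.span_scale[of "p - p'" S c]
  by (simp_all add: algebra_simps cvs.scale_right_diff_distrib)

quotient_type (overloaded) ('a, 'b) tensor =
  "('a::complex_vector \<times> 'b::complex_vector) \<Rightarrow>\<^sub>0 complex" /
  "\<lambda>p q. p - q \<in> cspan tensor_relations"
  by (rule equivp_cspan)

lemma abs_rep_tensor: "abs_tensor (rep_tensor z) = z"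
  by (rule Quotient3_abs_rep[OF Quotient3_tensor])

instantiation tensor :: (complex_vector, complex_vector) complex_vector
begin
lift_definition zero_tensor :: "('a, 'b) tensor" is 0 .
lift_definition plus_tensor :: "('a, 'b) tensor \<Rightarrow> ('a, 'b) tensor \<Rightarrow> ('a, 'b) tensor" is "(+)"
  by (rule cspan_cong)
lift_definition uminus_tensor :: "('a, 'b) tensor \<Rightarrow> ('a, 'b) tensor" is uminus
  by (rule cspan_cong)
lift_definition minus_tensor :: "('a, 'b) tensor \<Rightarrow> ('a, 'b) tensor \<Rightarrow> ('a, 'b) tensor" is "(-)"
  by (rule cspan_cong)
lift_definition scaleC_tensor :: "complex \<Rightarrow> ('a, 'b) tensor \<Rightarrow> ('a, 'b) tensor" is scaleC
  by (rule cspan_cong)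
instance
  by standard (transfer; simp add: algebra_simps scaleC_add_right scaleC_add_left scaleC_scaleC
      scaleC_one cvs.span_zero)+
end

lift_definition tens :: "'a::complex_vector \<Rightarrow> 'b::complex_vector \<Rightarrow> ('a, 'b) tensor"
  is "\<lambda>x y. Poly_Mapping.single (x, y) 1" .

text \<open>The linear map on the tensor product induced by a bilinear map. It is computed on an
  arbitrarily chosen representative; for bilinear maps the choice is irrelevant.\<close>

definition tensor_ext ::
    "('a::complex_vector \<Rightarrow> 'b::complex_vector \<Rightarrow> 'c::complex_vector) \<Rightarrow> ('a, 'b) tensor \<Rightarrow> 'c" where
  "tensor_ext \<beta> z = free_ext (\<lambda>(x, y). \<beta> x y) (rep_tensor z)"

lemma tensor_ext_abs:
  assumes "\<And>y. clinear (\<lambda>x. \<beta> x y)" "\<And>x. clinear (\<beta> x)"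
  shows "tensor_ext \<beta> (abs_tensor p) = free_ext (\<lambda>(x, y). \<beta> x y) p"
proof -
  note l = clinear_free_ext[of "\<lambda>(x, y). \<beta> x y"]
  have "rep_tensor (abs_tensor p) - p \<in> cspan tensor_relations"
    unfolding tensor.abs_eq_iff[symmetric] by (rule abs_rep_tensor)
  then have "free_ext (\<lambda>(x, y). \<beta> x y) (rep_tensor (abs_tensor p) - p) = 0"
    by (rule clinear_cspan_zero[OF l, rotated])
      (auto simp: tensor_relations_def clinear_diff[OF l] free_ext_single scaleC_one
        clinear_add[OF assms(1)] clinear_add[OF assms(2)]
        clinear_scale[OF assms(1)] clinear_scale[OF assms(2)])
  then show ?thesis by (simp add: tensor_ext_def clinear_diff[OF l])
qed

lemma tensor_ext_tens:
  assumes "\<And>y. clinear (\<lambda>x. \<beta> x y)" "\<And>x. clinear (\<beta> x)"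
  shows "tensor_ext \<beta> (tens x y) = \<beta> x y"
  by (simp add: tens.abs_eq tensor_ext_abs[OF assms] free_ext_single scaleC_one)

lemma clinear_tensor_ext:
  assumes "\<And>y. clinear (\<lambda>x. \<beta> x y)" "\<And>x. clinear (\<beta> x)"
  shows "clinear (tensor_ext \<beta>)"
proof (rule clinearI)
  fix z w :: "('b, 'a) tensor" and c
  obtain p q where zw: "z = abs_tensor p" "w = abs_tensor q"
    using abs_rep_tensor[symmetric] by blast
  show "tensor_ext \<beta> (z + w) = tensor_ext \<beta> z + tensor_ext \<beta> w"
    unfolding zw plus_tensor.abs_eq tensor_ext_abs[OF assms] by (rule clinear_add[OF clinear_free_ext])
  show "tensor_ext \<beta> (c *\<^sub>C z) = c *\<^sub>C tensor_ext \<beta> z"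
    unfolding zw scaleC_tensor.abs_eq tensor_ext_abs[OF assms] by (rule clinear_scale[OF clinear_free_ext])
qed

locale coalgebra =
  fixes \<Delta> :: "'h::complex_vector \<Rightarrow> ('h, 'h) tensor" and \<epsilon> :: "'h \<Rightarrow> complex"
  assumes comult_linear: "clinear \<Delta>"
    and counit_linear: "clinear \<epsilon>"
    and coassoc: "tensor_ext (\<lambda>x y. tensor_ext (\<lambda>u v. tens u (tens v y)) (\<Delta> x)) (\<Delta> h)
                  = tensor_ext (\<lambda>x y. tens x (\<Delta> y)) (\<Delta> h)"
    and counit_left: "tensor_ext (\<lambda>x y. \<epsilon> x *\<^sub>C y) (\<Delta> h) = h"
    and counit_right: "tensor_ext (\<lambda>x y. \<epsilon> y *\<^sub>C x) (\<Delta> h) = h"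


section \<open>The algebra W(H)\<close>

text \<open>\<^term>\<open>Gen h\<close> is the symbol \<open>h\<close>, \<^term>\<open>Om h\<close> the symbol \<open>\<omega>\<^sub>h\<close>.\<close>

datatype 'h gen = Gen 'h | Om 'h

primrec gdeg :: "'h gen \<Rightarrow> nat" where
  "gdeg (Gen h) = 1"
| "gdeg (Om h) = 2"

definition wdeg :: "'h gen list \<Rightarrow> nat" where
  "wdeg w = sum_list (map gdeg w)"

definition weil_relations :: "('h::complex_vector gen list \<Rightarrow>\<^sub>0 complex) set" where
  "weil_relations =
     {Poly_Mapping.single (u @ g (x + y) # v) 1 - Poly_Mapping.single (u @ g x # v) 1
        - Poly_Mapping.single (u @ g y # v) 1 | u v x y g. g \<in> {Gen, Om}} \<union>
     {Poly_Mapping.single (u @ g (c *\<^sub>C x) # v) 1 - Poly_Mapping.single (u @ g x # v) c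
        | u v c x g. g \<in> {Gen, Om}}"

text \<open>The type is \<open>W(H)\<close> with unit adjoined, the unit being the class of the empty word.\<close>

quotient_type (overloaded) 'h weil =
  "'h::complex_vector gen list \<Rightarrow>\<^sub>0 complex" / "\<lambda>p q. p - q \<in> cspan weil_relations"
  by (rule equivp_cspan)

lemma abs_rep_weil: "abs_weil (rep_weil z) = z"
  by (rule Quotient3_abs_rep[OF Quotient3_weil])

instantiation weil :: (complex_vector) complex_vector
begin
lift_definition zero_weil :: "'a weil" is 0 .
lift_definition plus_weil :: "'a weil \<Rightarrow> 'a weil \<Rightarrow> 'a weil" is "(+)"
  by (rule cspan_cong)
lift_definition uminus_weil :: "'a weil \<Rightarrow> 'a weil" is uminus
  by (rule cspan_cong)
lift_definition minus_weil :: "'a weil \<Rightarrow> 'a weil \<Rightarrow> 'a weil" is "(-)"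
  by (rule cspan_cong)
lift_definition scaleC_weil :: "complex \<Rightarrow> 'a weil \<Rightarrow> 'a weil" is scaleC
  by (rule cspan_cong)
instance
  by standard (transfer; simp add: algebra_simps scaleC_add_right scaleC_add_left scaleC_scaleC
      scaleC_one cvs.span_zero)+
end

lift_definition word :: "'h::complex_vector gen list \<Rightarrow> 'h weil"
  is "\<lambda>w. Poly_Mapping.single w 1" .

text \<open>Linear extension of a function on words; again it is computed on a chosen representative,
  whose choice is irrelevant if the function is linear in each letter.\<close>

definition weil_ext :: "('h::complex_vector gen list \<Rightarrow> 'b::complex_vector) \<Rightarrow> 'h weil \<Rightarrow> 'b" where
  "weil_ext f x = free_ext f (rep_weil x)"

definition word_linear :: "('h::complex_vector gen list \<Rightarrow> 'b::complex_vector) \<Rightarrow> bool" where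
  "word_linear f \<longleftrightarrow> (\<forall>u v. \<forall>g\<in>{Gen, Om}. clinear (\<lambda>x. f (u @ g x # v)))"

lemma weil_ext_abs:
  assumes "word_linear f"
  shows "weil_ext f (abs_weil p) = free_ext f p"
proof -
  note l = clinear_free_ext[of f]
  have f: "clinear (\<lambda>x. f (u @ Gen x # v))" "clinear (\<lambda>x. f (u @ Om x # v))" for u v
    using assms by (auto simp: word_linear_def)
  have "rep_weil (abs_weil p) - p \<in> cspan weil_relations"
    unfolding weil.abs_eq_iff[symmetric] by (rule abs_rep_weil)
  then have "free_ext f (rep_weil (abs_weil p) - p) = 0"
    by (rule clinear_cspan_zero[OF l, rotated])
      (auto simp: weil_relations_def clinear_diff[OF l] free_ext_single scaleC_one
        clinear_add[OF f(1)] clinear_add[OF f(2)] clinear_scale[OF f(1)] clinear_scale[OF f(2)])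
  then show ?thesis by (simp add: weil_ext_def clinear_diff[OF l])
qed

lemma weil_ext_word: "word_linear f \<Longrightarrow> weil_ext f (word w) = f w"
  by (simp add: word.abs_eq weil_ext_abs free_ext_single scaleC_one)

lemma clinear_weil_ext:
  assumes "word_linear f"
  shows "clinear (weil_ext f)"
proof (rule clinearI)
  fix z w :: "'a weil" and c
  obtain p q where zw: "z = abs_weil p" "w = abs_weil q"
    using abs_rep_weil[symmetric] by blast
  show "weil_ext f (z + w) = weil_ext f z + weil_ext f w"
    unfolding zw plus_weil.abs_eq weil_ext_abs[OF assms] by (rule clinear_add[OF clinear_free_ext])
  show "weil_ext f (c *\<^sub>C z) = c *\<^sub>C weil_ext f z"
    unfolding zw scaleC_weil.abs_eq weil_ext_abs[OF assms] by (rule clinear_scale[OF clinear_free_ext])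
qed

lemma weil_induct [case_names zero step]:
  assumes "P 0" "\<And>c w x. P x \<Longrightarrow> P (c *\<^sub>C word w + x)"
  shows "P x"
proof -
  obtain p where x: "x = abs_weil p" using abs_rep_weil[symmetric] by blast
  have "P (abs_weil p)"
  proof (induction p rule: free_induct)
    case 1 show ?case using assms(1) by (simp add: zero_weil_def)
  next
    case (2 k c p) then show ?case using assms(2)
      by (simp add: plus_weil.abs_eq[symmetric] scaleC_weil.abs_eq[symmetric] word.abs_eq[symmetric])
  qed
  with x show ?thesis by simp
qed

lemma clinear_weil_eq:
  assumes "clinear f" "clinear g" "\<And>w. f (word w) = g (word w)"
  shows "f x = g x"
  by (induction x rule: weil_induct)
    (simp_all add: clinear_zero[OF assms(1)] clinear_zero[OF assms(2)] clinear_add[OF assms(1)]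
      clinear_add[OF assms(2)] clinear_scale[OF assms(1)] clinear_scale[OF assms(2)] assms(3))

lemma word_linear_word: "word_linear word"
  unfolding word_linear_def
proof (intro allI ballI clinearI)
  fix u v :: "'a gen list" and g :: "'a \<Rightarrow> 'a gen" and x y c assume g: "g \<in> {Gen, Om}"
  have "Poly_Mapping.single (u @ g (x + y) # v) 1 - Poly_Mapping.single (u @ g x # v) 1
      - Poly_Mapping.single (u @ g y # v) 1 \<in> cspan weil_relations"
    using g unfolding weil_relations_def by (intro cvs.span_base) blast
  then show "word (u @ g (x + y) # v) = word (u @ g x # v) + word (u @ g y # v)"
    by (simp add: word.abs_eq plus_weil.abs_eq weil.abs_eq_iff diff_diff_eq)
  have "Poly_Mapping.single (u @ g (c *\<^sub>C x) # v) 1 - Poly_Mapping.single (u @ g x # v) c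
      \<in> cspan weil_relations"
    using g unfolding weil_relations_def by (intro cvs.span_base) blast
  then show "word (u @ g (c *\<^sub>C x) # v) = c *\<^sub>C word (u @ g x # v)"
    by (simp add: word.abs_eq scaleC_weil.abs_eq weil.abs_eq_iff scaleC_single)
qed

definition weil_mult :: "'h::complex_vector weil \<Rightarrow> 'h weil \<Rightarrow> 'h weil" where
  "weil_mult x y = weil_ext (\<lambda>u. weil_ext (\<lambda>v. word (u @ v)) y) x"

lemma word_linear_append:
  fixes u v :: "'a::complex_vector gen list"
  shows "word_linear (\<lambda>v. word (u @ v))" "word_linear (\<lambda>u. word (u @ v))"
proof -
  have "clinear (\<lambda>x. word ((u @ u') @ g x # w))" "clinear (\<lambda>x. word (u' @ g x # (w @ v)))"
    if "g \<in> {Gen, Om}" for u' w and g :: "'a \<Rightarrow> 'a gen"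
    using word_linear_word that unfolding word_linear_def by blast+
  then show "word_linear (\<lambda>v. word (u @ v))" "word_linear (\<lambda>u. word (u @ v))"
    unfolding word_linear_def by simp_all
qed

lemma clinear_const_scale: "clinear f \<Longrightarrow> clinear (\<lambda>x. c *\<^sub>C f x)"
  by (rule clinearI)
    (simp_all add: clinear_add clinear_scale scaleC_add_right scaleC_scaleC mult.commute)

lemma clinear_sum2: "clinear f \<Longrightarrow> clinear g \<Longrightarrow> clinear (\<lambda>x. f x + g x)"
  by (rule clinearI)
    (simp_all add: clinear_add clinear_scale scaleC_add_right algebra_simps)

lemma clinear_zero_fun: "clinear (\<lambda>x. 0)"
  by (rule clinearI) (simp_all add: cvs.scale_zero_right)

lemma weil_ext_combination:
  fixes F :: "'a::complex_vector gen list \<Rightarrow> 'b::complex_vector gen list \<Rightarrow> 'c::complex_vector"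
  assumes "\<And>v. word_linear (\<lambda>u. F u v)" "\<And>u. word_linear (F u)"
  shows "word_linear (\<lambda>u. weil_ext (F u) y)"
  unfolding word_linear_def
proof (intro allI ballI)
  fix u v and g :: "'a \<Rightarrow> 'a gen" assume g: "g \<in> {Gen, Om}"
  have F: "clinear (\<lambda>x. F (u @ g x # v) w)" for w
    using assms(1) g by (auto simp: word_linear_def)
  show "clinear (\<lambda>x. weil_ext (F (u @ g x # v)) y)"
  proof (induction y rule: weil_induct)
    case zero
    then show ?case by (simp add: clinear_zero[OF clinear_weil_ext[OF assms(2)]] clinear_zero_fun)
  next
    case (step c w y)
    have "weil_ext (F u') (c *\<^sub>C word w + y) = c *\<^sub>C F u' w + weil_ext (F u') y" for u'
      by (simp add: clinear_add[OF clinear_weil_ext[OF assms(2)]]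
          clinear_scale[OF clinear_weil_ext[OF assms(2)]] weil_ext_word[OF assms(2)])
    then show ?case using clinear_sum2[OF clinear_const_scale[OF F] step] by simp
  qed
qed

lemma word_linear_mult: "word_linear (\<lambda>u. weil_ext (\<lambda>v. word (u @ v)) y)"
  by (rule weil_ext_combination) (rule word_linear_append)+

lemma weil_mult_linear_left: "clinear (\<lambda>x. weil_mult x y)"
  unfolding weil_mult_def by (rule clinear_weil_ext[OF word_linear_mult])

lemma weil_mult_word_left: "weil_mult (word u) y = weil_ext (\<lambda>v. word (u @ v)) y"
  unfolding weil_mult_def by (rule weil_ext_word[OF word_linear_mult])

lemma weil_mult_word: "weil_mult (word u) (word v) = word (u @ v)"
  by (simp add: weil_mult_word_left weil_ext_word[OF word_linear_append(1)])

lemma weil_mult_linear_right: "clinear (weil_mult x)"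
proof (induction x rule: weil_induct)
  case zero
  have "weil_mult 0 y = 0" for y :: "'a weil" by (rule clinear_zero[OF weil_mult_linear_left])
  then have "weil_mult 0 = (\<lambda>y::'a weil. 0)" by (rule ext)
  then show ?case by (simp only: clinear_zero_fun)
next
  case (step c w x)
  have "weil_mult (c *\<^sub>C word w + x) = (\<lambda>y. c *\<^sub>C weil_mult (word w) y + weil_mult x y)"
    by (rule ext) (simp add: clinear_add[OF weil_mult_linear_left]
        clinear_scale[OF weil_mult_linear_left])
  moreover have "clinear (weil_mult (word w))"
    unfolding weil_mult_word_left[abs_def] by (rule clinear_weil_ext[OF word_linear_append(1)])
  ultimately show ?case using step by (simp add: clinear_sum2 clinear_const_scale)
qed

lemma weil_mult_assoc: "weil_mult (weil_mult x y) z = weil_mult x (weil_mult y z)"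
proof (induction x rule: weil_induct)
  case zero show ?case by (simp add: clinear_zero[OF weil_mult_linear_left])
next
  case (step c u x)
  have "weil_mult (weil_mult (word u) y) z = weil_mult (word u) (weil_mult y z)"
  proof (induction y rule: weil_induct)
    case zero show ?case by (simp add: clinear_zero[OF weil_mult_linear_left]
          clinear_zero[OF weil_mult_linear_right])
  next
    case (step c v y)
    have "weil_mult (word (u @ v)) z = weil_mult (word u) (weil_mult (word v) z)"
      by (induction z rule: weil_induct)
        (simp_all add: clinear_zero[OF weil_mult_linear_right] weil_mult_word
          clinear_add[OF weil_mult_linear_right] clinear_scale[OF weil_mult_linear_right])
    with step show ?case
      by (simp add: clinear_add[OF weil_mult_linear_right] clinear_scale[OF weil_mult_linear_right]
          clinear_add[OF weil_mult_linear_left] clinear_scale[OF weil_mult_linear_left]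
          weil_mult_word)
  qed
  with step show ?case
    by (simp add: clinear_add[OF weil_mult_linear_left] clinear_scale[OF weil_mult_linear_left])
qed

lemma weil_mult_one: "weil_mult (word []) x = x" "weil_mult x (word []) = x"
  by (induction x rule: weil_induct)
    (simp_all add: clinear_zero[OF weil_mult_linear_right] clinear_zero[OF weil_mult_linear_left]
      clinear_add[OF weil_mult_linear_right] clinear_scale[OF weil_mult_linear_right]
      clinear_add[OF weil_mult_linear_left] clinear_scale[OF weil_mult_linear_left] weil_mult_word)

lemma word_Nil_neq_zero: "word [] \<noteq> (0 :: 'a::complex_vector weil)"
proof
  assume *: "word [] = (0 :: 'a weil)"
  have l: "word_linear (\<lambda>w :: 'a gen list. if w = [] then 1 else 0 :: complex)"
    by (auto simp: word_linear_def intro: clinear_zero_fun)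
  show False
    using weil_ext_word[OF l, of "[]"] clinear_zero[OF clinear_weil_ext[OF l]] * by simp
qed

instantiation weil :: (complex_vector) ring_1
begin
definition one_weil :: "'a weil" where "one_weil = word []"
definition times_weil :: "'a weil \<Rightarrow> 'a weil \<Rightarrow> 'a weil" where "times_weil = weil_mult"
instance
  by standard (simp_all add: one_weil_def times_weil_def weil_mult_assoc weil_mult_one
      clinear_add[OF weil_mult_linear_right] clinear_add[OF weil_mult_linear_left]
      word_Nil_neq_zero)
end

lemma word_append: "word (u @ v) = word u * word v"
  by (simp add: times_weil_def weil_mult_word)

lemma word_Cons: "word (a # w) = word [a] * word w"
  using word_append[of "[a]" w] by simp

lemma one_weil_word: "1 = word []"
  by (simp add: one_weil_def)

lemma scaleC_mult_left: "(c *\<^sub>C x) * y = c *\<^sub>C (x * y)" for x y :: "'h::complex_vector weil"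
  by (simp add: times_weil_def clinear_scale[OF weil_mult_linear_left])

lemma scaleC_mult_right: "x * (c *\<^sub>C y) = c *\<^sub>C (x * y)" for x y :: "'h::complex_vector weil"
  by (simp add: times_weil_def clinear_scale[OF weil_mult_linear_right])

abbreviation gen :: "'h::complex_vector \<Rightarrow> 'h weil" where
  "gen h \<equiv> word [Gen h]"

abbreviation om :: "'h::complex_vector \<Rightarrow> 'h weil" where
  "om h \<equiv> word [Om h]"

lemma clinear_gen: "clinear gen" and clinear_om: "clinear om"
  using word_linear_word[unfolded word_linear_def, rule_format, of _ "[]" "[]"] by auto


subsection \<open>Operators\<close>

primrec derivation_word ::
    "('h::complex_vector gen \<Rightarrow> 'h weil) \<Rightarrow> 'h gen list \<Rightarrow> 'h weil" where
  "derivation_word D [] = 0"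
| "derivation_word D (a # w) =
     D a * word w + (-1) ^ gdeg a *\<^sub>C (word [a] * derivation_word D w)"

text \<open>\<^term>\<open>derivation D\<close> is the graded derivation of degree 1 with values \<^term>\<open>D\<close> on generators.\<close>

definition derivation ::
    "('h::complex_vector gen \<Rightarrow> 'h weil) \<Rightarrow> 'h weil \<Rightarrow> 'h weil" where
  "derivation D = weil_ext (derivation_word D)"

primrec diff0_gen ::
    "('h::complex_vector \<Rightarrow> ('h, 'h) tensor) \<Rightarrow> 'h gen \<Rightarrow> 'h weil" where
  "diff0_gen \<Delta> (Gen h) = - tensor_ext (\<lambda>x y. gen x * gen y) (\<Delta> h)"
| "diff0_gen \<Delta> (Om h) =
     tensor_ext (\<lambda>x y. om x * gen y) (\<Delta> h) - tensor_ext (\<lambda>x y. gen x * om y) (\<Delta> h)"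

primrec diff_gen ::
    "('h::complex_vector \<Rightarrow> ('h, 'h) tensor) \<Rightarrow> 'h gen \<Rightarrow> 'h weil" where
  "diff_gen \<Delta> (Gen h) = om h - tensor_ext (\<lambda>x y. gen x * gen y) (\<Delta> h)"
| "diff_gen \<Delta> (Om h) =
     tensor_ext (\<lambda>x y. om x * gen y) (\<Delta> h) - tensor_ext (\<lambda>x y. gen x * om y) (\<Delta> h)"

definition weil_diff ::
    "('h::complex_vector \<Rightarrow> ('h, 'h) tensor) \<Rightarrow> 'h weil \<Rightarrow> 'h weil" where
  "weil_diff \<Delta> = derivation (diff_gen \<Delta>)"

definition weil_diff0 ::
    "('h::complex_vector \<Rightarrow> ('h, 'h) tensor) \<Rightarrow> 'h weil \<Rightarrow> 'h weil" where
  "weil_diff0 \<Delta> = derivation (diff0_gen \<Delta>)"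

text \<open>The values of \<open>t\<close>, \<open>N\<close> and \<open>b\<^sub>t\<close> at the empty word are immaterial, since these operators
  are only used on the non-unital algebra.\<close>

primrec cyc_word :: "'h::complex_vector gen list \<Rightarrow> 'h weil" where
  "cyc_word [] = word []"
| "cyc_word (a # w) = (-1) ^ (gdeg a * wdeg w) *\<^sub>C (word w * word [a])"

definition cyc :: "'h::complex_vector weil \<Rightarrow> 'h weil" where
  "cyc = weil_ext cyc_word"

definition norm_word :: "'h::complex_vector gen list \<Rightarrow> 'h weil" where
  "norm_word w = (\<Sum>i<length w. (cyc ^^ i) (word w))"

definition cyc_norm :: "'h::complex_vector weil \<Rightarrow> 'h weil" where
  "cyc_norm = weil_ext norm_word"

primrec bt_word ::
    "('h::complex_vector \<Rightarrow> ('h, 'h) tensor) \<Rightarrow> 'h gen list \<Rightarrow> 'h weil" where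
  "bt_word \<Delta> [] = 0"
| "bt_word \<Delta> (a # w) = cyc (weil_diff0 \<Delta> (word [a]) * word w)"

definition weil_bt ::
    "('h::complex_vector \<Rightarrow> ('h, 'h) tensor) \<Rightarrow> 'h weil \<Rightarrow> 'h weil" where
  "weil_bt \<Delta> = weil_ext (bt_word \<Delta>)"

definition weil_b ::
    "('h::complex_vector \<Rightarrow> ('h, 'h) tensor) \<Rightarrow> 'h weil \<Rightarrow> 'h weil" where
  "weil_b \<Delta> x = weil_diff \<Delta> x + weil_bt \<Delta> x"

definition cyc_minus_one :: "'h::complex_vector weil \<Rightarrow> 'h weil" where
  "cyc_minus_one x = cyc x - x"


subsection \<open>The defining equations of the operators\<close>

lemma clinear_comp: "clinear f \<Longrightarrow> clinear g \<Longrightarrow> clinear (\<lambda>x. f (g x))"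
  by (rule clinearI) (simp_all add: clinear_add clinear_scale)

lemma clinear_minus: "clinear f \<Longrightarrow> clinear (\<lambda>x. - f x)"
  using clinear_const_scale[of f "-1"] by (simp add: scaleC_one cvs.scale_minus_left)

lemma clinear_diff_fun: "clinear f \<Longrightarrow> clinear g \<Longrightarrow> clinear (\<lambda>x. f x - g x)"
  using clinear_sum2[OF _ clinear_minus, of f g] by simp

lemma clinear_sum_fun: "(\<And>i. i \<in> A \<Longrightarrow> clinear (f i)) \<Longrightarrow> clinear (\<lambda>x. \<Sum>i\<in>A. f i x)"
  by (induction A rule: infinite_finite_induct) (simp_all add: clinear_zero_fun clinear_sum2)

lemma clinear_mult_left: "clinear f \<Longrightarrow> clinear (\<lambda>x. f x * y)" for y :: "'h::complex_vector weil"
  by (rule clinearI) (simp_all add: clinear_add clinear_scale scaleC_mult_left algebra_simps)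

lemma clinear_mult_right: "clinear f \<Longrightarrow> clinear (\<lambda>x. y * f x)" for y :: "'h::complex_vector weil"
  by (rule clinearI) (simp_all add: clinear_add clinear_scale scaleC_mult_right algebra_simps)

lemma gdeg_letter: "g \<in> {Gen, Om} \<Longrightarrow> gdeg (g x) = gdeg (g 0)"
  by auto

lemma wdeg_letter: "g \<in> {Gen, Om} \<Longrightarrow> wdeg (u @ g x # v) = wdeg (u @ g 0 # v)"
  by (auto simp: wdeg_def)

lemma clinear_letter: "g \<in> {Gen, Om} \<Longrightarrow> clinear (\<lambda>x. word (u @ g x # v))"
  using word_linear_word by (auto simp: word_linear_def)

lemma clinear_diff0_gen:
  assumes "clinear \<Delta>" "g \<in> {Gen, Om}"
  shows "clinear (\<lambda>x. diff0_gen \<Delta> (g x))" "clinear (\<lambda>x. diff_gen \<Delta> (g x))"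
proof -
  have *: "clinear (tensor_ext (\<lambda>x y. gen x * gen y))" "clinear (tensor_ext (\<lambda>x y. om x * gen y))"
    "clinear (tensor_ext (\<lambda>x y. gen x * om y))"
    by (intro clinear_tensor_ext clinear_mult_left clinear_mult_right clinear_gen clinear_om)+
  note ** = *[THEN clinear_comp, OF assms(1)]
  show "clinear (\<lambda>x. diff0_gen \<Delta> (g x))" "clinear (\<lambda>x. diff_gen \<Delta> (g x))"
    using assms(2) by (auto intro!: clinear_minus clinear_diff_fun ** clinear_om)
qed

lemma word_linear_derivation_word:
  assumes "\<And>g. g \<in> {Gen, Om} \<Longrightarrow> clinear (\<lambda>x. D (g x))"
  shows "word_linear (derivation_word D)"
  unfolding word_linear_def
proof (intro allI ballI)
  fix u v and g :: "'a \<Rightarrow> 'a gen" assume g: "g \<in> {Gen, Om}"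
  show "clinear (\<lambda>x. derivation_word D (u @ g x # v))"
  proof (induction u)
    case Nil
    show ?case using g clinear_letter[OF g, of "[]" "[]"] unfolding append_Nil derivation_word.simps
      by (subst gdeg_letter[OF g])
        (auto intro!: clinear_sum2 clinear_mult_left clinear_const_scale assms)
  next
    case (Cons a u)
    then show ?case using clinear_letter[OF g]
      by (auto intro!: clinear_sum2 clinear_mult_right clinear_const_scale)
  qed
qed

lemma clinear_derivation:
  assumes "\<And>g. g \<in> {Gen, Om} \<Longrightarrow> clinear (\<lambda>x. D (g x))"
  shows "clinear (derivation D)"
  unfolding derivation_def by (intro clinear_weil_ext word_linear_derivation_word assms)

lemma derivation_gen:
  assumes "\<And>g. g \<in> {Gen, Om} \<Longrightarrow> clinear (\<lambda>x. D (g x))"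
  shows "derivation D (word [a]) = D a"
  using weil_ext_word[OF word_linear_derivation_word[of D], of "[a]"] assms
  by (simp add: derivation_def one_weil_word[symmetric])

lemma derivation_Leibniz:
  assumes D: "\<And>g. g \<in> {Gen, Om} \<Longrightarrow> clinear (\<lambda>x. D (g x))"
  shows "derivation D (word u * y) =
           derivation D (word u) * y + (-1) ^ wdeg u *\<^sub>C (word u * derivation D y)"
proof -
  have e: "derivation D (word w) = derivation_word D w" for w
    unfolding derivation_def by (rule weil_ext_word[OF word_linear_derivation_word[OF D]])
  have "derivation_word D (u @ v) = derivation_word D u * word v
          + (-1) ^ wdeg u *\<^sub>C (word u * derivation_word D v)" for v
  proof (induction u)
    case Nil show ?case by (simp add: wdeg_def one_weil_word[symmetric] scaleC_one)
  next
    case (Cons a u)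
    have s: "(-1) ^ gdeg a *\<^sub>C (-1) ^ wdeg u *\<^sub>C z = (-1) ^ wdeg (a # u) *\<^sub>C z" for z :: "'a weil"
      by (simp add: wdeg_def scaleC_scaleC power_add)
    have "derivation_word D ((a # u) @ v) = D a * (word u * word v) + (-1) ^ gdeg a *\<^sub>C
        (word [a] * (derivation_word D u * word v + (-1) ^ wdeg u *\<^sub>C (word u * derivation_word D v)))"
      by (simp only: append_Cons derivation_word.simps Cons word_append)
    also have "\<dots> = (D a * word u + (-1) ^ gdeg a *\<^sub>C (word [a] * derivation_word D u)) * word v
        + (-1) ^ wdeg (a # u) *\<^sub>C (word [a] * word u * derivation_word D v)"
      by (simp only: distrib_left distrib_right scaleC_mult_left scaleC_mult_right scaleC_add_right
          mult.assoc add.assoc s)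
    finally show ?case by (simp only: derivation_word.simps word_Cons[of a u])
  qed
  then have w: "derivation D (word u * word v) =
      derivation D (word u) * word v + (-1) ^ wdeg u *\<^sub>C (word u * derivation D (word v))" for v
    by (simp add: e flip: word_append)
  have 1: "clinear (\<lambda>y. derivation D (word u * y))"
    by (intro clinear_comp[OF clinear_derivation[OF D]] clinearI)
      (simp_all add: distrib_left scaleC_mult_right)
  have 2: "clinear (\<lambda>y. derivation D (word u) * y + (-1) ^ wdeg u *\<^sub>C (word u * derivation D y))"
    by (intro clinear_sum2 clinear_const_scale clinear_mult_right[OF clinear_derivation[OF D]] clinearI)
      (simp_all add: distrib_left scaleC_mult_right)
  show ?thesis by (rule clinear_weil_eq[OF 1 2 w])
qed

lemma word_linear_cyc_word: "word_linear cyc_word"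
  unfolding word_linear_def
proof (intro allI ballI)
  fix u v :: "'a gen list" and g :: "'a \<Rightarrow> 'a gen" assume g: "g \<in> {Gen, Om}"
  show "clinear (\<lambda>x. cyc_word (u @ g x # v))"
  proof (cases u)
    case Nil
    then show ?thesis using clinear_letter[OF g, of "[]" "[]"]
      unfolding Nil append_Nil cyc_word.simps
      by (subst gdeg_letter[OF g]) (auto intro!: clinear_mult_right clinear_const_scale)
  next
    case (Cons a u')
    show ?thesis unfolding Cons append_Cons cyc_word.simps
      by (subst wdeg_letter[OF g])
        (intro clinear_const_scale clinear_mult_left clinear_letter[OF g])
  qed
qed

lemma clinear_cyc: "clinear cyc"
  unfolding cyc_def by (intro clinear_weil_ext word_linear_cyc_word)

lemma cyc_Cons:
  "cyc (word [a] * word w) = (-1) ^ (gdeg a * wdeg w) *\<^sub>C (word w * word [a])"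
  using weil_ext_word[OF word_linear_cyc_word, of "a # w"] word_Cons[of a w] by (simp add: cyc_def)

lemma clinear_cyc_pow: "clinear (cyc ^^ i)"
proof (induction i)
  case 0 show ?case by (rule clinearI) simp_all
next
  case (Suc i) then show ?case by (auto intro: clinear_comp[OF clinear_cyc] simp: comp_def)
qed

lemma word_linear_norm_word: "word_linear norm_word"
  unfolding word_linear_def norm_word_def
  by (auto intro!: clinear_sum2 clinear_sum_fun clinear_comp[OF clinear_cyc_pow] clinear_letter)

lemma cyc_norm_word: "cyc_norm (word w) = (\<Sum>i<length w. (cyc ^^ i) (word w))"
  unfolding cyc_norm_def by (simp add: weil_ext_word[OF word_linear_norm_word] norm_word_def)

context
  fixes \<Delta> :: "'h::complex_vector \<Rightarrow> ('h, 'h) tensor"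
  assumes \<Delta>: "clinear \<Delta>"
begin

lemma weil_diff_gen:
  "weil_diff \<Delta> (gen h) = om h - tensor_ext (\<lambda>x y. gen x * gen y) (\<Delta> h)"
  unfolding weil_diff_def
  by (subst derivation_gen) (use clinear_diff0_gen[OF \<Delta>] in auto)

lemma weil_diff_om:
  "weil_diff \<Delta> (om h) =
     tensor_ext (\<lambda>x y. om x * gen y) (\<Delta> h) - tensor_ext (\<lambda>x y. gen x * om y) (\<Delta> h)"
  unfolding weil_diff_def
  by (subst derivation_gen) (use clinear_diff0_gen[OF \<Delta>] in auto)

lemma weil_diff0_gen: "weil_diff0 \<Delta> (gen h) = - tensor_ext (\<lambda>x y. gen x * gen y) (\<Delta> h)"
  unfolding weil_diff0_def
  by (subst derivation_gen) (use clinear_diff0_gen[OF \<Delta>] in auto)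

lemma weil_diff0_om: "weil_diff0 \<Delta> (om h) = weil_diff \<Delta> (om h)"
  unfolding weil_diff_om unfolding weil_diff0_def
  by (subst derivation_gen) (use clinear_diff0_gen[OF \<Delta>] in auto)

lemma weil_diff_Leibniz:
  "weil_diff \<Delta> (word u * y) =
     weil_diff \<Delta> (word u) * y + (-1) ^ wdeg u *\<^sub>C (word u * weil_diff \<Delta> y)"
  unfolding weil_diff_def
  by (rule derivation_Leibniz) (rule clinear_diff0_gen[OF \<Delta>])

lemma word_linear_bt_word: "word_linear (bt_word \<Delta>)"
  unfolding word_linear_def
proof (intro allI ballI)
  fix u v :: "'h gen list" and g :: "'h \<Rightarrow> 'h gen" assume g: "g \<in> {Gen, Om}"
  have d: "clinear (weil_diff0 \<Delta>)"
    unfolding weil_diff0_def by (intro clinear_derivation clinear_diff0_gen[OF \<Delta>])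
  show "clinear (\<lambda>x. bt_word \<Delta> (u @ g x # v))"
    using clinear_letter[OF g] clinear_letter[OF g, of "[]" "[]"]
    by (cases u) (auto intro!: clinear_comp[OF clinear_cyc] clinear_mult_left clinear_mult_right
        clinear_comp[OF d])
qed

lemma weil_bt_Cons: "weil_bt \<Delta> (word [a] * word w) = cyc (weil_diff0 \<Delta> (word [a]) * word w)"
  using weil_ext_word[OF word_linear_bt_word, of "a # w"] by (simp add: weil_bt_def word_Cons[of a w])

end


section \<open>Complexes of complex vector spaces\<close>

text \<open>The multiplication inherited from \<^typ>\<open>('c, 'a) module\<close> is used only to form commutators;
  the unit is a dummy in the non-unital cases. \<open>homog C k\<close> is the part of degree \<open>k\<close>.\<close>

record 'a graded_complex = "(complex, 'a) module" +
  homog :: "nat \<Rightarrow> 'a set"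
  diff :: "'a \<Rightarrow> 'a"

abbreviation complex_ring :: "complex ring" where
  "complex_ring \<equiv> ring_of_type_algebra"

definition linear_map ::
    "('a, 'm) graded_complex_scheme \<Rightarrow> ('b, 'n) graded_complex_scheme \<Rightarrow> ('a \<Rightarrow> 'b) \<Rightarrow> bool" where
  "linear_map C D f \<longleftrightarrow>
     f \<in> carrier C \<rightarrow> carrier D \<and>
     (\<forall>x\<in>carrier C. \<forall>y\<in>carrier C. f (x \<oplus>\<^bsub>C\<^esub> y) = f x \<oplus>\<^bsub>D\<^esub> f y) \<and>
     (\<forall>c. \<forall>x\<in>carrier C. f (c \<odot>\<^bsub>C\<^esub> x) = c \<odot>\<^bsub>D\<^esub> f x)"

definition graded_space :: "('a, 'm) graded_complex_scheme \<Rightarrow> bool" where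
  "graded_space C \<longleftrightarrow>
     Module.module complex_ring C \<and>
     (\<forall>k. submodule (homog C k) complex_ring C) \<and>
     (\<forall>x\<in>carrier C. \<exists>!f. (\<forall>k. f k \<in> homog C k) \<and> finite {k. f k \<noteq> \<zero>\<^bsub>C\<^esub>} \<and>
        x = finsum C f {k. f k \<noteq> \<zero>\<^bsub>C\<^esub>})"

definition cochain_complex :: "('a, 'm) graded_complex_scheme \<Rightarrow> bool" where
  "cochain_complex C \<longleftrightarrow>
     graded_space C \<and> linear_map C C (diff C) \<and>
     (\<forall>k. diff C ` homog C k \<subseteq> homog C (Suc k)) \<and>
     (\<forall>x\<in>carrier C. diff C (diff C x) = \<zero>\<^bsub>C\<^esub>)"

definition chain_map ::
    "('a, 'm) graded_complex_scheme \<Rightarrow> ('b, 'n) graded_complex_scheme \<Rightarrow> ('a \<Rightarrow> 'b) \<Rightarrow> bool" where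
  "chain_map C D f \<longleftrightarrow>
     linear_map C D f \<and> (\<forall>k. f ` homog C k \<subseteq> homog D k) \<and>
     (\<forall>x\<in>carrier C. f (diff C x) = diff D (f x))"

text \<open>\<open>\<cdots> \<rightarrow> C (-1) \<rightarrow> C 0 \<rightarrow> C 1 \<rightarrow> \<cdots>\<close> with maps \<open>f i : C i \<rightarrow> C (i + 1)\<close>.
  Exactness is stated on total spaces; as the maps preserve degree and each space is the direct sum
  of its homogeneous parts, this is the same as exactness in each degree.\<close>

definition exact_sequence :: "(int \<Rightarrow> 'a graded_complex) \<Rightarrow> (int \<Rightarrow> 'a \<Rightarrow> 'a) \<Rightarrow> bool" where
  "exact_sequence C f \<longleftrightarrow>
     (\<forall>i. cochain_complex (C i)) \<and>
     (\<forall>i. chain_map (C i) (C (i + 1)) (f i)) \<and>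
     (\<forall>i. a_kernel (C (i + 1)) (C (i + 2)) (f (i + 1)) = f i ` carrier (C i))"

text \<open>\<open>0 \<rightarrow> A \<rightarrow> C 0 \<rightarrow> C 1 \<rightarrow> \<cdots>\<close> with maps \<open>g : A \<rightarrow> C 0\<close> and \<open>f i : C i \<rightarrow> C (i + 1)\<close>\<close>

definition exact_resolution ::
    "'b graded_complex \<Rightarrow> ('b \<Rightarrow> 'a) \<Rightarrow> (nat \<Rightarrow> 'a graded_complex) \<Rightarrow> (nat \<Rightarrow> 'a \<Rightarrow> 'a) \<Rightarrow> bool" where
  "exact_resolution A g C f \<longleftrightarrow>
     cochain_complex A \<and> (\<forall>i. cochain_complex (C i)) \<and>
     chain_map A (C 0) g \<and> (\<forall>i. chain_map (C i) (C (i + 1)) (f i)) \<and>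
     a_kernel A (C 0) g = {\<zero>\<^bsub>A\<^esub>} \<and>
     a_kernel (C 0) (C 1) (f 0) = g ` carrier A \<and>
     (\<forall>i. a_kernel (C (i + 1)) (C (i + 2)) (f (i + 1)) = f i ` carrier (C i))"

text \<open>The map induced on a quotient by a map that is constant on each coset.\<close>

definition descend :: "('a \<Rightarrow> 'b) \<Rightarrow> 'a set \<Rightarrow> 'b" where
  "descend f A = the_elem (f ` A)"

definition quot_map ::
    "('a, 'm) graded_complex_scheme \<Rightarrow> 'a set \<Rightarrow> ('a \<Rightarrow> 'a) \<Rightarrow> 'a set \<Rightarrow> 'a set" where
  "quot_map M U f = descend (\<lambda>x. U +>\<^bsub>M\<^esub> f x)"

definition quot_complex :: "'a graded_complex \<Rightarrow> 'a set \<Rightarrow> 'a set graded_complex" where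
  "quot_complex M U =
     \<lparr>carrier = a_rcosets\<^bsub>M\<^esub> U, monoid.mult = rcoset_mult M U, one = U +>\<^bsub>M\<^esub> \<one>\<^bsub>M\<^esub>,
      ring.zero = U, add = set_add M,
      module.smult = (\<lambda>c. quot_map M U (\<lambda>x. c \<odot>\<^bsub>M\<^esub> x)),
      homog = (\<lambda>k. (\<lambda>x. U +>\<^bsub>M\<^esub> x) ` homog M k),
      diff = quot_map M U (diff M)\<rparr>"

definition sub_complex :: "'a graded_complex \<Rightarrow> 'a set \<Rightarrow> 'a graded_complex" where
  "sub_complex M S = M\<lparr>carrier := S, homog := (\<lambda>k. homog M k \<inter> S)\<rparr>"

text \<open>\<open>[A, B]\<close> for graded subspaces \<open>A\<close>, \<open>B\<close>: the span of the graded commutators of homogeneous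
  elements.\<close>

definition graded_commutators :: "'a graded_complex \<Rightarrow> 'a set \<Rightarrow> 'a set \<Rightarrow> 'a set" where
  "graded_commutators M A B =
     (\<lambda>U. submodule U complex_ring M) hull
       {x \<otimes>\<^bsub>M\<^esub> y \<ominus>\<^bsub>M\<^esub> (-1) ^ (i * j) \<odot>\<^bsub>M\<^esub> (y \<otimes>\<^bsub>M\<^esub> x) | x y i j.
          x \<in> A \<inter> homog M i \<and> y \<in> B \<inter> homog M j}"


section \<open>The complexes attached to W(H)\<close>

definition weil_plus ::
    "('h::complex_vector \<Rightarrow> ('h, 'h) tensor) \<Rightarrow> 'h weil graded_complex" where
  "weil_plus \<Delta> =
     \<lparr>carrier = UNIV, monoid.mult = (*), one = 1, ring.zero = 0, add = (+), module.smult = scaleC,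
      homog = (\<lambda>k. cspan (word ` {w. wdeg w = k})), diff = weil_diff \<Delta>\<rparr>"

definition weil_carrier :: "'h::complex_vector weil set" where
  "weil_carrier = cspan (word ` {w. w \<noteq> []})"

definition weil_alg ::
    "('h::complex_vector \<Rightarrow> ('h, 'h) tensor) \<Rightarrow> 'h weil graded_complex" where
  "weil_alg \<Delta> = sub_complex (weil_plus \<Delta>) weil_carrier"

definition is_weil_ideal :: "'h::complex_vector weil set \<Rightarrow> bool" where
  "is_weil_ideal J \<longleftrightarrow>
     csubspace J \<and> J \<subseteq> weil_carrier \<and> (\<forall>x\<in>weil_carrier. \<forall>y\<in>J. x * y \<in> J \<and> y * x \<in> J)"

definition om_ideal :: "'h::complex_vector weil set" where
  "om_ideal = is_weil_ideal hull range om"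

primrec om_power :: "nat \<Rightarrow> 'h::complex_vector weil set" where
  "om_power 0 = UNIV"
| "om_power (Suc n) = cspan {x * y | x y. x \<in> om_ideal \<and> y \<in> om_power n}"

definition W_quot ::
    "('h::complex_vector \<Rightarrow> ('h, 'h) tensor) \<Rightarrow> nat \<Rightarrow> 'h weil set graded_complex" where
  "W_quot \<Delta> n = quot_complex (weil_alg \<Delta>) (om_power (n + 1))"

definition W_map ::
    "('h::complex_vector \<Rightarrow> ('h, 'h) tensor) \<Rightarrow> nat \<Rightarrow> ('h weil \<Rightarrow> 'h weil) \<Rightarrow>
     'h weil set \<Rightarrow> 'h weil set" where
  "W_map \<Delta> n f = quot_map (weil_alg \<Delta>) (om_power (n + 1)) f"

definition W_quot_b ::
    "('h::complex_vector \<Rightarrow> ('h, 'h) tensor) \<Rightarrow> nat \<Rightarrow> 'h weil set graded_complex" where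
  "W_quot_b \<Delta> n = (W_quot \<Delta> n)\<lparr>diff := W_map \<Delta> n (weil_b \<Delta>)\<rparr>"

definition W_nat ::
    "('h::complex_vector \<Rightarrow> ('h, 'h) tensor) \<Rightarrow> nat \<Rightarrow> 'h weil set set graded_complex" where
  "W_nat \<Delta> n = quot_complex (W_quot \<Delta> n)
     (graded_commutators (W_quot \<Delta> n) (carrier (W_quot \<Delta> n)) (carrier (W_quot \<Delta> n)))"

definition I_pow ::
    "('h::complex_vector \<Rightarrow> ('h, 'h) tensor) \<Rightarrow> nat \<Rightarrow> 'h weil graded_complex" where
  "I_pow \<Delta> n = sub_complex (weil_alg \<Delta>) (om_power (n + 1))"

definition I_pow_b ::
    "('h::complex_vector \<Rightarrow> ('h, 'h) tensor) \<Rightarrow> nat \<Rightarrow> 'h weil graded_complex" where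
  "I_pow_b \<Delta> n = (I_pow \<Delta> n)\<lparr>diff := weil_b \<Delta>\<rparr>"

text \<open>The commutators \<open>[I(H), I\<^bsub>n-1\<^esub>(H)]\<close> are formed in the unital algebra because
  \<open>I\<^bsub>-1\<^esub>(H) = I(H)\<^sup>0\<close> contains the unit.\<close>

definition I_nat ::
    "('h::complex_vector \<Rightarrow> ('h, 'h) tensor) \<Rightarrow> nat \<Rightarrow> 'h weil set graded_complex" where
  "I_nat \<Delta> n = quot_complex (I_pow \<Delta> n)
     (graded_commutators (weil_plus \<Delta>) om_ideal (om_power n))"

end

(* The contracting identity 1 = N L + (t - 1) G, with L = 1/p and G = (1/p) sum_{i<p} i t^i on products of p
   generators, gives exactness at every spot; it respects the powers of I(H) because t permutes the
   letters of a word up to sign.  The relations between b, \<partial>, t and N all come from the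
   bilinear operator J(u, x) = sum_{i < length u} t^i(u x): it satisfies
   (t - 1) J(u, x) = \<plusminus>x u - u x, J(u, 1) = N u, and b J(u, x) = J(\<partial>u, x) \<plusminus> J(u, \<partial>x),
   whence (t - 1) b = \<partial> (t - 1), b N = N \<partial> and b^2 = 0.  Finally the
   commutator subspaces are the images of t - 1; for I_n(H) this uses
   [a, y \<omega> z] = [a y \<omega>, z] \<plusminus> [y \<omega>, z a] to move the commutator
   with a symbol a = h to one with an element of I(H). *)

theory Submission
  imports Defs
begin

text \<open>The symbols h and \<omega>_h depend linearly on h, so words are not a basis of W(H): an
  operator is given by a formula on words that is linear in every letter, and identities and
  inclusions are checked on words and extended linearly. Hence graded pieces and powers of I(H) are
  written as spans of the words with a property P, where P speaks of length and degree, which do not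
  depend on the vectors inside the letters. A word of length l and degree d has d - l letters
  \<omega>, so stability of a power of I(H) becomes an inequality between lengths and degrees that
  survives rotation. The factors 1/p confine the contraction to words with p > 0 letters, that is,
  to the non-unital algebra. L and G need not commute with the differentials: exactness is tested on
  total spaces, and only t - 1 and N have to be chain maps. The operator b does not preserve the
  number of letters; its relations are therefore obtained from first letters and J, not from powers
  of t on words of one length.\<close>

section \<open>Spans of words\<close>

abbreviation wspan :: "('h::complex_vector gen list \<Rightarrow> bool) \<Rightarrow> 'h weil set" where
  "wspan P \<equiv> cspan (word ` Collect P)"

lemma wspan_word: "P w \<Longrightarrow> word w \<in> wspan P"
  by (rule cvs.span_base) simp

lemma csubspace_wspan: "csubspace (wspan P)"
  by (rule cvs.subspace_span)

lemma wspan_mono: "(\<And>w. P w \<Longrightarrow> Q w) \<Longrightarrow> wspan P \<subseteq> wspan Q"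
  by (rule cvs.span_mono) auto

lemma wspan_UNIV: "wspan (\<lambda>w. True) = UNIV"
proof -
  have "x \<in> wspan (\<lambda>w. True)" for x :: "'a weil"
  proof (induction x rule: weil_induct)
    case zero
    show ?case by (rule cvs.span_zero)
  next
    case (step c w x)
    then show ?case by (intro cvs.span_add cvs.span_scale wspan_word TrueI)
  qed
  then show ?thesis by auto
qed

lemma clinear_wspan:
  assumes f: "clinear f" and V: "csubspace V" and "\<And>w. P w \<Longrightarrow> f (word w) \<in> V"
    and x: "x \<in> wspan P"
  shows "f x \<in> V"
  using x
proof (induction rule: cvs.span_induct_alt)
  case base show ?case by (simp add: clinear_zero[OF f] cvs.subspace_0[OF V])
next
  case (step c x y)
  then show ?case
    by (auto simp: clinear_add[OF f] clinear_scale[OF f]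
        intro!: cvs.subspace_add[OF V] cvs.subspace_scale[OF V] assms(3))
qed

lemma clinear_wspan_eq:
  assumes f: "clinear f" and g: "clinear g" and "\<And>w. P w \<Longrightarrow> f (word w) = g (word w)"
    and x: "x \<in> wspan P"
  shows "f x = g x"
  using clinear_wspan[OF clinear_diff_fun[OF f g] cvs.subspace_single_0 _ x] assms(3) by auto

lemma clinear_id: "clinear (\<lambda>x. x)"
  by (rule clinearI) simp_all

lemmas clinear_intros = clinear_id clinear_mult_left clinear_mult_right clinear_const_scale
  clinear_sum2 clinear_diff_fun clinear_minus clinear_zero_fun

lemma wspan_mult:
  assumes "x \<in> wspan P" "y \<in> wspan Q" "\<And>u v. P u \<Longrightarrow> Q v \<Longrightarrow> R (u @ v)"
  shows "x * y \<in> wspan R"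
proof (rule clinear_wspan[OF _ csubspace_wspan _ assms(1)])
  fix u assume u: "P u"
  show "word u * y \<in> wspan R"
    by (rule clinear_wspan[OF _ csubspace_wspan _ assms(2)])
      (auto intro!: clinear_intros wspan_word assms(3) u simp flip: word_append)
qed (intro clinear_intros)

section \<open>The cyclic operator\<close>

text \<open>The Koszul sign for moving the block u past v. The first letter a passes the rest of u
  and v, and later every letter of that rest passes a, which by then stands at the end; so each
  product of degrees of two letters of u occurs twice, and modulo 2 only |u| |v| remains.\<close>

lemma cyc_pow_append:
  "(cyc ^^ length u) (word (u @ v)) = (-1) ^ (wdeg u * wdeg v) *\<^sub>C word (v @ u)"
proof (induction u arbitrary: v)
  case Nil
  then show ?case by (simp add: wdeg_def scaleC_one)
next
  case (Cons a u)
  have "cyc (word (a # u @ v)) = (-1) ^ (gdeg a * (wdeg u + wdeg v)) *\<^sub>C word (u @ (v @ [a]))"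
    using cyc_Cons[of a "u @ v"] word_append[of "u @ v" "[a]"]
    by (simp add: word_Cons[of a "u @ v"] wdeg_def)
  then have "(cyc ^^ length (a # u)) (word ((a # u) @ v))
      = (-1) ^ (gdeg a * (wdeg u + wdeg v)) *\<^sub>C (-1) ^ (wdeg u * wdeg (v @ [a])) *\<^sub>C
          word ((v @ [a]) @ u)"
    by (simp add: funpow_swap1 del: funpow.simps(2) add: funpow_Suc_right
        clinear_scale[OF clinear_cyc_pow] Cons)
  also have "\<dots> = (-1) ^ (wdeg (a # u) * wdeg v) *\<^sub>C word (v @ a # u)"
    by (simp add: wdeg_def scaleC_scaleC minus_one_power_iff flip: power_add)
  finally show ?case .
qed

lemma cyc_pow_length: "(cyc ^^ length w) (word w) = word w"
  using cyc_pow_append[of w "[]"] by (simp add: wdeg_def scaleC_one)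

text \<open>The scalar, a sign, is left unspecified: the lemma serves to show that spans of rotation
  invariant properties are stable under t.\<close>

lemma cyc_pow_word: "\<exists>c. (cyc ^^ i) (word w) = c *\<^sub>C word (rotate i w)"
proof (induction i)
  case 0
  have "(cyc ^^ 0) (word w) = 1 *\<^sub>C word (rotate 0 w)" by (simp add: scaleC_one)
  then show ?case by blast
next
  case (Suc i)
  have "\<exists>c. cyc (word v) = c *\<^sub>C word (rotate1 v)" for v :: "'a gen list"
  proof (cases v)
    case Nil
    then show ?thesis using cyc_pow_length[of "[]"] weil_ext_word[OF word_linear_cyc_word, of "[]"]
      by (auto simp: cyc_def intro!: exI[of _ 1] scaleC_one[symmetric])
  next
    case (Cons a v')
    then show ?thesis using cyc_Cons[of a v'] by (auto simp: word_Cons[of a v'] word_append)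
  qed
  then obtain c where "cyc (word (rotate i w)) = c *\<^sub>C word (rotate (Suc i) w)" by auto
  with Suc show ?case by (auto simp: clinear_scale[OF clinear_cyc] scaleC_scaleC)
qed

lemma cyc_pow_wspan:
  assumes "x \<in> wspan P" "\<And>w i. P w \<Longrightarrow> P (rotate i w)"
  shows "(cyc ^^ i) x \<in> wspan P"
proof (rule clinear_wspan[OF clinear_cyc_pow csubspace_wspan _ assms(1)])
  fix w assume "P w"
  then show "(cyc ^^ i) (word w) \<in> wspan P"
    using cyc_pow_word[of i w] assms(2) by (auto intro!: cvs.span_scale wspan_word)
qed

lemma cyc_wspan:
  "x \<in> wspan P \<Longrightarrow> (\<And>w i. P w \<Longrightarrow> P (rotate i w)) \<Longrightarrow> cyc x \<in> wspan P"
  using cyc_pow_wspan[of x P 1] by simp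

lemma cyc_pow_weil_length: "x \<in> wspan (\<lambda>w. length w = p) \<Longrightarrow> (cyc ^^ p) x = x"
  by (rule clinear_wspan_eq[OF clinear_cyc_pow clinear_id]) (auto intro: cyc_pow_length)

lemma clinear_cyc_norm: "clinear cyc_norm"
  unfolding cyc_norm_def by (rule clinear_weil_ext[OF word_linear_norm_word])

lemma clinear_cyc_minus_one: "clinear cyc_minus_one"
  unfolding cyc_minus_one_def[abs_def] by (intro clinear_intros clinear_cyc)

lemma cyc_norm_wspan_length:
  "x \<in> wspan (\<lambda>w. length w = p) \<Longrightarrow> cyc_norm x = (\<Sum>i<p. (cyc ^^ i) x)"
  by (rule clinear_wspan_eq[OF clinear_cyc_norm clinear_sum_fun])
    (auto intro: clinear_cyc_pow simp: cyc_norm_word)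

lemma clinear_sum: "clinear f \<Longrightarrow> f (sum g A) = (\<Sum>i\<in>A. f (g i))"
  by (induction A rule: infinite_finite_induct) (simp_all add: clinear_zero clinear_add)

text \<open>Meant for identities that use t^p = 1 and so depend on the number p of letters: since
  every word lies in one homogeneous component, both sides may be compared there.\<close>

lemma wspan_homogeneous_induct:
  fixes f :: "'h::complex_vector gen list \<Rightarrow> nat"
  assumes "clinear F" "clinear G" "\<And>k x. x \<in> wspan (\<lambda>w. f w = k) \<Longrightarrow> F x = G x"
  shows "F x = G x"
  by (rule clinear_weil_eq[OF assms(1,2)]) (rule assms(3), rule wspan_word, rule refl)

text \<open>The sum telescopes; on words with p letters and for n = p the right side is t^p - 1 =
  0.\<close>

lemma cyc_minus_one_sum: "cyc_minus_one (\<Sum>i<n. (cyc ^^ i) x) = (cyc ^^ n) x - x"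
  by (induction n)
    (simp_all add: clinear_zero[OF clinear_cyc_minus_one] clinear_add[OF clinear_cyc_minus_one],
     simp add: cyc_minus_one_def)

lemma sum_cyc_minus_one: "(\<Sum>i<n. (cyc ^^ i) (cyc_minus_one x)) = (cyc ^^ n) x - x"
  by (induction n)
    (simp_all add: cyc_minus_one_def clinear_diff[OF clinear_cyc_pow] clinear_cyc_pow funpow_swap1)

lemma cyc_minus_one_wspan:
  "x \<in> wspan P \<Longrightarrow> (\<And>w i. P w \<Longrightarrow> P (rotate i w)) \<Longrightarrow> cyc_minus_one x \<in> wspan P"
  unfolding cyc_minus_one_def by (intro cvs.span_diff cyc_wspan)

lemma cyc_minus_one_norm: "cyc_minus_one (cyc_norm x) = 0"
  by (rule wspan_homogeneous_induct[where f = length and F = "\<lambda>x. cyc_minus_one (cyc_norm x)"])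
    (auto intro: clinear_comp[OF clinear_cyc_minus_one clinear_cyc_norm] clinear_zero_fun
      simp: cyc_norm_wspan_length cyc_minus_one_sum cyc_pow_weil_length)

lemma cyc_norm_minus_one: "cyc_norm (cyc_minus_one x) = 0"
proof (rule wspan_homogeneous_induct[where f = length and F = "\<lambda>x. cyc_norm (cyc_minus_one x)"])
  fix k and x :: "'a weil" assume x: "x \<in> wspan (\<lambda>w. length w = k)"
  then have "cyc_minus_one x \<in> wspan (\<lambda>w. length w = k)" by (rule cyc_minus_one_wspan) simp
  with x show "cyc_norm (cyc_minus_one x) = 0"
    by (simp add: cyc_norm_wspan_length sum_cyc_minus_one cyc_pow_weil_length)
qed (auto intro: clinear_comp[OF clinear_cyc_norm clinear_cyc_minus_one] clinear_zero_fun)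

lemma cyc_norm_wspan:
  assumes "x \<in> wspan P" "\<And>w i. P w \<Longrightarrow> P (rotate i w)"
  shows "cyc_norm x \<in> wspan P"
  by (rule clinear_wspan[OF clinear_cyc_norm csubspace_wspan _ assms(1)])
    (auto simp: cyc_norm_word intro!: cvs.span_sum cyc_pow_wspan wspan_word assms(2))

section \<open>The contraction of the cyclic operator\<close>

text \<open>The map L. Its factor depends on the length only, hence is compatible with linearity in
  the letters. On the empty word it is 1/0 = 0, so the unit is sent to 0.\<close>

definition cyc_mean :: "'h::complex_vector weil \<Rightarrow> 'h weil" where
  "cyc_mean = weil_ext (\<lambda>w. (1 / of_nat (length w)) *\<^sub>C word w)"

text \<open>The coefficients come from \<open>(t - 1) (\<Sum>i<p. i t\<^sup>i) = p - N\<close>, valid when \<open>t\<^sup>p = 1\<close>.\<close>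

definition cyc_homotopy :: "'h::complex_vector weil \<Rightarrow> 'h weil" where
  "cyc_homotopy = weil_ext (\<lambda>w. (1 / of_nat (length w)) *\<^sub>C
     (\<Sum>i<length w. of_nat i *\<^sub>C (cyc ^^ i) (word w)))"

lemma word_linear_cyc_mean: "word_linear (\<lambda>w. (1 / of_nat (length w)) *\<^sub>C word w)"
  unfolding word_linear_def by (auto intro!: clinear_const_scale clinear_letter)

lemma word_linear_cyc_homotopy:
  "word_linear (\<lambda>w. (1 / of_nat (length w)) *\<^sub>C (\<Sum>i<length w. of_nat i *\<^sub>C (cyc ^^ i) (word w)))"
  unfolding word_linear_def length_append length_Cons
  by (intro allI ballI clinear_const_scale clinear_sum_fun clinear_comp[OF clinear_cyc_pow]
      clinear_letter)

lemma clinear_cyc_mean: "clinear cyc_mean" and clinear_cyc_homotopy: "clinear cyc_homotopy"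
  unfolding cyc_mean_def cyc_homotopy_def 
  by (intro clinear_weil_ext word_linear_cyc_mean word_linear_cyc_homotopy)+

lemma cyc_mean_wspan_length:
  "x \<in> wspan (\<lambda>w. length w = p) \<Longrightarrow> cyc_mean x = (1 / of_nat p) *\<^sub>C x"
  by (rule clinear_wspan_eq[OF clinear_cyc_mean clinear_const_scale[OF clinear_id]])
    (auto simp: cyc_mean_def weil_ext_word[OF word_linear_cyc_mean])

lemma cyc_homotopy_wspan_length:
  "x \<in> wspan (\<lambda>w. length w = p) \<Longrightarrow>
     cyc_homotopy x = (1 / of_nat p) *\<^sub>C (\<Sum>i<p. of_nat i *\<^sub>C (cyc ^^ i) x)"
  by (rule clinear_wspan_eq[OF clinear_cyc_homotopy])
    (auto simp: cyc_homotopy_def weil_ext_word[OF word_linear_cyc_homotopy]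
      intro!: clinear_const_scale clinear_sum_fun clinear_cyc_pow)

lemma cyc_mean_wspan:
  assumes "x \<in> wspan P"
  shows "cyc_mean x \<in> wspan P"
  by (rule clinear_wspan[OF clinear_cyc_mean csubspace_wspan _ assms])
    (auto simp: cyc_mean_def weil_ext_word[OF word_linear_cyc_mean]
      intro!: cvs.span_scale wspan_word)

lemma cyc_homotopy_wspan:
  assumes "x \<in> wspan P" "\<And>w i. P w \<Longrightarrow> P (rotate i w)"
  shows "cyc_homotopy x \<in> wspan P"
  by (rule clinear_wspan[OF clinear_cyc_homotopy csubspace_wspan _ assms(1)])
    (auto simp: cyc_homotopy_def weil_ext_word[OF word_linear_cyc_homotopy]
      intro!: cvs.span_scale cvs.span_sum cyc_pow_wspan wspan_word assms(2))

text \<open>Summation by parts: the weights i leave n copies of the last term minus the plain sum of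
  the shifted terms.\<close>

lemma cyc_telescope:
  "(\<Sum>i<n. of_nat i *\<^sub>C ((cyc ^^ Suc i) x - (cyc ^^ i) x))
     = of_nat n *\<^sub>C (cyc ^^ n) x - (\<Sum>i<n. (cyc ^^ Suc i) x)"
  by (induction n)
    (simp_all add: scaleC_add_left scaleC_one cvs.scale_right_diff_distrib algebra_simps
      del: funpow.simps)

text \<open>On words of length p all four maps are polynomials in t and hence commute. Both orders
  are recorded: the first formula settles the kernel of t - 1, the second the kernel of N.\<close>

lemma cyc_homotopy_length:
  assumes x: "x \<in> wspan (\<lambda>w. length w = p)" and p: "p > 0"
  shows "x = cyc_norm (cyc_mean x) + cyc_homotopy (cyc_minus_one x)"
    and "x = cyc_mean (cyc_norm x) + cyc_minus_one (cyc_homotopy x)"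
proof -
  let ?W = "wspan (\<lambda>w. length w = p) :: 'a weil set"
  have tx: "cyc_minus_one x \<in> ?W" "cyc_norm x \<in> ?W" "cyc_mean x \<in> ?W"
    by (auto intro: cyc_minus_one_wspan cyc_norm_wspan cyc_mean_wspan x)
  have "(\<Sum>i<Suc p. (cyc ^^ i) x) = x + (\<Sum>i<p. (cyc ^^ Suc i) x)"
    by (subst sum.lessThan_Suc_shift) simp
  then have shift: "(\<Sum>i<p. (cyc ^^ Suc i) x) = (\<Sum>i<p. (cyc ^^ i) x)"
    using cyc_pow_weil_length[OF x] by simp
  have *: "(\<Sum>i<p. of_nat i *\<^sub>C ((cyc ^^ Suc i) x - (cyc ^^ i) x)) = of_nat p *\<^sub>C x - cyc_norm x"
    unfolding cyc_telescope shift cyc_pow_weil_length[OF x] cyc_norm_wspan_length[OF x] ..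
  \<comment> \<open>x is split as (1/p) N x + (1/p) (p - N) x; the second summand is what the
    weights i produce.\<close>
  have 1: "x = (1 / of_nat p) *\<^sub>C cyc_norm x + (1 / of_nat p) *\<^sub>C (of_nat p *\<^sub>C x - cyc_norm x)"
    using p by (simp add: cvs.scale_right_diff_distrib scaleC_scaleC scaleC_one)
  have h: "(cyc ^^ i) (cyc_minus_one x) = (cyc ^^ Suc i) x - (cyc ^^ i) x"
    "cyc_minus_one ((cyc ^^ i) x) = (cyc ^^ Suc i) x - (cyc ^^ i) x" for i
    by (simp_all add: cyc_minus_one_def clinear_diff[OF clinear_cyc_pow] funpow_swap1)
  show "x = cyc_norm (cyc_mean x) + cyc_homotopy (cyc_minus_one x)"
    unfolding cyc_homotopy_wspan_length[OF tx(1)] h * unfolding cyc_mean_wspan_length[OF x]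
      clinear_scale[OF clinear_cyc_norm] by (rule 1)
  show "x = cyc_mean (cyc_norm x) + cyc_minus_one (cyc_homotopy x)"
    unfolding cyc_homotopy_wspan_length[OF x] cyc_mean_wspan_length[OF tx(2)]
      clinear_scale[OF clinear_cyc_minus_one] clinear_sum[OF clinear_cyc_minus_one] h * by (rule 1)
qed

text \<open>The empty word has to be excluded: N, L and G vanish on it, so both right sides are 0
  there.\<close>

lemma cyc_homotopy_formulas:
  assumes x: "x \<in> wspan (\<lambda>w. w \<noteq> [])"
  shows "x = cyc_norm (cyc_mean x) + cyc_homotopy (cyc_minus_one x)" (is "x = ?f x")
    and "x = cyc_mean (cyc_norm x) + cyc_minus_one (cyc_homotopy x)" (is "x = ?g x")
proof -
  note l = clinear_cyc_norm clinear_cyc_mean clinear_cyc_homotopy clinear_cyc_minus_one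
  have "clinear ?f" "clinear ?g"
    by (intro clinear_sum2 clinear_comp[OF l(1) l(2)] clinear_comp[OF l(2) l(1)]
        clinear_comp[OF l(3) l(4)] clinear_comp[OF l(4) l(3)])+
  then show "x = ?f x" "x = ?g x"
    by (auto intro!: clinear_wspan_eq[OF clinear_id _ _ x]
        intro: cyc_homotopy_length[OF wspan_word[of "\<lambda>v. length v = length w" w for w]])
qed

section \<open>Degrees and the bilinear operator J\<close>

abbreviation weil_homog :: "nat \<Rightarrow> 'h::complex_vector weil set" where
  "weil_homog k \<equiv> wspan (\<lambda>w. wdeg w = k)"

lemma wdeg_append: "wdeg (u @ v) = wdeg u + wdeg v"
  by (simp add: wdeg_def)

lemma weil_homog_mult: "x \<in> weil_homog i \<Longrightarrow> y \<in> weil_homog j \<Longrightarrow> x * y \<in> weil_homog (i + j)"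
  by (erule wspan_mult) (auto simp: wdeg_append)

lemma weil_homog_word: "wdeg w = k \<Longrightarrow> word w \<in> weil_homog k"
  by (rule wspan_word)

lemma word_letter_homog: "word [a] \<in> weil_homog (gdeg a)"
  by (rule weil_homog_word) (simp add: wdeg_def)

text \<open>The sum of those rotations of \<open>x y\<close> that begin with a letter of \<open>x\<close>.\<close>

definition partial_norm :: "'h::complex_vector weil \<Rightarrow> 'h weil \<Rightarrow> 'h weil" where
  "partial_norm x y =
     weil_ext (\<lambda>u. weil_ext (\<lambda>v. \<Sum>i<length u. (cyc ^^ i) (word (u @ v))) y) x"

lemma word_linear_partial_norm:
  fixes u v :: "'h::complex_vector gen list"
  shows "word_linear (\<lambda>v. \<Sum>i<length u. (cyc ^^ i) (word (u @ v)))"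
    "word_linear (\<lambda>u. \<Sum>i<length u. (cyc ^^ i) (word (u @ v)))"
proof -
  have "clinear (\<lambda>x. \<Sum>i<n. (cyc ^^ i) (word (u' @ g x # w)))"
    if "g \<in> {Gen, Om}" for u' w n and g :: "'h \<Rightarrow> 'h gen"
    by (intro clinear_sum_fun clinear_comp[OF clinear_cyc_pow] clinear_letter that)
  note * = this this[where u' = "u @ u'" for u', unfolded append_assoc]
  show "word_linear (\<lambda>v. \<Sum>i<length u. (cyc ^^ i) (word (u @ v)))"
    unfolding word_linear_def by (intro allI ballI) (rule *)
  show "word_linear (\<lambda>u. \<Sum>i<length u. (cyc ^^ i) (word (u @ v)))"
    unfolding word_linear_def
    by (intro allI ballI, simp only: append_assoc append_Cons length_append length_Cons) (rule *)
qed

lemma word_linear_partial_norm_ext: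
  "word_linear (\<lambda>u. weil_ext (\<lambda>v. \<Sum>i<length u. (cyc ^^ i) (word (u @ v))) y)"
  by (rule weil_ext_combination) (rule word_linear_partial_norm)+

lemma clinear_partial_norm_left: "clinear (\<lambda>x. partial_norm x y)"
  unfolding partial_norm_def by (rule clinear_weil_ext[OF word_linear_partial_norm_ext])

lemma partial_norm_word_left:
  "partial_norm (word u) y = weil_ext (\<lambda>v. \<Sum>i<length u. (cyc ^^ i) (word (u @ v))) y"
  unfolding partial_norm_def by (rule weil_ext_word[OF word_linear_partial_norm_ext])

lemma partial_norm_word:
  "partial_norm (word u) (word v) = (\<Sum>i<length u. (cyc ^^ i) (word (u @ v)))"
  by (simp add: partial_norm_word_left weil_ext_word[OF word_linear_partial_norm(1)])

lemma clinear_partial_norm_right: "clinear (partial_norm x)"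
proof (induction x rule: weil_induct)
  case zero
  have "partial_norm 0 = (\<lambda>y::'a weil. 0)"
    by (rule ext) (rule clinear_zero[OF clinear_partial_norm_left])
  then show ?case by (simp only: clinear_zero_fun)
next
  case (step c w x)
  have "partial_norm (c *\<^sub>C word w + x) = (\<lambda>y. c *\<^sub>C partial_norm (word w) y + partial_norm x y)"
    by (rule ext) (simp add: clinear_add[OF clinear_partial_norm_left]
        clinear_scale[OF clinear_partial_norm_left])
  moreover have "clinear (partial_norm (word w))"
    unfolding partial_norm_word_left[abs_def] by (rule clinear_weil_ext[OF word_linear_partial_norm(1)])
  ultimately show ?case using step by (simp add: clinear_sum2 clinear_const_scale)
qed

lemmas clinear_partial_norm =
  clinear_comp[OF clinear_partial_norm_left] clinear_comp[OF clinear_partial_norm_right]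

lemma partial_norm_wspan:
  assumes "x \<in> wspan P" "y \<in> wspan Q" "\<And>u v. P u \<Longrightarrow> Q v \<Longrightarrow> R (u @ v)"
    and R: "\<And>w i. R w \<Longrightarrow> R (rotate i w)"
  shows "partial_norm x y \<in> wspan R"
proof (rule clinear_wspan[OF clinear_partial_norm_left csubspace_wspan _ assms(1)])
  fix u assume u: "P u"
  show "partial_norm (word u) y \<in> wspan R"
    by (rule clinear_wspan[OF clinear_partial_norm_right csubspace_wspan _ assms(2)])
      (auto intro!: cvs.span_sum cyc_pow_wspan wspan_word R assms(3) u simp: partial_norm_word)
qed

lemma partial_norm_one: "partial_norm x 1 = cyc_norm x"
  by (rule clinear_weil_eq[OF clinear_partial_norm_left clinear_cyc_norm])
    (simp add: one_weil_word partial_norm_word cyc_norm_word)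

lemma partial_norm_length_one:
  assumes "x \<in> wspan (\<lambda>w. length w = 1)"
  shows "partial_norm x y = x * y"
proof (rule clinear_wspan_eq[OF clinear_partial_norm_left _ _ assms])
  fix w :: "'a gen list" assume w: "length w = 1"
  show "partial_norm (word w) y = word w * y"
    by (rule clinear_weil_eq[OF clinear_partial_norm_right])
      (auto simp: partial_norm_word w word_append intro: clinear_intros)
qed (intro clinear_intros)

lemma partial_norm_letter: "partial_norm (word [a]) y = word [a] * y"
  by (rule partial_norm_length_one) (simp add: wspan_word)

text \<open>The rotated summand is the source of b_t: for x = \<partial>_0(a) it equals
  b_t(ay).\<close>

lemma partial_norm_length_two:
  assumes "x \<in> wspan (\<lambda>w. length w = 2)"
  shows "partial_norm x y = x * y + cyc (x * y)"
proof (rule clinear_wspan_eq[OF clinear_partial_norm_left _ _ assms])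
  fix w :: "'a gen list" assume w: "length w = 2"
  show "partial_norm (word w) y = word w * y + cyc (word w * y)"
  proof (rule clinear_weil_eq[OF clinear_partial_norm_right])
    show "clinear (\<lambda>y. word w * y + cyc (word w * y))"
      by (intro clinear_intros clinear_comp[OF clinear_cyc])
  qed (simp add: partial_norm_word w word_append numeral_2_eq_2)
qed (intro clinear_intros clinear_comp[OF clinear_cyc])

text \<open>The sum telescopes to t^(length u) - 1, and this power of t moves the whole block u
  behind v. So J(u, v) is a primitive under t - 1 of minus the graded commutator of u and v.\<close>

lemma cyc_minus_one_partial_norm_word:
  "cyc_minus_one (partial_norm (word u) (word v))
     = (-1) ^ (wdeg u * wdeg v) *\<^sub>C (word v * word u) - word u * word v"
  by (simp add: partial_norm_word cyc_minus_one_sum cyc_pow_append flip: word_append)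

lemma cyc_minus_one_partial_norm:
  assumes x: "x \<in> weil_homog i" and y: "y \<in> weil_homog j"
  shows "cyc_minus_one (partial_norm x y) = (-1) ^ (i * j) *\<^sub>C (y * x) - x * y"
proof (rule clinear_wspan_eq[OF _ _ _ x])
  note c = clinear_comp[OF clinear_cyc_minus_one]
  show "clinear (\<lambda>x. cyc_minus_one (partial_norm x y))"
    "clinear (\<lambda>x. (-1) ^ (i * j) *\<^sub>C (y * x) - x * y)"
    by (intro c clinear_partial_norm_left clinear_intros)+
  fix u :: "'a gen list" assume u: "wdeg u = i"
  show "cyc_minus_one (partial_norm (word u) y) = (-1) ^ (i * j) *\<^sub>C (y * word u) - word u * y"
    by (rule clinear_wspan_eq[OF _ _ _ y])
      (auto intro!: c clinear_partial_norm_right clinear_intros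
        simp: cyc_minus_one_partial_norm_word u)
qed

lemma cyc_minus_one_letter_mult:
  assumes "x \<in> weil_homog k"
  shows "cyc_minus_one (word [a] * x) = (-1) ^ (gdeg a * k) *\<^sub>C (x * word [a]) - word [a] * x"
  using cyc_minus_one_partial_norm[OF word_letter_homog assms] by (simp only: partial_norm_letter)

text \<open>Rotations of uvw that begin in uv begin either in u or in v; the latter are rotations of
  vwu, and the sign is that of moving u behind vw.\<close>

lemma partial_norm_append:
  "partial_norm (word (u @ v)) (word w) = partial_norm (word u) (word (v @ w))
     + (-1) ^ (wdeg u * (wdeg v + wdeg w)) *\<^sub>C partial_norm (word v) (word (w @ u))"
proof -
  let ?s = "(-1) ^ (wdeg u * (wdeg v + wdeg w)) :: complex"
  have "(\<Sum>i<length u + n. (cyc ^^ i) x)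
      = (\<Sum>i<length u. (cyc ^^ i) x) + (\<Sum>i<n. (cyc ^^ i) ((cyc ^^ length u) x))" for n and x :: "'a weil"
    by (induction n) (simp_all add: add.assoc, metis add.commute comp_apply funpow_add)
  then show ?thesis
    by (simp add: partial_norm_word cyc_pow_append wdeg_append clinear_scale[OF clinear_cyc_pow]
        cvs.scale_sum_right)
qed

lemma partial_norm_mult:
  assumes x: "x \<in> weil_homog i" and y: "y \<in> weil_homog j" and z: "z \<in> weil_homog k"
  shows "partial_norm (x * y) z = partial_norm x (y * z)
     + (-1) ^ (i * (j + k)) *\<^sub>C partial_norm y (z * x)"
proof (rule clinear_wspan_eq[OF _ _ _ x])
  note c = clinear_partial_norm clinear_partial_norm_left clinear_partial_norm_right clinear_intros
  show "clinear (\<lambda>x. partial_norm (x * y) z)"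
    "clinear (\<lambda>x. partial_norm x (y * z) + (-1) ^ (i * (j + k)) *\<^sub>C partial_norm y (z * x))"
    by (intro c)+
  fix u :: "'a gen list" assume u: "wdeg u = i"
  show "partial_norm (word u * y) z = partial_norm (word u) (y * z)
     + (-1) ^ (i * (j + k)) *\<^sub>C partial_norm y (z * word u)"
  proof (rule clinear_wspan_eq[OF _ _ _ y])
    show "clinear (\<lambda>y. partial_norm (word u * y) z)"
      "clinear (\<lambda>y. partial_norm (word u) (y * z) + (-1) ^ (i * (j + k)) *\<^sub>C partial_norm y (z * word u))"
      by (intro c)+
    fix v :: "'a gen list" assume v: "wdeg v = j"
    show "partial_norm (word u * word v) z = partial_norm (word u) (word v * z)
       + (-1) ^ (i * (j + k)) *\<^sub>C partial_norm (word v) (z * word u)"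
      by (rule clinear_wspan_eq[OF _ _ _ z])
        (auto intro!: c simp: partial_norm_append u v simp flip: word_append)
  qed
qed

section \<open>The differentials\<close>

text \<open>Valid for every \<beta>, since \<open>tensor_ext\<close> is by definition a finite
  linear combination of values of \<beta> on a chosen representative. For the same reason linear
  maps and sums pass through it.\<close>

lemma tensor_ext_wspan:
  assumes "\<And>x y. \<beta> x y \<in> wspan P"
  shows "tensor_ext \<beta> z \<in> wspan P"
  unfolding tensor_ext_def free_ext_def
  by (intro cvs.span_sum cvs.span_scale) (auto simp: assms split: prod.split)

lemma clinear_tensor_ext_comp: "clinear f \<Longrightarrow> f (tensor_ext \<beta> z) = tensor_ext (\<lambda>x y. f (\<beta> x y)) z"
  by (simp add: tensor_ext_def free_ext_def clinear_sum clinear_scale case_prod_unfold)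

lemma tensor_ext_add: "tensor_ext (\<lambda>x y. \<beta> x y + \<gamma> x y) z = tensor_ext \<beta> z + tensor_ext \<gamma> z"
  and tensor_ext_diff: "tensor_ext (\<lambda>x y. \<beta> x y - \<gamma> x y) z = tensor_ext \<beta> z - tensor_ext \<gamma> z"
  and tensor_ext_minus: "tensor_ext (\<lambda>x y. - \<beta> x y) z = - tensor_ext \<beta> z"
  by (simp_all add: tensor_ext_def free_ext_def scaleC_add_right sum.distrib sum_subtractf sum_negf
      case_prod_unfold cvs.scale_right_diff_distrib cvs.scale_minus_right)

context coalgebra
begin

text \<open>Coassociativity followed by A \<otimes> B \<otimes> C and multiplication in W(H). With
  A, B, C among \<open>gen\<close> and \<open>om\<close> it cancels the products of three letters in
  \<partial>\<partial>.\<close>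

lemma coassoc_product:
  fixes A B C :: "'h \<Rightarrow> 'h weil"
  assumes "clinear A" "clinear B" "clinear C"
  shows "tensor_ext (\<lambda>x y. tensor_ext (\<lambda>u v. A u * B v) (\<Delta> x) * C y) (\<Delta> h)
       = tensor_ext (\<lambda>x y. A x * tensor_ext (\<lambda>u v. B u * C v) (\<Delta> y)) (\<Delta> h)"
proof -
  note l = clinear_comp[OF assms(1) clinear_id] clinear_comp[OF assms(2) clinear_id]
    clinear_comp[OF assms(3) clinear_id]
  \<comment> \<open>A map on H \<otimes> (H \<otimes> H), the space in which both sides of
    coassociativity lie.\<close>
  let ?F = "tensor_ext (\<lambda>x z. A x * tensor_ext (\<lambda>u v. B u * C v) z)"
  have i: "clinear (tensor_ext (\<lambda>u v. B u * C v))"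
    by (intro clinear_tensor_ext clinear_intros l)
  have F: "clinear ?F" and F_tens: "?F (tens x z) = A x * tensor_ext (\<lambda>u v. B u * C v) z" for x z
  proof -
    have "clinear (\<lambda>x. A x * tensor_ext (\<lambda>u v. B u * C v) z)"
      "clinear (\<lambda>z. A x * tensor_ext (\<lambda>u v. B u * C v) z)" for x z
      by (intro clinear_mult_left clinear_mult_right assms i)+
    then show "clinear ?F" "?F (tens x z) = A x * tensor_ext (\<lambda>u v. B u * C v) z"
      by (auto intro!: clinear_tensor_ext tensor_ext_tens)
  qed
  have 2: "tensor_ext (\<lambda>u v. B u * C v) (tens v y) = B v * C y" for v y
    by (intro tensor_ext_tens clinear_intros l)
  have m: "tensor_ext (\<lambda>u v. A u * B v) z * C y = tensor_ext (\<lambda>u v. A u * (B v * C y)) z" for z y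
    by (subst clinear_tensor_ext_comp[of "\<lambda>x. x * C y"]) (auto intro: clinear_intros simp: mult.assoc)
  have "?F (tensor_ext (\<lambda>x y. tensor_ext (\<lambda>u v. tens u (tens v y)) (\<Delta> x)) (\<Delta> h))
      = ?F (tensor_ext (\<lambda>x y. tens x (\<Delta> y)) (\<Delta> h))"
    by (simp only: coassoc)
  then show ?thesis
    by (simp add: clinear_tensor_ext_comp[OF F] F_tens 2 m)
qed

lemma clinear_weil_diff: "clinear (weil_diff \<Delta>)"
  unfolding weil_diff_def by (intro clinear_derivation clinear_diff0_gen comult_linear)

lemma clinear_weil_b: "clinear (weil_b \<Delta>)"
  unfolding weil_b_def[abs_def] weil_bt_def
  by (intro clinear_sum2 clinear_weil_diff clinear_weil_ext word_linear_bt_word comult_linear)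

lemma weil_diff_mult:
  assumes "x \<in> weil_homog i"
  shows "weil_diff \<Delta> (x * y) = weil_diff \<Delta> x * y + (-1) ^ i *\<^sub>C (x * weil_diff \<Delta> y)"
  by (rule clinear_wspan_eq[OF _ _ _ assms])
    (auto intro!: clinear_comp[OF clinear_weil_diff] clinear_intros clinear_weil_diff
      simp: weil_diff_Leibniz[OF comult_linear])

lemma weil_diff_letter_homog: "weil_diff \<Delta> (word [a]) \<in> weil_homog (Suc (gdeg a))"
proof -
  have *: "word [a] * word [b] \<in> weil_homog k" if "gdeg a + gdeg b = k" for a b :: "'h gen" and k
    unfolding word_append[symmetric] by (rule weil_homog_word) (simp add: wdeg_def that)
  then show ?thesis
    by (cases a; simp only: weil_diff_gen[OF comult_linear] weil_diff_om[OF comult_linear])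
      (intro cvs.span_diff tensor_ext_wspan weil_homog_word *; simp add: wdeg_def)+
qed

lemma weil_diff_word_Nil: "weil_diff \<Delta> (word []) = 0"
  using weil_diff_mult[of "word []" 0 "word []"] weil_homog_word[of "[]" 0]
  by (simp add: one_weil_word[symmetric] wdeg_def[of "[]"] scaleC_one)

text \<open>\<partial> of a word is a signed sum in which one letter a is replaced by \<partial>a,
  so it is enough to know the effect of such a replacement.\<close>

lemma weil_diff_wspan:
  assumes x: "x \<in> wspan P" and "\<And>u a v. P (u @ a # v) \<Longrightarrow>
      word u * weil_diff \<Delta> (word [a]) * word v \<in> wspan Q"
  shows "weil_diff \<Delta> x \<in> wspan Q"
proof (rule clinear_wspan[OF clinear_weil_diff csubspace_wspan _ x])
  fix w assume "P w"
  \<comment> \<open>Generalised over a prefix v, because P speaks of the whole word and the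
    induction peels off its first letters.\<close>
  then have "word v * weil_diff \<Delta> (word w') \<in> wspan Q" if "v @ w' = w" for v w'
    using that
  proof (induction w' arbitrary: v)
    case Nil
    then show ?case by (simp add: weil_diff_word_Nil cvs.span_zero)
  next
    case (Cons a w')
    have e: "weil_diff \<Delta> (word (a # w')) = weil_diff \<Delta> (word [a]) * word w'
        + (-1) ^ gdeg a *\<^sub>C (word [a] * weil_diff \<Delta> (word w'))"
      unfolding word_Cons[of a w'] by (rule weil_diff_mult[OF word_letter_homog])
    have "word (v @ [a]) * weil_diff \<Delta> (word w') \<in> wspan Q"
      by (rule Cons.IH) (use Cons.prems in auto)
    moreover have "word v * weil_diff \<Delta> (word [a]) * word w' \<in> wspan Q"
      by (rule assms(2)) (use Cons.prems in auto)
    ultimately show ?case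
      unfolding e by (simp add: word_append distrib_left scaleC_mult_right mult.assoc cvs.span_add
          cvs.span_scale)
  qed
  from this[of "[]" w] show "weil_diff \<Delta> (word w) \<in> wspan Q"
    by (simp add: one_weil_word[symmetric])
qed

lemma weil_diff_homog: "x \<in> weil_homog k \<Longrightarrow> weil_diff \<Delta> x \<in> weil_homog (Suc k)"
proof (erule weil_diff_wspan)
  fix u a and v :: "'h gen list" assume k: "wdeg (u @ a # v) = k"
  have "word u * weil_diff \<Delta> (word [a]) * word v \<in> weil_homog (wdeg u + Suc (gdeg a) + wdeg v)"
    by (intro weil_homog_mult weil_diff_letter_homog weil_homog_word refl)
  also have "wdeg u + Suc (gdeg a) + wdeg v = Suc k" using k by (simp add: wdeg_def)
  finally show "word u * weil_diff \<Delta> (word [a]) * word v \<in> weil_homog (Suc k)" .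
qed

text \<open>For h the products of two letters in \<partial>\<omega>_h cancel against those from
  \<partial>h_0 and \<partial>h_1; for \<omega>_h the two terms \<omega>\<omega> cancel. What
  remains are products of three letters, which coassociativity removes.\<close>

lemma weil_diff_squared_letter: "weil_diff \<Delta> (weil_diff \<Delta> (word [a])) = 0"
proof -
  note d = clinear_tensor_ext_comp[OF clinear_weil_diff]
  have "gen h \<in> weil_homog 1" "om h \<in> weil_homog 2" for h :: 'h
    using word_letter_homog[of "Gen h"] word_letter_homog[of "Om h"] by simp_all
  note L = this[THEN weil_diff_mult]
  note s = coassoc_product[OF clinear_gen clinear_gen clinear_gen]
    coassoc_product[OF clinear_om clinear_gen clinear_gen]
    coassoc_product[OF clinear_gen clinear_om clinear_gen]
    coassoc_product[OF clinear_gen clinear_gen clinear_om]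
  have neg: "(-1) ^ 1 *\<^sub>C x = - x" "(-1) ^ 2 *\<^sub>C x = x" for x :: "'h weil"
    by (simp_all add: cvs.scale_minus_left scaleC_one)
  show ?thesis
  proof (cases a)
    case (Gen h)
    show ?thesis
      unfolding Gen weil_diff_gen[OF comult_linear] clinear_diff[OF clinear_weil_diff] d L
        weil_diff_om[OF comult_linear] neg
      by (simp add: left_diff_distrib right_diff_distrib tensor_ext_add tensor_ext_diff
          tensor_ext_minus s)
  next
    case (Om h)
    show ?thesis
      unfolding Om weil_diff_om[OF comult_linear] clinear_diff[OF clinear_weil_diff] d L
        weil_diff_om[OF comult_linear] weil_diff_gen[OF comult_linear] neg
      by (simp add: left_diff_distrib right_diff_distrib tensor_ext_add tensor_ext_diff
          tensor_ext_minus s)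
  qed
qed

text \<open>Since \<partial>a has degree |a| + 1, the two terms \<partial>a \<partial>w in
  \<partial>\<partial>(aw) have opposite signs, and only \<partial>\<partial>a and
  \<partial>\<partial>w remain.\<close>

lemma weil_diff_squared: "weil_diff \<Delta> (weil_diff \<Delta> x) = 0"
proof (rule clinear_weil_eq[OF clinear_comp[OF clinear_weil_diff clinear_weil_diff] clinear_zero_fun])
  fix w :: "'h gen list"
  show "weil_diff \<Delta> (weil_diff \<Delta> (word w)) = 0"
  proof (induction w)
    case Nil
    show ?case by (simp add: weil_diff_word_Nil clinear_zero[OF clinear_weil_diff])
  next
    case (Cons a w)
    show ?case
      unfolding word_Cons[of a w] 
      by (simp add: weil_diff_mult[OF word_letter_homog] weil_diff_mult[OF weil_diff_letter_homog]
         clinear_add[OF clinear_weil_diff] clinear_scale[OF clinear_weil_diff] Cons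
         weil_diff_squared_letter)
  qed
qed

end

section \<open>The powers of I(H) as a filtration by the number of letters \<omega>\<close>

lemma wdeg_rotate: "wdeg (rotate i w) = wdeg w"
proof (induction i)
  case (Suc i)
  have "wdeg (rotate1 v) = wdeg v" for v :: "'a gen list"
    by (cases v) (simp_all add: wdeg_def)
  with Suc show ?case by simp
qed simp

lemma wdeg_Cons: "wdeg (a # w) = gdeg a + wdeg w"
  by (simp add: wdeg_def)

lemma length_le_wdeg: "length w \<le> wdeg w"
proof (induction w)
  case (Cons a w)
  then show ?case by (cases a) (simp_all add: wdeg_def)
qed (simp add: wdeg_def)

text \<open>The word is cut just behind its first letter \<omega>: u ends with that letter, and v
  keeps the others.\<close>

lemma om_split:
  "length w + Suc n \<le> wdeg w \<Longrightarrow>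
     \<exists>u v. w = u @ v \<and> length u + 1 \<le> wdeg u \<and> length v + n \<le> wdeg v"
proof (induction w)
  case Nil
  then show ?case by (simp add: wdeg_def)
next
  case (Cons a w)
  show ?case
  proof (cases a)
    case (Gen h)
    then obtain u v where "w = u @ v" "length u + 1 \<le> wdeg u" "length v + n \<le> wdeg v"
      using Cons by (auto simp: wdeg_def)
    then show ?thesis using Gen by (intro exI[of _ "a # u"] exI[of _ v]) (simp add: wdeg_def)
  next
    case (Om h)
    then show ?thesis using Cons.prems
      by (intro exI[of _ "[a]"] exI[of _ w]) (simp add: wdeg_def)
  qed
qed

text \<open>As symbols have degree 1 or 2, the excess of the degree of a word over its length is the
  number of its letters \<open>\<omega>\<^sub>h\<close>.\<close>

definition om_filtration :: "nat \<Rightarrow> 'h::complex_vector weil set" where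
  "om_filtration n = wspan (\<lambda>w. w \<noteq> [] \<and> length w + n \<le> wdeg w)"

lemma weil_carrier_eq: "weil_carrier = om_filtration 0"
  by (simp add: weil_carrier_def om_filtration_def length_le_wdeg)

text \<open>For n > 0 the inequality already excludes the empty word; for n = 0 the condition
  \<open>w \<noteq> []\<close> separates W(H) from its unital extension.\<close>

lemma om_filtration_pos: "0 < n \<Longrightarrow> om_filtration n = wspan (\<lambda>w. length w + n \<le> wdeg w)"
proof -
  assume "0 < n"
  then have "w \<noteq> [] \<and> length w + n \<le> wdeg w \<longleftrightarrow> length w + n \<le> wdeg w" for w :: "'a gen list"
    by (auto simp: wdeg_def)
  then show ?thesis by (simp add: om_filtration_def)
qed

lemma csubspace_om_filtration: "csubspace (om_filtration n)"
  unfolding om_filtration_def by (rule csubspace_wspan)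

lemma om_filtration_mono: "m \<le> n \<Longrightarrow> om_filtration n \<subseteq> om_filtration m"
  unfolding om_filtration_def by (rule wspan_mono) simp

text \<open>The span is an ideal because numbers of letters \<omega> add up. Conversely a word with
  a letter \<omega> arises from that letter by multiplication with others, so it lies in every ideal
  that contains all \<omega>_h.\<close>

lemma om_ideal_eq: "om_ideal = (wspan (\<lambda>w. length w + 1 \<le> wdeg w) :: 'h::complex_vector weil set)"
proof
  have "om_filtration 1 = (wspan (\<lambda>w. length w + 1 \<le> wdeg w) :: 'h weil set)"
    by (rule om_filtration_pos) simp
  moreover have "x * y \<in> (om_filtration 1 :: 'h weil set) \<and> y * x \<in> (om_filtration 1 :: 'h weil set)"
    if "x \<in> weil_carrier" "y \<in> om_filtration 1" for x y :: "'h weil"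
    using that unfolding weil_carrier_eq om_filtration_def
    by (auto simp: wdeg_append elim!: wspan_mult)
  then have "is_weil_ideal (om_filtration 1 :: 'h weil set)"
    using om_filtration_mono[of 0 1]
    by (simp add: is_weil_ideal_def csubspace_om_filtration weil_carrier_eq)
  moreover have "range om \<subseteq> (om_filtration 1 :: 'h weil set)"
    unfolding om_filtration_def by (auto simp: wdeg_def intro!: wspan_word)
  ultimately show "om_ideal \<subseteq> (wspan (\<lambda>w. length w + 1 \<le> wdeg w) :: 'h weil set)"
    unfolding om_ideal_def using hull_minimal by metis
next
  show "wspan (\<lambda>w. length w + 1 \<le> wdeg w) \<subseteq> (om_ideal :: 'h weil set)"
    unfolding om_ideal_def hull_def
  proof (rule Inter_greatest, clarify)
    fix J :: "'h weil set" and x :: "'h weil"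
    assume J: "is_weil_ideal J" "range om \<subseteq> J" and x: "x \<in> wspan (\<lambda>w. length w + 1 \<le> wdeg w)"
    have "word w \<in> J" if "length w + 1 \<le> wdeg w" for w
      using that
    proof (induction w)
      case Nil
      then show ?case by (simp add: wdeg_def)
    next
      case (Cons a w)
      have word: "word v \<in> weil_carrier" if "v \<noteq> []" for v :: "'h gen list"
        unfolding weil_carrier_def by (rule wspan_word) (rule that)
      show ?case
      proof (cases a)
        case (Gen h)
        then show ?thesis using Cons J(1) word[of "[a]"] unfolding word_Cons[of a w]
          by (auto simp: is_weil_ideal_def wdeg_def)
      next
        case (Om h)
        then have "word [a] \<in> J" using J(2) by auto
        \<comment> \<open>An empty rest is a separate case: J absorbs elements of the non-unital
          algebra, and 1 is not among them.\<close>
        then show ?thesis using J(1) word[of w]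
          unfolding word_Cons[of a w] by (cases "w = []") (auto simp: is_weil_ideal_def one_weil_word[symmetric])
      qed
    qed
    then have "word ` {w. length w + 1 \<le> wdeg w} \<subseteq> J" by auto
    moreover have "csubspace J" using J(1) by (simp add: is_weil_ideal_def)
    ultimately show "x \<in> J" using x cvs.span_minimal by blast
  qed
qed

text \<open>For the inclusion from right to left a word is split behind its first \<omega>. For n =
  0 the inequality holds for all words, in agreement with \<open>om_power 0 = UNIV\<close>.\<close>

lemma om_power_eq: "om_power n = (wspan (\<lambda>w. length w + n \<le> wdeg w) :: 'h::complex_vector weil set)"
proof (induction n)
  case 0
  show ?case by (simp only: om_power.simps add_0_right length_le_wdeg wspan_UNIV)
next
  case (Suc n)
  have "x * y \<in> wspan (\<lambda>w. length w + Suc n \<le> wdeg w)"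
    if "x \<in> om_ideal" "y \<in> om_power n" for x y :: "'h weil"
    using that(1)[unfolded om_ideal_eq] that(2)[unfolded Suc]
    by (rule wspan_mult) (simp add: wdeg_append)
  then have 1: "om_power (Suc n) \<subseteq> (wspan (\<lambda>w. length w + Suc n \<le> wdeg w) :: 'h weil set)"
    unfolding om_power.simps by (intro cvs.span_minimal csubspace_wspan) blast
  have "word w \<in> (om_power (Suc n) :: 'h weil set)" if w: "length w + Suc n \<le> wdeg w" for w
  proof -
    obtain u v where uv: "w = u @ v" "length u + 1 \<le> wdeg u" "length v + n \<le> wdeg v"
      using om_split[OF w] by blast
    then have "word u \<in> (om_ideal :: 'h weil set)" "word v \<in> (om_power n :: 'h weil set)"
      unfolding om_ideal_eq Suc by (auto intro: wspan_word)
    then show ?thesis unfolding uv(1) word_append by (auto intro!: cvs.span_base)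
  qed
  then have "(wspan (\<lambda>w. length w + Suc n \<le> wdeg w) :: 'h weil set) \<subseteq> om_power (Suc n)"
    by (intro cvs.span_minimal) (auto intro: cvs.subspace_span)
  with 1 show ?case by auto
qed

lemma om_power_Suc_eq: "om_power (n + 1) = om_filtration (n + 1)"
  unfolding om_power_eq by (rule om_filtration_pos[symmetric]) simp

lemma om_filtration_cyc:
  assumes "x \<in> om_filtration n"
  shows "cyc_minus_one x \<in> om_filtration n" "cyc_norm x \<in> om_filtration n"
    "cyc_mean x \<in> om_filtration n" "cyc_homotopy x \<in> om_filtration n"
  using assms unfolding om_filtration_def
  by (auto intro!: cyc_minus_one_wspan cyc_norm_wspan cyc_mean_wspan cyc_homotopy_wspan
      simp: wdeg_rotate)

lemma weil_homog_cyc: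
  assumes "x \<in> weil_homog k"
  shows "cyc_minus_one x \<in> weil_homog k" "cyc_norm x \<in> weil_homog k"
  using assms by (auto intro!: cyc_minus_one_wspan cyc_norm_wspan simp: wdeg_rotate)

section \<open>The operator b and its relations\<close>

context coalgebra
begin

text \<open>So b is \<partial> with the term \<partial>(a) y of the first letter replaced by
  J(\<partial>a, y). The one-letter part of \<partial>a contributes as in \<partial>; the quadratic
  part \<partial>_0(a) contributes \<partial>_0(a) y and its rotation, and that rotation is
  b_t(ay).\<close>

lemma weil_b_letter_mult:
  "weil_b \<Delta> (word [a] * y) = partial_norm (weil_diff \<Delta> (word [a])) y
     + (-1) ^ gdeg a *\<^sub>C (word [a] * weil_diff \<Delta> y)"
proof (rule clinear_weil_eq[where x = y])
  show "clinear (\<lambda>y. weil_b \<Delta> (word [a] * y))"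
    by (intro clinear_comp[OF clinear_weil_b] clinear_intros)
  show "clinear (\<lambda>y. partial_norm (weil_diff \<Delta> (word [a])) y
     + (-1) ^ gdeg a *\<^sub>C (word [a] * weil_diff \<Delta> y))"
    by (intro clinear_intros clinear_weil_diff clinear_partial_norm_right)
  fix w :: "'h gen list"
  let ?d = "weil_diff \<Delta> (word [a])" and ?e = "weil_diff0 \<Delta> (word [a])"
  have *: "word [a] * word [b] \<in> wspan (\<lambda>w. length w = 2)" for a b :: "'h gen"
    unfolding word_append[symmetric] by (rule wspan_word) simp
  have 2: "?e \<in> wspan (\<lambda>w. length w = 2)"
    by (cases a; simp only: weil_diff0_gen[OF comult_linear] weil_diff0_om[OF comult_linear]
        weil_diff_om[OF comult_linear]) (intro cvs.span_diff cvs.span_neg tensor_ext_wspan *)+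
  \<comment> \<open>The difference is \<omega>_h for a = h and 0 for a = \<omega>_h.\<close>
  have 1: "?d - ?e \<in> wspan (\<lambda>w. length w = 1)"
    by (cases a) (auto simp: weil_diff_gen[OF comult_linear] weil_diff0_gen[OF comult_linear]
        weil_diff0_om[OF comult_linear] intro: wspan_word cvs.span_zero)
  have "partial_norm ?d (word w) = partial_norm ((?d - ?e) + ?e) (word w)"
    by simp
  also have "\<dots> = ?d * word w + cyc (?e * word w)"
    unfolding clinear_add[OF clinear_partial_norm_left] partial_norm_length_one[OF 1]
      partial_norm_length_two[OF 2] by (simp add: left_diff_distrib)
  finally have "partial_norm ?d (word w) = ?d * word w + cyc (?e * word w)" .
  then show "weil_b \<Delta> (word [a] * word w) = partial_norm ?d (word w)
      + (-1) ^ gdeg a *\<^sub>C (word [a] * weil_diff \<Delta> (word w))"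
    unfolding weil_b_def weil_diff_mult[OF word_letter_homog] weil_bt_Cons[OF comult_linear]
    by (simp only: ac_simps)
qed

lemma weil_b_word_Nil: "weil_b \<Delta> (word []) = 0"
  using weil_ext_word[OF word_linear_bt_word[OF comult_linear], of "[]"]
  by (simp add: weil_b_def weil_bt_def weil_diff_word_Nil)

text \<open>In terms of \<^const>\<open>partial_norm\<close>, the operator \<open>b\<close> obeys a Leibniz rule; this is the source of
  all identities between \<open>b\<close>, \<open>\<partial>\<close>, \<open>t\<close> and \<open>N\<close>.\<close>

lemma weil_b_partial_norm_word:
  "x \<in> weil_homog k \<Longrightarrow> weil_b \<Delta> (partial_norm (word u) x) =
     partial_norm (weil_diff \<Delta> (word u)) x + (-1) ^ wdeg u *\<^sub>C partial_norm (word u) (weil_diff \<Delta> x)"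
proof (induction u arbitrary: x k)
  case Nil
  have "partial_norm (word []) y = 0" for y :: "'h weil"
    by (rule clinear_weil_eq[OF clinear_partial_norm_right clinear_zero_fun])
      (simp add: partial_norm_word)
  then show ?case
    by (simp add: weil_diff_word_Nil clinear_zero[OF clinear_partial_norm_left]
        clinear_zero[OF clinear_weil_b] cvs.scale_zero_right)
next
  case (Cons a u)
  let ?a = "word [a]" and ?u = "word u"
  let ?d = "weil_diff \<Delta>" and ?J = "partial_norm :: 'h weil \<Rightarrow> _"
  note x = Cons.prems
  have a: "?a \<in> weil_homog (gdeg a)" and u: "?u \<in> weil_homog (wdeg u)"
    by (rule word_letter_homog) (rule weil_homog_word, rule refl)
  note da = weil_diff_homog[OF a] and du = weil_diff_homog[OF u] and dx = weil_diff_homog[OF x]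
  note lin = clinear_add[OF clinear_weil_b] clinear_scale[OF clinear_weil_b]
    clinear_add[OF clinear_partial_norm_left] clinear_scale[OF clinear_partial_norm_left]
    clinear_add[OF clinear_partial_norm_right] clinear_scale[OF clinear_partial_norm_right]
  have d: "?d (?u * x) = ?d ?u * x + (-1) ^ wdeg u *\<^sub>C (?u * ?d x)"
    "?d (x * ?a) = ?d x * ?a + (-1) ^ k *\<^sub>C (x * ?d ?a)"
    "?d (?a * ?u) = ?d ?a * ?u + (-1) ^ gdeg a *\<^sub>C (?a * ?d ?u)"
    by (rule weil_diff_mult, rule u x a)+
  \<comment> \<open>J(au, x) is aux plus a signed J(u, xa), so the induction hypothesis is used for
    xa; this is why x and its degree are arbitrary.\<close>
  have "weil_b \<Delta> (?J (?a * ?u) x) = ?J (?d ?a) (?u * x) + (-1) ^ gdeg a *\<^sub>C (?a * ?d (?u * x))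
      + (-1) ^ (gdeg a * (wdeg u + k)) *\<^sub>C
         (?J (?d ?u) (x * ?a) + (-1) ^ wdeg u *\<^sub>C ?J ?u (?d (x * ?a)))"
    unfolding partial_norm_mult[OF a u x] partial_norm_letter lin weil_b_letter_mult
      Cons.IH[OF weil_homog_mult[OF x a]] ..
  \<comment> \<open>Expanding J on products gives the same six terms on both sides; their signs
    depend on the parities of three degrees.\<close>
  also have "\<dots> = ?J (?d (?a * ?u)) x + (-1) ^ (gdeg a + wdeg u) *\<^sub>C ?J (?a * ?u) (?d x)"
    unfolding d lin partial_norm_mult[OF da u x] partial_norm_mult[OF a du x]
      partial_norm_mult[OF a u dx] partial_norm_letter
    by (cases "even (gdeg a)"; cases "even (wdeg u)"; cases "even k")
      (simp_all add: minus_one_power_iff scaleC_one cvs.scale_minus_left cvs.scale_minus_right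
        scaleC_add_right distrib_left algebra_simps)
  finally show ?case by (simp add: word_Cons[of a u] wdeg_def)
qed

lemma weil_b_partial_norm:
  assumes x: "x \<in> weil_homog i" and y: "y \<in> weil_homog j"
  shows "weil_b \<Delta> (partial_norm x y) =
     partial_norm (weil_diff \<Delta> x) y + (-1) ^ i *\<^sub>C partial_norm x (weil_diff \<Delta> y)"
  by (rule clinear_wspan_eq[OF _ _ _ x])
    (auto intro!: clinear_intros clinear_partial_norm_left clinear_comp[OF clinear_weil_b]
      clinear_comp[OF clinear_partial_norm_left] clinear_weil_diff
      simp: weil_b_partial_norm_word[OF y])

text \<open>The Leibniz rule for J with 1 as second argument, where \<partial>1 = 0.\<close>

lemma weil_b_cyc_norm: "weil_b \<Delta> (cyc_norm x) = cyc_norm (weil_diff \<Delta> x)"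
proof (rule clinear_weil_eq[where x = x])
  have 1: "(1 :: 'h weil) \<in> weil_homog 0" "weil_diff \<Delta> 1 = 0"
    unfolding one_weil_word by (rule weil_homog_word, simp add: wdeg_def) (rule weil_diff_word_Nil)
  show "weil_b \<Delta> (cyc_norm (word w)) = cyc_norm (weil_diff \<Delta> (word w))" for w
    using weil_b_partial_norm_word[OF 1(1), of w]
    by (simp add: 1(2) partial_norm_one clinear_zero[OF clinear_partial_norm_right]
        cvs.scale_zero_right)
qed (intro clinear_comp[OF clinear_weil_b] clinear_comp[OF clinear_cyc_norm] clinear_cyc_norm
    clinear_weil_diff)+

text \<open>Both J(\<partial>a, v) and a \<partial>v yield a term J(\<partial>a, \<partial>v) under
  b. The signs are opposite because \<partial>a has degree |a| + 1, and all other terms contain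
  \<partial>\<partial>.\<close>

lemma weil_b_squared: "weil_b \<Delta> (weil_b \<Delta> x) = 0"
proof (rule clinear_weil_eq[where x = x])
  fix w :: "'h gen list"
  show "weil_b \<Delta> (weil_b \<Delta> (word w)) = 0"
  proof (cases w)
    case Nil
    then show ?thesis by (simp add: weil_b_word_Nil clinear_zero[OF clinear_weil_b])
  next
    case (Cons a v)
    have v: "word v \<in> weil_homog (wdeg v)" by (rule weil_homog_word) simp
    show ?thesis
      unfolding Cons word_Cons[of a v] weil_b_letter_mult
      by (simp add: clinear_add[OF clinear_weil_b] clinear_scale[OF clinear_weil_b]
          weil_b_letter_mult weil_b_partial_norm[OF weil_diff_letter_homog v] weil_diff_squared
          weil_diff_squared_letter clinear_zero[OF clinear_partial_norm_left] cvs.scale_minus_left)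
  qed
qed (intro clinear_comp[OF clinear_weil_b] clinear_weil_b clinear_zero_fun)+

text \<open>As (t - 1)(av) is minus the graded commutator of a and v, the claim is the Leibniz rule
  of \<partial> for that commutator: up to sign, t - 1 turns J(\<partial>a, v) into the commutator
  of \<partial>a and v, and a \<partial>v into that of a and \<partial>v.\<close>

lemma cyc_minus_one_weil_b: "cyc_minus_one (weil_b \<Delta> x) = weil_diff \<Delta> (cyc_minus_one x)"
proof (rule clinear_weil_eq[where x = x])
  fix w :: "'h gen list"
  show "cyc_minus_one (weil_b \<Delta> (word w)) = weil_diff \<Delta> (cyc_minus_one (word w))"
  proof (cases w)
    case Nil
    have "cyc_minus_one (word [] :: 'h weil) = 0"
      using cyc_pow_length[of "[] :: 'h gen list"] weil_ext_word[OF word_linear_cyc_word, of "[]"]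
      by (simp add: cyc_minus_one_def cyc_def)
    then show ?thesis unfolding Nil
      by (simp add: weil_b_word_Nil clinear_zero[OF clinear_cyc_minus_one]
          clinear_zero[OF clinear_weil_diff])
  next
    case (Cons a v)
    have v: "word v \<in> weil_homog (wdeg v)" by (rule weil_homog_word) simp
    note a = word_letter_homog[of a]
    show ?thesis
      unfolding Cons word_Cons[of a v] weil_b_letter_mult cyc_minus_one_letter_mult[OF v]
        clinear_add[OF clinear_cyc_minus_one] clinear_scale[OF clinear_cyc_minus_one]
        cyc_minus_one_partial_norm[OF weil_diff_letter_homog v] cyc_minus_one_letter_mult[OF weil_diff_homog[OF v]]
        clinear_diff[OF clinear_weil_diff] clinear_scale[OF clinear_weil_diff]
        weil_diff_mult[OF v] weil_diff_mult[OF a]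
      by (cases "even (gdeg a)"; cases "even (wdeg v)")
        (simp_all add: minus_one_power_iff scaleC_one cvs.scale_minus_left cvs.scale_minus_right)
  qed
qed (intro clinear_comp[OF clinear_weil_b] clinear_comp[OF clinear_cyc_minus_one]
    clinear_comp[OF clinear_weil_diff] clinear_weil_b clinear_cyc_minus_one)+

text \<open>P and Q record what is known of the words in \<partial>a and in \<partial>w; R has to be
  rotation invariant because J rotates.\<close>

lemma weil_b_wspan_letter:
  assumes "weil_diff \<Delta> (word [a]) \<in> wspan P" "weil_diff \<Delta> (word w) \<in> wspan Q"
    and "\<And>u. P u \<Longrightarrow> R (u @ w)" "\<And>v. Q v \<Longrightarrow> R (a # v)" "\<And>w i. R w \<Longrightarrow> R (rotate i w)"
  shows "weil_b \<Delta> (word (a # w)) \<in> wspan R"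
  unfolding word_Cons[of a w] weil_b_letter_mult
proof (intro cvs.span_add cvs.span_scale)
  show "partial_norm (weil_diff \<Delta> (word [a])) (word w) \<in> wspan R"
    by (rule partial_norm_wspan[OF assms(1) wspan_word[of "\<lambda>v. v = w"]]) (use assms(3,5) in auto)
  show "word [a] * weil_diff \<Delta> (word w) \<in> wspan R"
    by (rule wspan_mult[OF wspan_word[of "\<lambda>v. v = [a]"] assms(2)]) (use assms(4) in auto)
qed

lemma weil_b_homog:
  assumes "x \<in> weil_homog k"
  shows "weil_b \<Delta> x \<in> weil_homog (Suc k)"
proof (rule clinear_wspan[OF clinear_weil_b csubspace_wspan _ assms])
  fix w :: "'h gen list" assume k: "wdeg w = k"
  show "weil_b \<Delta> (word w) \<in> weil_homog (Suc k)"
  proof (cases w)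
    case (Cons a v)
    have "word v \<in> weil_homog (wdeg v)" by (rule weil_homog_word) simp
    then show ?thesis unfolding Cons
      by (rule weil_b_wspan_letter[OF weil_diff_letter_homog weil_diff_homog])
        (use Cons k in \<open>auto simp: wdeg_Cons wdeg_append wdeg_rotate\<close>)
  qed (simp add: weil_b_word_Nil cvs.span_zero)
qed

text \<open>Degree minus length counts letters \<omega>: a has \<open>gdeg a - 1\<close> of them,
  and no word in \<partial>a has fewer. The inequality is arranged so as to avoid
  subtraction.\<close>

lemma weil_diff_letter_om:
  "weil_diff \<Delta> (word [a]) \<in> wspan (\<lambda>w. w \<noteq> [] \<and> length w + gdeg a \<le> wdeg w + 1)"
proof -
  have *: "word [a] * word [b] \<in> wspan (\<lambda>w. w \<noteq> [] \<and> length w + n \<le> wdeg w + 1)"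
    if "1 + n \<le> gdeg a + gdeg b" for a b :: "'h gen" and n
    unfolding word_append[symmetric] by (rule wspan_word) (use that in \<open>simp add: wdeg_def\<close>)
  show ?thesis
    by (cases a; simp only: weil_diff_gen[OF comult_linear] weil_diff_om[OF comult_linear])
      (intro cvs.span_diff tensor_ext_wspan wspan_word *; simp add: wdeg_def)+
qed

text \<open>Replacing a letter a by \<partial>a never lowers the number of letters \<omega>. The
  hypothesis admits the empty word and the conclusion excludes it, which fits \<partial>1 = 0; this
  covers the empty rest of a one-letter word.\<close>

lemma weil_diff_om_filtration:
  "x \<in> wspan (\<lambda>w. length w + n \<le> wdeg w) \<Longrightarrow> weil_diff \<Delta> x \<in> om_filtration n"
  unfolding om_filtration_def
proof (erule weil_diff_wspan)
  fix u v :: "'h gen list" and a assume *: "length (u @ a # v) + n \<le> wdeg (u @ a # v)"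
  have "word u * weil_diff \<Delta> (word [a])
     \<in> wspan (\<lambda>w. w \<noteq> [] \<and> length w + wdeg u + gdeg a \<le> wdeg w + length u + 1)"
    by (rule wspan_mult[OF wspan_word[of "\<lambda>w. w = u"] weil_diff_letter_om])
      (auto simp: wdeg_append)
  then show "word u * weil_diff \<Delta> (word [a]) * word v
     \<in> wspan (\<lambda>w. w \<noteq> [] \<and> length w + n \<le> wdeg w)"
    by (rule wspan_mult[OF _ wspan_word[of "\<lambda>w. w = v"]])
      (use * in \<open>auto simp: wdeg_append wdeg_Cons\<close>)
qed

lemma weil_b_om_filtration:
  assumes "x \<in> om_filtration n"
  shows "weil_b \<Delta> x \<in> om_filtration n"
  using assms unfolding om_filtration_def
proof (rule clinear_wspan[OF clinear_weil_b csubspace_wspan, rotated])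
  fix w :: "'h gen list" assume w: "w \<noteq> [] \<and> length w + n \<le> wdeg w"
  then obtain a v where v: "w = a # v" by (cases w) auto
  \<comment> \<open>The index is the exact number of letters \<omega> in v, so that it adds up with
    that of a to the number in w.\<close>
  have "word v \<in> wspan (\<lambda>w. length w + (wdeg v - length v) \<le> wdeg w)"
    using length_le_wdeg[of v] by (intro wspan_word) simp
  note weil_diff_om_filtration[OF this, unfolded om_filtration_def]
  then show "weil_b \<Delta> (word w) \<in> wspan (\<lambda>w. w \<noteq> [] \<and> length w + n \<le> wdeg w)"
    unfolding v by (rule weil_b_wspan_letter[OF weil_diff_letter_om])
      (use w v length_le_wdeg[of v] in \<open>auto simp: wdeg_rotate wdeg_append\<close>,
       auto simp: wdeg_def)
qed

end

section \<open>Graded modules and their quotients\<close>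

lemma complex_ring_simps [simp]:
  "carrier complex_ring = UNIV" "\<zero>\<^bsub>complex_ring\<^esub> = 0" "\<one>\<^bsub>complex_ring\<^esub> = 1"
  "a \<oplus>\<^bsub>complex_ring\<^esub> b = a + b" "a \<otimes>\<^bsub>complex_ring\<^esub> b = a * b"
  by (simp_all add: ring_of_type_algebra_def)

lemma cring_complex_ring: "cring complex_ring"
  by (rule cring_from_type_algebra)

lemma complex_ring_uminus_one: "\<ominus>\<^bsub>complex_ring\<^esub> 1 = -1"
proof -
  interpret cring complex_ring by (rule cring_complex_ring)
  show ?thesis using minus_equality[of "-1" 1] by simp
qed

abbreviation complex_module :: "('a, 'm) graded_complex_scheme \<Rightarrow> bool" where
  "complex_module C \<equiv> Module.module complex_ring C"

lemma complex_module_uminus: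
  assumes "complex_module C" "x \<in> carrier C"
  shows "\<ominus>\<^bsub>C\<^esub> x = (-1) \<odot>\<^bsub>C\<^esub> x"
proof -
  interpret Module.module complex_ring C by fact
  show ?thesis using smult_l_minus[of 1 x] smult_one[of x] assms(2)
    by (simp add: complex_ring_uminus_one)
qed

lemma complex_submoduleI:
  assumes C: "complex_module C" and "H \<subseteq> carrier C" "\<zero>\<^bsub>C\<^esub> \<in> H"
    and "\<And>a b. a \<in> H \<Longrightarrow> b \<in> H \<Longrightarrow> a \<oplus>\<^bsub>C\<^esub> b \<in> H"
    and "\<And>c x. x \<in> H \<Longrightarrow> c \<odot>\<^bsub>C\<^esub> x \<in> H"
  shows "submodule H complex_ring C"
  by (rule Module.module.submoduleI[OF C])
    (use assms complex_module_uminus[OF C] in \<open>auto simp: subset_iff\<close>)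

lemma complex_submoduleD:
  assumes C: "complex_module C" and H: "submodule H complex_ring C"
  shows "H \<subseteq> carrier C" "\<zero>\<^bsub>C\<^esub> \<in> H" "\<And>a b. a \<in> H \<Longrightarrow> b \<in> H \<Longrightarrow> a \<oplus>\<^bsub>C\<^esub> b \<in> H"
    "\<And>c x. x \<in> H \<Longrightarrow> c \<odot>\<^bsub>C\<^esub> x \<in> H" "\<And>a. a \<in> H \<Longrightarrow> \<ominus>\<^bsub>C\<^esub> a \<in> H"
    "\<And>a b. a \<in> H \<Longrightarrow> b \<in> H \<Longrightarrow> a \<ominus>\<^bsub>C\<^esub> b \<in> H"
  using Module.module.submoduleE[OF C H] subgroup.one_closed[OF submodule.axioms(1)[OF H]]
  by (auto simp: a_minus_def)

lemma linear_map_zero: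
  assumes "complex_module C" "complex_module D" "linear_map C D f"
  shows "f \<zero>\<^bsub>C\<^esub> = \<zero>\<^bsub>D\<^esub>"
proof -
  interpret C: Module.module complex_ring C by fact
  interpret D: Module.module complex_ring D by fact
  have "f (0 \<odot>\<^bsub>C\<^esub> \<zero>\<^bsub>C\<^esub>) = 0 \<odot>\<^bsub>D\<^esub> f \<zero>\<^bsub>C\<^esub>" "f \<zero>\<^bsub>C\<^esub> \<in> carrier D"
    using assms(3) C.zero_closed unfolding linear_map_def by blast+
  then show ?thesis using C.smult_l_null[of "\<zero>\<^bsub>C\<^esub>"] D.smult_l_null[of "f \<zero>\<^bsub>C\<^esub>"] by simp
qed

lemma linear_map_minus:
  assumes "complex_module C" "complex_module D" "linear_map C D f" "x \<in> carrier C" "y \<in> carrier C"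
  shows "f (x \<ominus>\<^bsub>C\<^esub> y) = f x \<ominus>\<^bsub>D\<^esub> f y"
proof -
  interpret C: Module.module complex_ring C by fact
  interpret D: Module.module complex_ring D by fact
  have "f y \<in> carrier D" using assms by (auto simp: linear_map_def)
  then show ?thesis using assms C.smult_closed[of "-1" y]
    by (simp add: a_minus_def complex_module_uminus linear_map_def)
qed

lemma linear_map_finsum:
  assumes "complex_module C" "complex_module D" "linear_map C D f"
    and "finite A" "g \<in> A \<rightarrow> carrier C"
  shows "f (finsum C g A) = finsum D (\<lambda>i. f (g i)) A"
  using assms(4,5)
proof (induction A rule: finite_induct)
  interpret C: Module.module complex_ring C by fact
  interpret D: Module.module complex_ring D by fact
  case empty
  then show ?case by (simp add: linear_map_zero[OF assms(1-3)])
next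
  interpret C: Module.module complex_ring C by fact
  interpret D: Module.module complex_ring D by fact
  case (insert a A)
  then have "(\<lambda>i. f (g i)) \<in> A \<rightarrow> carrier D" "f (g a) \<in> carrier D"
    using assms(3) by (auto simp: linear_map_def)
  with insert show ?case using assms(3)
    by (simp add: C.finsum_insert D.finsum_insert linear_map_def Pi_def)
qed

lemma submodule_image:
  assumes "complex_module B" "complex_module C" "linear_map B C s"
  shows "submodule (s ` carrier B) complex_ring C"
proof (rule complex_submoduleI[OF assms(2)])
  interpret B: Module.module complex_ring B by fact
  show "\<zero>\<^bsub>C\<^esub> \<in> s ` carrier B"
    using linear_map_zero[OF assms] B.zero_closed by force
  fix a b assume "a \<in> s ` carrier B" "b \<in> s ` carrier B"
  then obtain x y where x: "a = s x" "b = s y" "x \<in> carrier B" "y \<in> carrier B" by blast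
  then have "a \<oplus>\<^bsub>C\<^esub> b = s (x \<oplus>\<^bsub>B\<^esub> y)" using assms(3) by (simp add: linear_map_def)
  then show "a \<oplus>\<^bsub>C\<^esub> b \<in> s ` carrier B" using x by simp
next
  interpret B: Module.module complex_ring B by fact
  fix c a assume "a \<in> s ` carrier B"
  then obtain x where x: "a = s x" "x \<in> carrier B" by blast
  then have "c \<odot>\<^bsub>C\<^esub> a = s (c \<odot>\<^bsub>B\<^esub> x)" "c \<odot>\<^bsub>B\<^esub> x \<in> carrier B"
    using assms(3) by (simp_all add: linear_map_def)
  then show "c \<odot>\<^bsub>C\<^esub> a \<in> s ` carrier B" by simp
next
  show "s ` carrier B \<subseteq> carrier C" using assms(3) by (auto simp: linear_map_def)
qed

section \<open>Gradings through projections\<close>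

text \<open>Replaces the unique existence in \<open>graded_space\<close> by explicit linear
  projections, which restrict to stable subspaces and descend to quotients.\<close>

definition graded_projections ::
    "('a, 'm) graded_complex_scheme \<Rightarrow> (nat \<Rightarrow> 'a \<Rightarrow> 'a) \<Rightarrow> bool" where
  "graded_projections C p \<longleftrightarrow>
     complex_module C \<and> (\<forall>k. submodule (homog C k) complex_ring C) \<and>
     (\<forall>k. linear_map C C (p k)) \<and> (\<forall>k. p k ` carrier C \<subseteq> homog C k) \<and>
     (\<forall>j k. \<forall>x\<in>homog C k. p j x = (if j = k then x else \<zero>\<^bsub>C\<^esub>)) \<and>
     (\<forall>x\<in>carrier C. finite {k. p k x \<noteq> \<zero>\<^bsub>C\<^esub>} \<and>
        x = finsum C (\<lambda>k. p k x) {k. p k x \<noteq> \<zero>\<^bsub>C\<^esub>})"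

lemma graded_projections_submodule:
  "graded_projections C p \<Longrightarrow> submodule (homog C k) complex_ring C"
  by (simp add: graded_projections_def)

text \<open>For uniqueness the j-th projection is applied to a decomposition of x: it annihilates
  all summands but the j-th.\<close>

lemma graded_space_projections:
  assumes "graded_projections C p"
  shows "graded_space C"
proof -
  have C: "complex_module C" and H: "submodule (homog C k) complex_ring C" and p: "linear_map C C (p k)"
    and ph: "x \<in> carrier C \<Longrightarrow> p k x \<in> homog C k"
    and pk: "x \<in> homog C k \<Longrightarrow> p j x = (if j = k then x else \<zero>\<^bsub>C\<^esub>)"
    and px: "x \<in> carrier C \<Longrightarrow> finite {k. p k x \<noteq> \<zero>\<^bsub>C\<^esub>} \<and>
        x = finsum C (\<lambda>k. p k x) {k. p k x \<noteq> \<zero>\<^bsub>C\<^esub>}" for j k x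
    using assms by (auto simp: graded_projections_def image_subset_iff)
  interpret C: Module.module complex_ring C by fact
  have "f = (\<lambda>k. p k x)" if f: "\<And>k. f k \<in> homog C k" "finite {k. f k \<noteq> \<zero>\<^bsub>C\<^esub>}"
    "x = finsum C f {k. f k \<noteq> \<zero>\<^bsub>C\<^esub>}" for f x
  proof
    fix j
    have fc: "f k \<in> carrier C" for k using f(1) complex_submoduleD(1)[OF C H] by blast
    have "p j x = finsum C (\<lambda>i. p j (f i)) {k. f k \<noteq> \<zero>\<^bsub>C\<^esub>}"
      by (subst f(3), rule linear_map_finsum[OF C C p f(2)]) (use fc in auto)
    also have "\<dots> = finsum C (\<lambda>i. if j = i then f i else \<zero>\<^bsub>C\<^esub>) {k. f k \<noteq> \<zero>\<^bsub>C\<^esub>}"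
      by (rule C.finsum_cong) (use pk[OF f(1)] fc in \<open>auto simp: simp_implies_def\<close>)
    also have "\<dots> = f j"
    proof (cases "f j = \<zero>\<^bsub>C\<^esub>")
      case True
      then have "finsum C (\<lambda>i. if j = i then f i else \<zero>\<^bsub>C\<^esub>) {k. f k \<noteq> \<zero>\<^bsub>C\<^esub>}
          = finsum C (\<lambda>i. \<zero>\<^bsub>C\<^esub>) {k. f k \<noteq> \<zero>\<^bsub>C\<^esub>}"
        by (intro C.finsum_cong) (auto simp: simp_implies_def)
      with True show ?thesis by (simp add: C.finsum_zero)
    next
      case False
      then show ?thesis
        using C.finsum_singleton[of j "{k. f k \<noteq> \<zero>\<^bsub>C\<^esub>}" f] f(2) fc by simp
    qed
    finally show "f j = p j x" by simp
  qed
  then have "\<exists>!f. (\<forall>k. f k \<in> homog C k) \<and> finite {k. f k \<noteq> \<zero>\<^bsub>C\<^esub>} \<and>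
        x = finsum C f {k. f k \<noteq> \<zero>\<^bsub>C\<^esub>}" if "x \<in> carrier C" for x
    using px[OF that] ph[OF that] by (intro ex1I[of _ "\<lambda>k. p k x"]) auto
  then show ?thesis using C H by (simp add: graded_space_def)
qed

text \<open>The module structure does not involve \<open>diff\<close>; these rules let a complex and
  its version with b share all facts on the underlying graded space.\<close>

lemma complex_module_diff_update [simp]:
  "complex_module (C\<lparr>diff := d\<rparr>) = complex_module C"
  by (simp add: module_def abelian_group_def abelian_monoid_def abelian_group_axioms_def
      module_axioms_def)

lemma submodule_diff_update [simp]:
  "submodule H R (C\<lparr>diff := d\<rparr>) = submodule H R C"
  by (simp add: submodule_def submodule_axioms_def)

lemma linear_map_diff_update [simp]:
  "linear_map (C\<lparr>diff := d\<rparr>) D f = linear_map C D f"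
  "linear_map C (D\<lparr>diff := d\<rparr>) f = linear_map C D f"
  by (simp_all add: linear_map_def)

lemma graded_projections_diff_update [simp]:
  "graded_projections (C\<lparr>diff := d\<rparr>) p = graded_projections C p"
  by (simp add: graded_projections_def finsum_def)

lemma cochain_complexI:
  assumes "graded_projections C p" "linear_map C C d" "\<And>k. d ` homog C k \<subseteq> homog C (Suc k)"
    "\<And>x. x \<in> carrier C \<Longrightarrow> d (d x) = \<zero>\<^bsub>C\<^esub>"
  shows "cochain_complex (C\<lparr>diff := d\<rparr>)"
  using assms graded_space_projections[of "C\<lparr>diff := d\<rparr>" p] by (simp add: cochain_complex_def)

section \<open>Quotient complexes\<close>

locale complex_quotient =
  fixes C :: "'a graded_complex" and U :: "'a set"
  assumes module: "complex_module C" and submodule: "submodule U complex_ring C"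
begin

sublocale Module.module complex_ring C by (rule module)

sublocale abelian_subgroup U C
  by (intro abelian_subgroupI3 additive_subgroup.intro submodule.axioms(1)[OF submodule])
    (rule Module.module.axioms(2)[OF module])

abbreviation proj :: "'a \<Rightarrow> 'a set" where "proj x \<equiv> U +>\<^bsub>C\<^esub> x"

abbreviation Q :: "'a set graded_complex" where "Q \<equiv> quot_complex C U"

lemma U_closed:
  "x \<in> U \<Longrightarrow> x \<in> carrier C" "\<zero>\<^bsub>C\<^esub> \<in> U" "x \<in> U \<Longrightarrow> y \<in> U \<Longrightarrow> x \<oplus>\<^bsub>C\<^esub> y \<in> U"
  "x \<in> U \<Longrightarrow> c \<odot>\<^bsub>C\<^esub> x \<in> U"
  using complex_submoduleD[OF module submodule] by auto

lemma proj_eq_iff: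
  assumes "x \<in> carrier C" "y \<in> carrier C"
  shows "proj x = proj y \<longleftrightarrow> x \<ominus>\<^bsub>C\<^esub> y \<in> U"
proof
  assume "proj x = proj y"
  then have "x \<in> proj y" using a_rcos_self[OF assms(1)] by simp
  then obtain u where "u \<in> U" "x = u \<oplus>\<^bsub>C\<^esub> y" by (auto simp: a_r_coset_def')
  then show "x \<ominus>\<^bsub>C\<^esub> y \<in> U" using assms
    by (simp add: a_minus_def U_closed a_assoc r_neg)
next
  assume "x \<ominus>\<^bsub>C\<^esub> y \<in> U"
  moreover have "x = (x \<ominus>\<^bsub>C\<^esub> y) \<oplus>\<^bsub>C\<^esub> y" using assms by (simp add: a_minus_def a_assoc l_neg)
  ultimately have "x \<in> proj y" by (auto simp: a_r_coset_def')
  then show "proj x = proj y"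
    using a_repr_independence' assms by metis
qed

lemma proj_zero: "proj \<zero>\<^bsub>C\<^esub> = U"
  using U_closed(1) by (auto simp: a_r_coset_def')

lemma proj_eq_zero: "x \<in> carrier C \<Longrightarrow> proj x = U \<longleftrightarrow> x \<in> U"
  using proj_eq_iff[of x "\<zero>\<^bsub>C\<^esub>"] minus_equality[of "\<zero>\<^bsub>C\<^esub>" "\<zero>\<^bsub>C\<^esub>"]
  by (simp add: proj_zero a_minus_def)

lemma carrier_Q: "carrier Q = proj ` carrier C"
  by (auto simp: quot_complex_def A_RCOSETS_def')

lemma zero_Q: "\<zero>\<^bsub>Q\<^esub> = U"
  by (simp add: quot_complex_def)

lemma homog_Q: "homog Q k = proj ` homog C k"
  by (simp add: quot_complex_def)

lemma add_Q: "x \<in> carrier C \<Longrightarrow> y \<in> carrier C \<Longrightarrow> proj x \<oplus>\<^bsub>Q\<^esub> proj y = proj (x \<oplus>\<^bsub>C\<^esub> y)"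
  by (simp add: quot_complex_def a_rcos_sum)

text \<open>The assumption on f makes the image of the coset a singleton, whose element
  \<open>descend\<close> returns.\<close>

lemma descend_proj:
  assumes "x \<in> carrier C" "\<And>u. u \<in> U \<Longrightarrow> f (u \<oplus>\<^bsub>C\<^esub> x) = f x"
  shows "descend f (proj x) = f x"
proof -
  have "f ` proj x = {f x}"
    using assms(2) a_rcos_self[OF assms(1)] by (auto simp: a_r_coset_def')
  then show ?thesis by (simp add: descend_def)
qed

lemma quot_map_proj:
  assumes f: "linear_map C C f" and "f ` U \<subseteq> U" and x: "x \<in> carrier C"
  shows "quot_map C U f (proj x) = proj (f x)"
  unfolding quot_map_def
proof (rule descend_proj[OF x])
  fix u assume u: "u \<in> U"
  have c: "f u \<in> carrier C" "f x \<in> carrier C" "f u \<in> U"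
    using assms u U_closed(1) by (auto simp: linear_map_def)
  have "f (u \<oplus>\<^bsub>C\<^esub> x) = f u \<oplus>\<^bsub>C\<^esub> f x"
    using f u x U_closed(1) by (simp add: linear_map_def)
  moreover have "(f u \<oplus>\<^bsub>C\<^esub> f x) \<ominus>\<^bsub>C\<^esub> f x = f u" using c by (simp add: a_minus_def a_assoc r_neg)
  ultimately show "proj (f (u \<oplus>\<^bsub>C\<^esub> x)) = proj (f x)"
    using c by (simp add: proj_eq_iff)
qed

lemma linear_map_smult: "linear_map C C (\<lambda>x. c \<odot>\<^bsub>C\<^esub> x)"
  by (auto simp: linear_map_def smult_r_distr smult_assoc1[symmetric, simplified] mult.commute)

lemma smult_Q: "x \<in> carrier C \<Longrightarrow> c \<odot>\<^bsub>Q\<^esub> proj x = proj (c \<odot>\<^bsub>C\<^esub> x)"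
  using quot_map_proj[OF linear_map_smult[of c]] U_closed(4)
  by (auto simp: quot_complex_def)

lemma module_Q: "complex_module Q"
proof (rule Module.moduleI[OF cring_complex_ring])
  show "abelian_group Q"
  proof (rule abelian_groupI)
    fix S T V assume "S \<in> carrier Q" "T \<in> carrier Q" "V \<in> carrier Q"
    then obtain x y z where *: "S = proj x" "T = proj y" "V = proj z"
      "x \<in> carrier C" "y \<in> carrier C" "z \<in> carrier C" by (auto simp: carrier_Q)
    then show "S \<oplus>\<^bsub>Q\<^esub> T \<in> carrier Q" "S \<oplus>\<^bsub>Q\<^esub> T \<oplus>\<^bsub>Q\<^esub> V = S \<oplus>\<^bsub>Q\<^esub> (T \<oplus>\<^bsub>Q\<^esub> V)"
      by (auto simp: add_Q carrier_Q a_assoc)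
    show "S \<oplus>\<^bsub>Q\<^esub> T = T \<oplus>\<^bsub>Q\<^esub> S" using * by (simp add: add_Q a_comm)
  next
    show "\<zero>\<^bsub>Q\<^esub> \<in> carrier Q" using proj_zero by (force simp: zero_Q carrier_Q)
    fix S assume "S \<in> carrier Q"
    then obtain x where x: "S = proj x" "x \<in> carrier C" by (auto simp: carrier_Q)
    show "\<zero>\<^bsub>Q\<^esub> \<oplus>\<^bsub>Q\<^esub> S = S" using x add_Q[of "\<zero>\<^bsub>C\<^esub>" x] by (simp add: zero_Q proj_zero)
    have "proj (\<ominus>\<^bsub>C\<^esub> x) \<oplus>\<^bsub>Q\<^esub> S = \<zero>\<^bsub>Q\<^esub>"
      using x by (simp add: add_Q l_neg zero_Q proj_zero)
    then show "\<exists>T\<in>carrier Q. T \<oplus>\<^bsub>Q\<^esub> S = \<zero>\<^bsub>Q\<^esub>" using x by (auto simp: carrier_Q)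
  qed
next
  fix a b :: complex and S T assume "S \<in> carrier Q" "T \<in> carrier Q"
  then obtain x y where *: "S = proj x" "T = proj y" "x \<in> carrier C" "y \<in> carrier C"
    by (auto simp: carrier_Q)
  have s: "c \<odot>\<^bsub>C\<^esub> z \<in> carrier C" if "z \<in> carrier C" for c z using that by simp
  show "a \<odot>\<^bsub>Q\<^esub> (S \<oplus>\<^bsub>Q\<^esub> T) = a \<odot>\<^bsub>Q\<^esub> S \<oplus>\<^bsub>Q\<^esub> a \<odot>\<^bsub>Q\<^esub> T"
    using * by (simp add: add_Q smult_Q s smult_r_distr)
next
  fix a b :: complex and S assume "S \<in> carrier Q"
  then obtain x where *: "S = proj x" "x \<in> carrier C" by (auto simp: carrier_Q)
  have s: "c \<odot>\<^bsub>C\<^esub> z \<in> carrier C" if "z \<in> carrier C" for c z using that by simp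
  show "(a \<oplus>\<^bsub>complex_ring\<^esub> b) \<odot>\<^bsub>Q\<^esub> S = a \<odot>\<^bsub>Q\<^esub> S \<oplus>\<^bsub>Q\<^esub> b \<odot>\<^bsub>Q\<^esub> S"
    "(a \<otimes>\<^bsub>complex_ring\<^esub> b) \<odot>\<^bsub>Q\<^esub> S = a \<odot>\<^bsub>Q\<^esub> (b \<odot>\<^bsub>Q\<^esub> S)"
    "\<one>\<^bsub>complex_ring\<^esub> \<odot>\<^bsub>Q\<^esub> S = S" "a \<odot>\<^bsub>Q\<^esub> S \<in> carrier Q"
    using * smult_l_distr[of a b x] smult_assoc1[of a b x] smult_one[of x]
    by (auto simp: add_Q smult_Q s carrier_Q)
qed

lemma linear_map_proj: "linear_map C Q proj"
  by (auto simp: linear_map_def add_Q smult_Q carrier_Q)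

lemma linear_map_quot_map:
  assumes f: "linear_map C C f" and U: "f ` U \<subseteq> U"
  shows "linear_map Q Q (quot_map C U f)"
  using f unfolding linear_map_def
  by (auto simp: carrier_Q add_Q smult_Q quot_map_proj[OF f U] Pi_iff)

lemma submodule_proj:
  assumes "submodule H complex_ring C"
  shows "submodule (proj ` H) complex_ring Q"
proof (rule complex_submoduleI[OF module_Q])
  note H = complex_submoduleD[OF module assms]
  show "\<zero>\<^bsub>Q\<^esub> \<in> proj ` H" using H(2) proj_zero by (force simp: zero_Q)
  fix S T assume "S \<in> proj ` H" "T \<in> proj ` H"
  with H show "S \<oplus>\<^bsub>Q\<^esub> T \<in> proj ` H" by (auto simp: add_Q subset_iff)
next
  note H = complex_submoduleD[OF module assms]
  show "proj ` H \<subseteq> carrier Q" using H(1) by (auto simp: carrier_Q)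
  fix S c assume "S \<in> proj ` H"
  with H show "c \<odot>\<^bsub>Q\<^esub> S \<in> proj ` H" by (auto simp: smult_Q subset_iff)
qed

text \<open>Stability under the projections says that U is a graded subspace.\<close>

lemma graded_projections_Q:
  assumes gp: "graded_projections C p" and U: "\<And>k. p k ` U \<subseteq> U"
  shows "graded_projections Q (\<lambda>k. quot_map C U (p k))"
proof -
  have H: "submodule (homog C k) complex_ring C" and p: "linear_map C C (p k)"
    and ph: "x \<in> carrier C \<Longrightarrow> p k x \<in> homog C k"
    and pk: "x \<in> homog C k \<Longrightarrow> p j x = (if j = k then x else \<zero>\<^bsub>C\<^esub>)"
    and px: "x \<in> carrier C \<Longrightarrow> finite {k. p k x \<noteq> \<zero>\<^bsub>C\<^esub>} \<and>
        x = finsum C (\<lambda>k. p k x) {k. p k x \<noteq> \<zero>\<^bsub>C\<^esub>}" for j k x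
    using gp by (auto simp: graded_projections_def image_subset_iff)
  interpret Q: Module.module complex_ring Q by (rule module_Q)
  note qp = quot_map_proj[OF p U]
  have hc: "x \<in> homog C k \<Longrightarrow> x \<in> carrier C" for x k
    using complex_submoduleD(1)[OF module H] by blast
  have sum: "finite {k. proj (p k x) \<noteq> U} \<and> proj x = finsum Q (\<lambda>k. proj (p k x)) {k. proj (p k x) \<noteq> U}"
    if x: "x \<in> carrier C" for x
  proof
    let ?K = "{k. p k x \<noteq> \<zero>\<^bsub>C\<^esub>}"
    have pc: "p k x \<in> carrier C" for k by (rule hc[OF ph[OF x]])
    have sub: "{k. proj (p k x) \<noteq> U} \<subseteq> ?K" by (auto simp: proj_zero)
    show "finite {k. proj (p k x) \<noteq> U}" by (rule finite_subset[OF sub]) (use px[OF x] in blast)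
    have "proj x = proj (finsum C (\<lambda>k. p k x) ?K)" using px[OF x] by simp
    also have "\<dots> = finsum Q (\<lambda>k. proj (p k x)) ?K"
      by (rule linear_map_finsum[OF module module_Q linear_map_proj]) (use px[OF x, THEN conjunct1] pc in auto)
    \<comment> \<open>Components of x that lie in U vanish in the quotient, so the support may
      shrink without changing the sum.\<close>
    also have "\<dots> = finsum Q (\<lambda>k. proj (p k x)) {k. proj (p k x) \<noteq> U}"
      by (rule Q.add.finprod_mono_neutral_cong_right)
        (use px[OF x, THEN conjunct1] sub pc in \<open>auto simp: carrier_Q zero_Q\<close>)
    finally show "proj x = finsum Q (\<lambda>k. proj (p k x)) {k. proj (p k x) \<noteq> U}" .
  qed
  show ?thesis
    unfolding graded_projections_def
  proof (intro conjI allI ballI)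
    fix S assume "S \<in> carrier Q"
    then obtain x where x: "S = proj x" "x \<in> carrier C" by (auto simp: carrier_Q)
    then show "finite {k. quot_map C U (p k) S \<noteq> \<zero>\<^bsub>Q\<^esub>}"
      using sum[OF x(2), THEN conjunct1] by (simp add: qp zero_Q)
    show "S = finsum Q (\<lambda>k. quot_map C U (p k) S) {k. quot_map C U (p k) S \<noteq> \<zero>\<^bsub>Q\<^esub>}"
      unfolding x(1) qp[OF x(2)] zero_Q by (rule sum[OF x(2), THEN conjunct2])
  qed (use ph pk hc in \<open>auto simp: module_Q homog_Q submodule_proj[OF H] linear_map_quot_map[OF p U]
      carrier_Q qp zero_Q proj_zero\<close>)
qed

text \<open>d is a parameter and not \<open>diff C\<close>, so that one quotient can carry either
  \<partial> or b.\<close>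

lemma cochain_complex_Q:
  assumes gp: "graded_projections C p" and U: "\<And>k. p k ` U \<subseteq> U"
    and d: "linear_map C C d" "d ` U \<subseteq> U" "\<And>k. d ` homog C k \<subseteq> homog C (Suc k)"
      "\<And>x. x \<in> carrier C \<Longrightarrow> d (d x) = \<zero>\<^bsub>C\<^esub>"
  shows "cochain_complex (Q\<lparr>diff := quot_map C U d\<rparr>)"
proof (rule cochain_complexI[OF graded_projections_Q[OF gp U] linear_map_quot_map[OF d(1,2)]])
  have hc: "homog C k \<subseteq> carrier C" for k
    by (rule complex_submoduleD(1)[OF module graded_projections_submodule[OF gp]])
  note q = quot_map_proj[OF d(1,2)]
  have c: "d x \<in> carrier C" if "x \<in> carrier C" for x using d(1) that by (auto simp: linear_map_def)
  show "quot_map C U d ` homog Q k \<subseteq> homog Q (Suc k)" for k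
    unfolding homog_Q using hc[of k] q d(3)[of k] by (auto simp: subset_iff image_subset_iff)
  show "quot_map C U d (quot_map C U d S) = \<zero>\<^bsub>Q\<^esub>" if "S \<in> carrier Q" for S
    using that by (auto simp: carrier_Q q c d(4) zero_Q proj_zero)
qed

lemma chain_map_Q:
  assumes f: "linear_map C C f" "f ` U \<subseteq> U" "\<And>k. f ` homog C k \<subseteq> homog C k"
    and d: "linear_map C C d" "d ` U \<subseteq> U" and e: "linear_map C C e" "e ` U \<subseteq> U"
    and fd: "\<And>x. x \<in> carrier C \<Longrightarrow> f (d x) = e (f x)"
    and gp: "graded_projections C p"
  shows "chain_map (Q\<lparr>diff := quot_map C U d\<rparr>) (Q\<lparr>diff := quot_map C U e\<rparr>) (quot_map C U f)"
proof -
  have hc: "homog C k \<subseteq> carrier C" for k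
    by (rule complex_submoduleD(1)[OF module graded_projections_submodule[OF gp]])
  have c: "d x \<in> carrier C" "f x \<in> carrier C" if "x \<in> carrier C" for x
    using d f that by (auto simp: linear_map_def)
  note q = quot_map_proj[OF f(1,2)] quot_map_proj[OF d] quot_map_proj[OF e]
  have "quot_map C U f ` homog Q k \<subseteq> homog Q k" for k
    unfolding homog_Q using hc[of k] q f(3)[of k] by (auto simp: subset_iff image_subset_iff)
  then show ?thesis
    using linear_map_quot_map[OF f(1,2)] by (auto simp: chain_map_def carrier_Q q c fd)
qed

text \<open>If f x \<in> U, then x - g (L x) = G (f x) lies in U because G preserves U. In this way
  a contracting identity on C passes to the quotient.\<close>

lemma exact_Q:
  assumes f: "linear_map C C f" "f ` U \<subseteq> U" and g: "linear_map C C g" "g ` U \<subseteq> U"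
    and L: "L ` carrier C \<subseteq> carrier C" and G: "G ` U \<subseteq> U"
    and fg: "\<And>x. x \<in> carrier C \<Longrightarrow> f (g x) = \<zero>\<^bsub>C\<^esub>"
    and h: "\<And>x. x \<in> carrier C \<Longrightarrow> x = g (L x) \<oplus>\<^bsub>C\<^esub> G (f x)"
  shows "{S \<in> carrier Q. quot_map C U f S = U} = quot_map C U g ` carrier Q"
proof (intro equalityI subsetI)
  have c: "f x \<in> carrier C" "g x \<in> carrier C" if "x \<in> carrier C" for x
    using f(1) g(1) that by (auto simp: linear_map_def)
  note q = quot_map_proj[OF f] quot_map_proj[OF g]
  fix S
  {
    assume "S \<in> {S \<in> carrier Q. quot_map C U f S = U}"
    then obtain x where x: "S = proj x" "x \<in> carrier C" "f x \<in> U"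
      by (auto simp: carrier_Q q c proj_eq_zero)
    then have Gx: "G (f x) \<in> U" and Lx: "L x \<in> carrier C" using G L by auto
    have "x \<ominus>\<^bsub>C\<^esub> g (L x) = G (f x) \<oplus>\<^bsub>C\<^esub> g (L x) \<ominus>\<^bsub>C\<^esub> g (L x)"
      using h[OF x(2)] a_comm[OF c(2)[OF Lx] U_closed(1)[OF Gx]] by simp
    also have "\<dots> = G (f x)"
      using c(2)[OF Lx] U_closed(1)[OF Gx] by (simp add: a_minus_def a_assoc r_neg)
    finally have "x \<ominus>\<^bsub>C\<^esub> g (L x) = G (f x)" .
    then have "proj x = proj (g (L x))" using Gx by (simp add: proj_eq_iff x c Lx)
    then show "S \<in> quot_map C U g ` carrier Q" using Lx x(1) by (auto simp: carrier_Q q image_iff)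
  next
    assume "S \<in> quot_map C U g ` carrier Q"
    then show "S \<in> {S \<in> carrier Q. quot_map C U f S = U}"
      by (auto simp: carrier_Q q c fg proj_zero)
  }
qed

end

section \<open>Two-periodic exact sequences\<close>

text \<open>\<open>B\<close> stands for the complex with b, \<open>C\<close> for that with
  \<partial>, and s for t - 1. As the kernel of N is the image of s, N embeds the quotient of C by
  that image into B, onto the kernel of s. The lemma serves I_n(H) and W_n(H) alike, once the image
  of s is known to be the commutator subspace.\<close>

lemma periodic_exact:
  fixes B C :: "'a graded_complex"
  assumes B: "cochain_complex B" and C: "cochain_complex C"
    and s: "chain_map B C s" and N: "chain_map C B N"
    and ker_s: "a_kernel B C s = N ` carrier C" and ker_N: "a_kernel C B N = s ` carrier B"
    and gp: "graded_projections C p" and p: "\<And>k. p k ` s ` carrier B \<subseteq> s ` carrier B"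
  shows "exact_sequence (\<lambda>i. if even i then B else C) (\<lambda>i. if even i then s else N)"
    and "exact_resolution (quot_complex C (s ` carrier B)) (descend N)
      (\<lambda>i. if even i then B else C) (\<lambda>i. if even i then s else N)"
proof -
  show "exact_sequence (\<lambda>i. if even i then B else C) (\<lambda>i. if even i then s else N)"
    using assms by (auto simp: exact_sequence_def)
  have mods: "complex_module B" "complex_module C" using B C
    by (auto simp: cochain_complex_def graded_space_def)
  have maps_lin: "linear_map B C s" "linear_map C B N" "linear_map C C (diff C)"
    using s N C by (auto simp: chain_map_def cochain_complex_def)
  let ?U = "s ` carrier B"
  interpret complex_quotient C ?U
    by (intro complex_quotient.intro mods submodule_image[OF mods maps_lin(1)])
  interpret B: Module.module complex_ring B by (rule mods)
  have closed: "N x \<in> carrier B" "diff C x \<in> carrier C" if "x \<in> carrier C" for x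
    using maps_lin(2,3) that unfolding linear_map_def by (auto simp only: Pi_iff)
  have N0: "N x = \<zero>\<^bsub>B\<^esub> \<longleftrightarrow> x \<in> ?U" if "x \<in> carrier C" for x
    using ker_N that by (auto simp: a_kernel_def')
  have dN: "descend N (proj x) = N x" if x: "x \<in> carrier C" for x
  proof (rule descend_proj[OF x])
    fix u assume u: "u \<in> ?U"
    have "N (u \<oplus>\<^bsub>C\<^esub> x) = N u \<oplus>\<^bsub>B\<^esub> N x"
      using maps_lin(2) x U_closed(1)[OF u] by (simp add: linear_map_def)
    then show "N (u \<oplus>\<^bsub>C\<^esub> x) = N x"
      using N0[OF U_closed(1)[OF u]] u closed(1)[OF x] by simp
  qed
  \<comment> \<open>The image of a chain map is a subcomplex; this gives the quotient its
    differential.\<close>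
  have dU: "diff C ` ?U \<subseteq> ?U"
  proof (clarify)
    fix x assume x: "x \<in> carrier B"
    have "diff C (s x) = s (diff B x)" "diff B x \<in> carrier B"
      using s B x by (auto simp: chain_map_def cochain_complex_def linear_map_def)
    then show "diff C (s x) \<in> ?U" by simp
  qed
  have hc: "homog C k \<subseteq> carrier C" for k
    by (rule complex_submoduleD(1)[OF module graded_projections_submodule[OF gp]])
  have "cochain_complex (Q\<lparr>diff := quot_map C ?U (diff C)\<rparr>)"
    by (rule cochain_complex_Q[OF gp p maps_lin(3) dU]) (use C in \<open>auto simp: cochain_complex_def\<close>)
  then have 1: "cochain_complex Q" by (simp add: quot_complex_def)
  have dQ: "diff Q (proj x) = proj (diff C x)" if "x \<in> carrier C" for x
    using quot_map_proj[OF maps_lin(3) dU that] by (simp add: quot_complex_def)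
  have "linear_map Q B (descend N)"
    using maps_lin(2) unfolding linear_map_def
    by (auto simp: carrier_Q dN add_Q smult_Q)
  moreover have "descend N ` homog Q k \<subseteq> homog B k" for k
  proof (clarsimp simp: homog_Q)
    fix x assume "x \<in> homog C k"
    then show "descend N (proj x) \<in> homog B k"
      using hc[of k] N by (subst dN) (auto simp: chain_map_def)
  qed
  moreover have "descend N (diff Q S) = diff B (descend N S)" if "S \<in> carrier Q" for S
    using that N by (auto simp: carrier_Q dN dQ closed chain_map_def)
  ultimately have 2: "chain_map Q B (descend N)" by (simp add: chain_map_def)
  have 3: "a_kernel Q B (descend N) = {\<zero>\<^bsub>Q\<^esub>}"
  proof -
    have "descend N (proj x) = \<zero>\<^bsub>B\<^esub> \<longleftrightarrow> proj x = ?U" if "x \<in> carrier C" for x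
      using that by (simp only: dN N0 proj_eq_zero)
    moreover have "?U \<in> proj ` carrier C"
      using imageI[OF U_closed(1)[OF U_closed(2)], of proj] unfolding proj_zero .
    ultimately show ?thesis unfolding a_kernel_def' carrier_Q zero_Q
      by (intro equalityI subsetI) (simp_all only: mem_Collect_eq singleton_iff image_iff, metis+)
  qed
  have "descend N ` carrier Q = N ` carrier C"
    unfolding carrier_Q image_image by (rule image_cong[OF refl]) (rule dN)
  then show "exact_resolution Q (descend N)
      (\<lambda>i. if even i then B else C) (\<lambda>i. if even i then s else N)"
    using 1 2 3 assms by (simp add: exact_resolution_def)
qed

section \<open>The complexes of subspaces of W(H)\<close>

definition weil_projection :: "nat \<Rightarrow> 'h::complex_vector weil \<Rightarrow> 'h weil" where
  "weil_projection k = weil_ext (\<lambda>w. if wdeg w = k then word w else 0)"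

lemma word_linear_weil_projection: "word_linear (\<lambda>w. if wdeg w = k then word w else 0)"
  unfolding word_linear_def
proof (intro allI ballI)
  fix u v and g :: "'a \<Rightarrow> 'a gen" assume g: "g \<in> {Gen, Om}"
  show "clinear (\<lambda>x. if wdeg (u @ g x # v) = k then word (u @ g x # v) else 0)"
    by (subst wdeg_letter[OF g], cases "wdeg (u @ g 0 # v) = k")
      (simp_all add: clinear_letter[OF g] clinear_zero_fun)
qed

lemma clinear_weil_projection: "clinear (weil_projection k)"
  unfolding weil_projection_def by (rule clinear_weil_ext[OF word_linear_weil_projection])

lemma weil_projection_word: "weil_projection k (word w) = (if wdeg w = k then word w else 0)"
  unfolding weil_projection_def by (rule weil_ext_word[OF word_linear_weil_projection])

lemma weil_projection_wspan: "x \<in> wspan P \<Longrightarrow> weil_projection k x \<in> wspan P"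
  by (rule clinear_wspan[OF clinear_weil_projection csubspace_wspan])
    (auto simp: weil_projection_word wspan_word cvs.span_zero)

lemma weil_projection_in_homog: "weil_projection k x \<in> weil_homog k"
  by (rule clinear_wspan[OF clinear_weil_projection csubspace_wspan, of "\<lambda>w. True"])
    (auto simp: weil_projection_word wspan_word cvs.span_zero wspan_UNIV simp del: Collect_const)

lemma weil_projection_homog:
  assumes "x \<in> weil_homog k"
  shows "weil_projection j x = (if j = k then x else 0)"
proof (cases "j = k")
  case True
  then show ?thesis
    by simp (rule clinear_wspan_eq[OF clinear_weil_projection clinear_id _ assms],
        simp add: weil_projection_word)
next
  case False
  then show ?thesis
    by simp (rule clinear_wspan_eq[OF clinear_weil_projection clinear_zero_fun _ assms],
        simp add: weil_projection_word)
qed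

text \<open>The induction carries a finite set K containing the support, since the supports of the
  summands do not determine that of a sum; in the end K is cut down to the support.\<close>

lemma weil_projection_sum:
  "finite {k. weil_projection k x \<noteq> 0} \<and>
     x = (\<Sum>k | weil_projection k x \<noteq> 0. weil_projection k x)"
proof -
  note add = clinear_add[OF clinear_weil_projection] and scale = clinear_scale[OF clinear_weil_projection]
  have "\<exists>K. finite K \<and> (\<forall>k. k \<notin> K \<longrightarrow> weil_projection k x = 0) \<and> x = (\<Sum>k\<in>K. weil_projection k x)"
  proof (induction x rule: weil_induct)
    case zero
    show ?case by (rule exI[of _ "{}"]) (simp add: clinear_zero[OF clinear_weil_projection])
  next
    case (step c w x)
    then obtain K where K: "finite K" "\<And>k. k \<notin> K \<Longrightarrow> weil_projection k x = 0"
      "x = (\<Sum>k\<in>K. weil_projection k x)" by blast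
    let ?L = "insert (wdeg w) K"
    have "(\<Sum>k\<in>?L. weil_projection k (c *\<^sub>C word w + x))
        = (\<Sum>k\<in>?L. if k = wdeg w then c *\<^sub>C word w else 0) + (\<Sum>k\<in>?L. weil_projection k x)"
      unfolding sum.distrib[symmetric]
      by (rule sum.cong) (auto simp: add scale weil_projection_word cvs.scale_zero_right)
    also have "(\<Sum>k\<in>?L. weil_projection k x) = (\<Sum>k\<in>K. weil_projection k x)"
      by (rule sum.mono_neutral_right) (use K in auto)
    also have "\<dots> = x" by (rule K(3)[symmetric])
    also have "(\<Sum>k\<in>?L. if k = wdeg w then c *\<^sub>C word w else 0) = c *\<^sub>C word w"
      using K(1) by (simp add: sum.delta)
    finally show ?case
      using K by (intro exI[of _ ?L]) (auto simp: add scale weil_projection_word cvs.scale_zero_right)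
  qed
  then obtain K where K: "finite K" "\<And>k. k \<notin> K \<Longrightarrow> weil_projection k x = 0"
    "x = (\<Sum>k\<in>K. weil_projection k x)" by blast
  have sub: "{k. weil_projection k x \<noteq> 0} \<subseteq> K" using K(2) by auto
  have "(\<Sum>k | weil_projection k x \<noteq> 0. weil_projection k x) = (\<Sum>k\<in>K. weil_projection k x)"
    by (rule sum.mono_neutral_left[OF K(1) sub]) auto
  with K(3) finite_subset[OF sub K(1)] show ?thesis by simp
qed

text \<open>Makes the image of t - 1 a graded subspace, so that the quotient by it is
  graded.\<close>

lemma weil_projection_cyc_minus_one:
  "weil_projection k (cyc_minus_one x) = cyc_minus_one (weil_projection k x)"
proof (rule clinear_weil_eq[where x = x])
  fix w :: "'a gen list"
  have "cyc_minus_one (word w) \<in> weil_homog (wdeg w)"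
    by (intro weil_homog_cyc weil_homog_word refl)
  then show "weil_projection k (cyc_minus_one (word w)) = cyc_minus_one (weil_projection k (word w))"
    by (simp add: weil_projection_homog weil_projection_word clinear_zero[OF clinear_cyc_minus_one])
qed (intro clinear_comp[OF clinear_weil_projection] clinear_comp[OF clinear_cyc_minus_one]
    clinear_weil_projection clinear_cyc_minus_one)+

text \<open>One shape for W(H), its unital extension and the powers of I(H), with \<partial> or b as
  differential. Multiplication and unit are always those of the unital algebra.\<close>

definition weil_sub :: "'h::complex_vector weil set \<Rightarrow> ('h weil \<Rightarrow> 'h weil) \<Rightarrow> 'h weil graded_complex"
  where "weil_sub S d =
     \<lparr>carrier = S, monoid.mult = (*), one = 1, ring.zero = 0, add = (+), module.smult = scaleC,
      homog = (\<lambda>k. weil_homog k \<inter> S), diff = d\<rparr>"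

lemma weil_sub_simps [simp]:
  "carrier (weil_sub S d) = S" "\<zero>\<^bsub>weil_sub S d\<^esub> = 0" "x \<oplus>\<^bsub>weil_sub S d\<^esub> y = x + y"
  "x \<otimes>\<^bsub>weil_sub S d\<^esub> y = x * y" "c \<odot>\<^bsub>weil_sub S d\<^esub> x = c *\<^sub>C x"
  "homog (weil_sub S d) k = weil_homog k \<inter> S" "diff (weil_sub S d) = d"
  "(weil_sub S d)\<lparr>diff := e\<rparr> = weil_sub S e"
  by (simp_all add: weil_sub_def)

lemma complex_module_weil_sub:
  assumes S: "csubspace S"
  shows "complex_module (weil_sub S d)"
proof (rule Module.moduleI[OF cring_complex_ring])
  show "abelian_group (weil_sub S d)"
  proof (rule abelian_groupI)
    fix x assume "x \<in> carrier (weil_sub S d)"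
    then show "\<exists>y\<in>carrier (weil_sub S d). y \<oplus>\<^bsub>weil_sub S d\<^esub> x = \<zero>\<^bsub>weil_sub S d\<^esub>"
      using cvs.subspace_neg[OF S] by (intro bexI[of _ "- x"]) auto
  qed (use S in \<open>auto simp: cvs.subspace_add cvs.subspace_0 algebra_simps\<close>)
qed (use S in \<open>auto simp: cvs.subspace_scale scaleC_add_left scaleC_add_right scaleC_scaleC scaleC_one\<close>)

lemma submodule_weil_sub:
  assumes S: "csubspace S"
  shows "submodule U complex_ring (weil_sub S d) \<longleftrightarrow> csubspace U \<and> U \<subseteq> S"
proof
  note C = complex_module_weil_sub[OF S, of d]
  show "submodule U complex_ring (weil_sub S d) \<Longrightarrow> csubspace U \<and> U \<subseteq> S"
    using complex_submoduleD[OF C, of U] by (auto simp: cvs.subspace_def)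
  show "csubspace U \<and> U \<subseteq> S \<Longrightarrow> submodule U complex_ring (weil_sub S d)"
    by (intro complex_submoduleI[OF C]) (auto simp: cvs.subspace_def)
qed

lemma minus_weil_sub:
  assumes S: "csubspace S" and "x \<in> S" "y \<in> S"
  shows "x \<ominus>\<^bsub>weil_sub S d\<^esub> y = x - y"
  using complex_module_uminus[OF complex_module_weil_sub[OF S], of y d] assms
  by (simp add: a_minus_def cvs.scale_minus_left scaleC_one)

lemma finsum_weil_sub:
  assumes S: "csubspace S" and "finite A" "\<And>i. i \<in> A \<Longrightarrow> g i \<in> S"
  shows "finsum (weil_sub S d) g A = sum g A"
  using assms(2,3)
proof (induction A rule: finite_induct)
  interpret Module.module complex_ring "weil_sub S d" by (rule complex_module_weil_sub[OF S])
  case empty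
  then show ?case by simp
next
  interpret Module.module complex_ring "weil_sub S d" by (rule complex_module_weil_sub[OF S])
  case (insert a A)
  then show ?case using finsum_insert[of A a g] by (simp add: Pi_def)
qed

lemma linear_map_weil_sub:
  "clinear f \<Longrightarrow> f ` S \<subseteq> T \<Longrightarrow> linear_map (weil_sub S d) (weil_sub T e) f"
  by (auto simp: linear_map_def clinear_add clinear_scale)

lemma graded_projections_weil_sub:
  assumes S: "csubspace S" and p: "\<And>k. weil_projection k ` S \<subseteq> S"
  shows "graded_projections (weil_sub S d) weil_projection"
  unfolding graded_projections_def
proof (intro conjI allI ballI)
  show "complex_module (weil_sub S d)" by (rule complex_module_weil_sub[OF S])
  show "submodule (homog (weil_sub S d) k) complex_ring (weil_sub S d)" for k
    by (simp add: submodule_weil_sub[OF S] cvs.subspace_inter[OF csubspace_wspan S])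
  show "linear_map (weil_sub S d) (weil_sub S d) (weil_projection k)" for k
    by (rule linear_map_weil_sub[OF clinear_weil_projection p])
  show "weil_projection k ` carrier (weil_sub S d) \<subseteq> homog (weil_sub S d) k" for k
    using p weil_projection_in_homog by auto
  show "weil_projection j x = (if j = k then x else \<zero>\<^bsub>weil_sub S d\<^esub>)"
    if "x \<in> homog (weil_sub S d) k" for j k x
    using that by (simp add: weil_projection_homog[of x k])
  fix x assume x: "x \<in> carrier (weil_sub S d)"
  show "finite {k. weil_projection k x \<noteq> \<zero>\<^bsub>weil_sub S d\<^esub>}"
    using weil_projection_sum[of x] by simp
  have "finsum (weil_sub S d) (\<lambda>k. weil_projection k x) {k. weil_projection k x \<noteq> 0}
      = (\<Sum>k | weil_projection k x \<noteq> 0. weil_projection k x)"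
    by (rule finsum_weil_sub[OF S]) (use weil_projection_sum[of x] p x in auto)
  also have "\<dots> = x" using weil_projection_sum[of x] by simp
  finally show "x = finsum (weil_sub S d) (\<lambda>k. weil_projection k x)
      {k. weil_projection k x \<noteq> \<zero>\<^bsub>weil_sub S d\<^esub>}" by simp
qed

lemma weil_projection_om_filtration: "weil_projection k ` om_filtration n \<subseteq> om_filtration n"
  unfolding om_filtration_def by (auto intro: weil_projection_wspan)

lemma om_filtration_Suc: "om_filtration (n + 1) = wspan (\<lambda>w. length w + (n + 1) \<le> wdeg w)"
  by (rule om_filtration_pos) simp

lemmas graded_projections_om_filtration =
  graded_projections_weil_sub[OF csubspace_om_filtration weil_projection_om_filtration]

lemma om_filtration_mult:
  assumes "x \<in> om_filtration m" "y \<in> om_filtration n"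
  shows "x * y \<in> om_filtration (m + n)"
  using assms unfolding om_filtration_def by (rule wspan_mult) (auto simp: wdeg_append)

lemma om_filtration_homotopy:
  assumes "x \<in> om_filtration n"
  shows "x = cyc_norm (cyc_mean x) + cyc_homotopy (cyc_minus_one x)"
    and "x = cyc_mean (cyc_norm x) + cyc_minus_one (cyc_homotopy x)"
proof -
  have "x \<in> wspan (\<lambda>w. w \<noteq> [])"
    using assms om_filtration_mono[of 0 n] by (auto simp: om_filtration_def length_le_wdeg)
  then show "x = cyc_norm (cyc_mean x) + cyc_homotopy (cyc_minus_one x)"
    "x = cyc_mean (cyc_norm x) + cyc_minus_one (cyc_homotopy x)"
    by (rule cyc_homotopy_formulas)+
qed

section \<open>W(H) and the complexes I_n(H)\<close>

context coalgebra
begin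

lemma weil_alg_eq: "weil_alg \<Delta> = weil_sub (om_filtration 0) (weil_diff \<Delta>)"
  by (simp add: weil_alg_def sub_complex_def weil_plus_def weil_sub_def weil_carrier_eq)

lemma I_pow_eq: "I_pow \<Delta> n = weil_sub (om_filtration (n + 1)) (weil_diff \<Delta>)"
proof -
  have "(\<lambda>k. weil_homog k \<inter> om_filtration 0 \<inter> om_filtration (n + 1))
      = (\<lambda>k. weil_homog k \<inter> om_filtration (n + 1) :: 'h weil set)"
    using om_filtration_mono[of 0 "n + 1"] by auto
  then show ?thesis
    unfolding I_pow_def weil_alg_eq om_power_Suc_eq by (simp add: sub_complex_def weil_sub_def)
qed

lemma I_pow_b_eq: "I_pow_b \<Delta> n = weil_sub (om_filtration (n + 1)) (weil_b \<Delta>)"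
  by (simp add: I_pow_b_def I_pow_eq)

lemma weil_plus_eq: "weil_plus \<Delta> = weil_sub UNIV (weil_diff \<Delta>)"
  by (simp add: weil_plus_def weil_sub_def)

lemma weil_diff_in_om_filtration:
  "x \<in> om_filtration n \<Longrightarrow> weil_diff \<Delta> x \<in> om_filtration n"
  by (rule weil_diff_om_filtration)
    (use wspan_mono[of "\<lambda>w. w \<noteq> [] \<and> length w + n \<le> wdeg w" "\<lambda>w. length w + n \<le> wdeg w"]
      in \<open>auto simp: om_filtration_def\<close>)

lemma cochain_complex_weil_sub:
  "cochain_complex (weil_sub (om_filtration n) (weil_diff \<Delta>))"
  "cochain_complex (weil_sub (om_filtration n) (weil_b \<Delta>))"
proof -
  note c = cochain_complexI[OF graded_projections_om_filtration[of n] linear_map_weil_sub, simplified]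
  show "cochain_complex (weil_sub (om_filtration n) (weil_diff \<Delta>))"
    by (rule c) (auto intro: clinear_weil_diff weil_diff_in_om_filtration weil_diff_homog weil_diff_squared)
  show "cochain_complex (weil_sub (om_filtration n) (weil_b \<Delta>))"
    by (rule c) (auto intro: clinear_weil_b weil_b_om_filtration weil_b_homog weil_b_squared)
qed

text \<open>Commutators lie in the image because J(x, y) is in I(H)^(n+1). For minimality it
  suffices to reach (t - 1) w for words w with more than n letters \<omega>; the obstacle is a first
  letter h, which is not in I(H).\<close>

lemma I_commutators:
  "graded_commutators (weil_plus \<Delta>) om_ideal (om_power n) = cyc_minus_one ` om_filtration (n + 1)"
  unfolding graded_commutators_def weil_plus_eq
proof (rule hull_unique)
  let ?M = "weil_sub UNIV (weil_diff \<Delta>) :: 'h weil graded_complex"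
  let ?gens = "{x \<otimes>\<^bsub>?M\<^esub> y \<ominus>\<^bsub>?M\<^esub> (-1) ^ (i * j) \<odot>\<^bsub>?M\<^esub> (y \<otimes>\<^bsub>?M\<^esub> x) | x y i j.
          x \<in> om_ideal \<inter> homog ?M i \<and> y \<in> om_power n \<inter> homog ?M j}"
  have U: "csubspace (UNIV :: 'h weil set)" by (rule cvs.subspace_UNIV)
  have m: "x \<ominus>\<^bsub>?M\<^esub> y = x - y" for x y by (rule minus_weil_sub[OF U]) auto
  show "?gens \<subseteq> cyc_minus_one ` om_filtration (n + 1)"
  proof (clarsimp simp: m)
    fix x y :: "'h weil" and i j
    assume *: "x \<in> om_ideal" "x \<in> weil_homog i" "y \<in> om_power n" "y \<in> weil_homog j"
    have "partial_norm x y \<in> om_filtration (n + 1)"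
      unfolding om_filtration_Suc
      by (rule partial_norm_wspan[OF *(1)[unfolded om_ideal_eq] *(3)[unfolded om_power_eq]])
        (auto simp: wdeg_append wdeg_rotate)
    \<comment> \<open>The sign is needed since t - 1 maps J(x, y) to minus the commutator.\<close>
    then have "- partial_norm x y \<in> om_filtration (n + 1)"
      by (rule cvs.subspace_neg[OF csubspace_om_filtration])
    moreover have "cyc_minus_one (- partial_norm x y) = x * y - (-1) ^ (i * j) *\<^sub>C (y * x)"
      using cyc_minus_one_partial_norm[OF *(2,4)] clinear_scale[OF clinear_cyc_minus_one, of "-1" "partial_norm x y"]
      by (simp add: cvs.scale_minus_left scaleC_one)
    ultimately show "x * y - (-1) ^ (i * j) *\<^sub>C (y * x) \<in> cyc_minus_one ` om_filtration (Suc n)"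
      by (metis Suc_eq_plus1 image_eqI)
  qed
  show "submodule (cyc_minus_one ` om_filtration (n + 1)) complex_ring ?M"
    using submodule_image[OF complex_module_weil_sub[OF csubspace_om_filtration]
        complex_module_weil_sub[OF U] linear_map_weil_sub[OF clinear_cyc_minus_one], of "n + 1"]
    by simp
  fix V assume gens: "?gens \<subseteq> V" and "submodule V complex_ring ?M"
  then have V: "csubspace V" by (simp add: submodule_weil_sub[OF U])
  have K: "(-1) ^ (wdeg u * wdeg v) *\<^sub>C (word v * word u) - word u * word v \<in> V"
    if "length u + 1 \<le> wdeg u" "length v + n \<le> wdeg v" for u v :: "'h gen list"
  proof -
    have uv: "word u \<in> om_ideal \<inter> homog ?M (wdeg u)" "word v \<in> om_power n \<inter> homog ?M (wdeg v)"
      using wspan_word[of "\<lambda>w. length w + 1 \<le> wdeg w", OF that(1)]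
        wspan_word[of "\<lambda>w. length w + n \<le> wdeg w", OF that(2)]
        weil_homog_word[OF refl, of u] weil_homog_word[OF refl, of v]
      unfolding om_ideal_eq om_power_eq weil_sub_simps Int_UNIV_right by - (rule IntI; assumption)+
    have "word u \<otimes>\<^bsub>?M\<^esub> word v \<ominus>\<^bsub>?M\<^esub> (-1) ^ (wdeg u * wdeg v) \<odot>\<^bsub>?M\<^esub> (word v \<otimes>\<^bsub>?M\<^esub> word u) \<in> ?gens"
      by (intro CollectI exI conjI, rule refl) (rule uv)+
    from subsetD[OF gens this]
    have "word u * word v - (-1) ^ (wdeg u * wdeg v) *\<^sub>C (word v * word u) \<in> V"
      by (simp add: m)
    from cvs.subspace_neg[OF V this] show ?thesis by simp
  qed
  have cyc_V: "cyc_minus_one (word w) \<in> V" if w: "length w + (n + 1) \<le> wdeg w" for w :: "'h gen list"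
  proof (cases w)
    case Nil
    then show ?thesis using w by (simp add: wdeg_def)
  next
    case (Cons a x)
    show ?thesis
    proof (cases a)
      case (Om h)
      \<comment> \<open>A first letter \<omega> is itself in I(H), and the rest has at least n
        further letters \<omega>.\<close>
      then have "(-1) ^ (wdeg [a] * wdeg x) *\<^sub>C (word x * word [a]) - word [a] * word x \<in> V"
        using w Cons by (intro K) (auto simp: wdeg_def)
      then show ?thesis
        using cyc_minus_one_partial_norm_word[of "[a]" x] unfolding Cons word_Cons[of a x] partial_norm_letter by metis
    next
      case (Gen h)
      \<comment> \<open>With the cut behind the first \<omega>, both au and u lie in I(H), while v
        and va lie in I(H)^n.\<close>
      then obtain u v where uv: "x = u @ v" "length u + 1 \<le> wdeg u" "length v + n \<le> wdeg v"
        using w Cons om_split[of x n] by (auto simp: wdeg_def)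
      \<comment> \<open>Under t - 1 this becomes the relation between commutators, with u = y
        \<omega> and v = z.\<close>
      have "partial_norm (word (a # u)) (word v) = word (a # u @ v)
          + (-1) ^ (wdeg [a] * (wdeg u + wdeg v)) *\<^sub>C partial_norm (word u) (word (v @ [a]))"
        using partial_norm_append[of "[a]" u v] by (simp add: partial_norm_letter flip: word_append)
      then have "cyc_minus_one (word w) = cyc_minus_one (partial_norm (word (a # u)) (word v))
          - (-1) ^ (wdeg [a] * (wdeg u + wdeg v)) *\<^sub>C
              cyc_minus_one (partial_norm (word u) (word (v @ [a])))"
        by (simp add: Cons uv clinear_add[OF clinear_cyc_minus_one]
            clinear_scale[OF clinear_cyc_minus_one])
      also have "\<dots> \<in> V"
        unfolding cyc_minus_one_partial_norm_word using Gen uv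
        by (intro cvs.subspace_diff[OF V] cvs.subspace_scale[OF V] K)
          (auto simp: wdeg_Cons wdeg_append wdeg_def[of "[]"])
      finally show ?thesis .
    qed
  qed
  show "cyc_minus_one ` om_filtration (n + 1) \<subseteq> V"
    unfolding om_filtration_Suc
    by (rule image_subsetI, rule clinear_wspan[OF clinear_cyc_minus_one V cyc_V])
qed

lemma chain_map_weil_sub:
  "chain_map (weil_sub (om_filtration n) (weil_b \<Delta>)) (weil_sub (om_filtration n) (weil_diff \<Delta>)) cyc_minus_one"
  "chain_map (weil_sub (om_filtration n) (weil_diff \<Delta>)) (weil_sub (om_filtration n) (weil_b \<Delta>)) cyc_norm"
  unfolding chain_map_def
  by (auto simp: cyc_minus_one_weil_b weil_b_cyc_norm om_filtration_cyc weil_homog_cyc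
      intro!: linear_map_weil_sub clinear_cyc_minus_one clinear_cyc_norm)

text \<open>On the kernel of t - 1 the contracting identity reads x = N (L x), on that of N it reads
  x = (t - 1) (G x).\<close>

lemma kernels_weil_sub:
  fixes d e :: "'h weil \<Rightarrow> 'h weil"
  shows "a_kernel (weil_sub (om_filtration n) d) (weil_sub (om_filtration n) e) cyc_minus_one
      = cyc_norm ` om_filtration n"
    and "a_kernel (weil_sub (om_filtration n) d) (weil_sub (om_filtration n) e) cyc_norm
      = cyc_minus_one ` om_filtration n"
proof -
  note z = clinear_zero[OF clinear_cyc_mean] clinear_zero[OF clinear_cyc_homotopy]
  have 1: "x \<in> cyc_norm ` om_filtration n" if "x \<in> om_filtration n" "cyc_minus_one x = 0" for x :: "'h weil"
    using om_filtration_homotopy(1)[OF that(1)] om_filtration_cyc(3)[OF that(1)]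
    by (simp add: that(2) z)
  have 2: "x \<in> cyc_minus_one ` om_filtration n" if "x \<in> om_filtration n" "cyc_norm x = 0" for x :: "'h weil"
    using om_filtration_homotopy(2)[OF that(1)] om_filtration_cyc(4)[OF that(1)]
    by (simp add: that(2) z)
  show "a_kernel (weil_sub (om_filtration n) d) (weil_sub (om_filtration n) e) cyc_minus_one
      = cyc_norm ` om_filtration n"
    "a_kernel (weil_sub (om_filtration n) d) (weil_sub (om_filtration n) e) cyc_norm
      = cyc_minus_one ` om_filtration n"
    using 1 2 by (auto simp: a_kernel_def' cyc_minus_one_norm cyc_norm_minus_one om_filtration_cyc)
qed

lemma I_resolution:
  "exact_resolution (I_nat \<Delta> n) (descend cyc_norm)
     (\<lambda>i. if even i then I_pow_b \<Delta> n else I_pow \<Delta> n)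
     (\<lambda>i. if even i then cyc_minus_one else cyc_norm)"
proof -
  have p: "weil_projection k ` cyc_minus_one ` om_filtration (n + 1)
      \<subseteq> (cyc_minus_one ` om_filtration (n + 1) :: 'h weil set)" for k
    unfolding image_image weil_projection_cyc_minus_one
    using weil_projection_om_filtration[of k "n + 1"] by blast
  show ?thesis
    unfolding I_nat_def I_pow_eq I_pow_b_eq I_commutators
    by (rule periodic_exact(2)[OF cochain_complex_weil_sub(2,1) chain_map_weil_sub,
          unfolded weil_sub_simps, OF kernels_weil_sub graded_projections_om_filtration p])
qed

section \<open>The quotients W_n(H)\<close>

context
  fixes n :: nat
begin

abbreviation "weil_complex \<equiv> weil_sub (om_filtration 0) (weil_diff \<Delta>)"

interpretation W: complex_quotient weil_complex "om_filtration (Suc n)"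
  by (rule complex_quotient.intro, rule complex_module_weil_sub[OF csubspace_om_filtration])
    (simp only: submodule_weil_sub[OF csubspace_om_filtration] csubspace_om_filtration
      om_filtration_mono le0 simp_thms)

abbreviation "quot_op \<equiv> quot_map weil_complex (om_filtration (Suc n))"

text \<open>The differential is displayed as a record update, so that the results on
  \<open>W.Q\<close> with a prescribed differential apply to \<partial> and b alike.\<close>

lemma W_quot_eq: "W_quot \<Delta> n = W.Q" "W_quot \<Delta> n = W.Q\<lparr>diff := quot_op (weil_diff \<Delta>)\<rparr>"
  "W_quot_b \<Delta> n = W.Q\<lparr>diff := quot_op (weil_b \<Delta>)\<rparr>" "W_map \<Delta> n = quot_op"
  unfolding W_quot_b_def W_quot_def W_map_def[abs_def] weil_alg_eq om_power_Suc_eq Suc_eq_plus1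
  by (simp_all add: quot_complex_def)

text \<open>Stability is used at m = 0, which is W(H) itself, and at m = n + 1, the subspace divided
  out.\<close>

lemma W_lin:
  assumes "clinear f" "\<And>m. f ` om_filtration m \<subseteq> om_filtration m"
  shows "linear_map weil_complex weil_complex f" "f ` om_filtration (Suc n) \<subseteq> om_filtration (Suc n)"
  by (rule linear_map_weil_sub[OF assms]) (rule assms(2))

lemma om_filtration_image:
  "cyc_minus_one ` om_filtration m \<subseteq> om_filtration m" "cyc_norm ` om_filtration m \<subseteq> om_filtration m"
  "cyc_mean ` om_filtration m \<subseteq> om_filtration m" "cyc_homotopy ` om_filtration m \<subseteq> om_filtration m"
  "weil_diff \<Delta> ` om_filtration m \<subseteq> om_filtration m" "weil_b \<Delta> ` om_filtration m \<subseteq> om_filtration m"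
  by (rule image_subsetI, erule om_filtration_cyc weil_diff_in_om_filtration weil_b_om_filtration)+

lemmas W_maps =
  W_lin[OF clinear_cyc_minus_one om_filtration_image(1)] W_lin[OF clinear_cyc_norm om_filtration_image(2)]
  W_lin[OF clinear_weil_diff om_filtration_image(5)] W_lin[OF clinear_weil_b om_filtration_image(6)]

lemma W_cochain: "cochain_complex (W_quot \<Delta> n)" "cochain_complex (W_quot_b \<Delta> n)"
proof -
  show "cochain_complex (W_quot \<Delta> n)" unfolding W_quot_eq(2)
    by (rule W.cochain_complex_Q[OF graded_projections_om_filtration weil_projection_om_filtration W_maps(5,6)])
      (use om_filtration_image(5) in \<open>auto simp: weil_diff_homog weil_diff_squared\<close>)
  show "cochain_complex (W_quot_b \<Delta> n)" unfolding W_quot_eq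
    by (rule W.cochain_complex_Q[OF graded_projections_om_filtration weil_projection_om_filtration W_maps(7,8)])
      (use om_filtration_image(6) in \<open>auto simp: weil_b_homog weil_b_squared\<close>)
qed

lemma W_chain_maps:
  "chain_map (W_quot_b \<Delta> n) (W_quot \<Delta> n) (W_map \<Delta> n cyc_minus_one)"
  "chain_map (W_quot \<Delta> n) (W_quot_b \<Delta> n) (W_map \<Delta> n cyc_norm)"
  unfolding W_quot_eq(2-4)
  by (rule W.chain_map_Q[OF W_maps(1,2) _ W_maps(7,8,5,6) _ graded_projections_om_filtration]
      W.chain_map_Q[OF W_maps(3,4) _ W_maps(5-8) _ graded_projections_om_filtration];
    auto simp: weil_homog_cyc om_filtration_cyc cyc_minus_one_weil_b weil_b_cyc_norm)+

lemma W_kernels: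
  "a_kernel (W_quot_b \<Delta> n) (W_quot \<Delta> n) (W_map \<Delta> n cyc_minus_one)
     = W_map \<Delta> n cyc_norm ` carrier (W_quot \<Delta> n)"
  "a_kernel (W_quot \<Delta> n) (W_quot_b \<Delta> n) (W_map \<Delta> n cyc_norm)
     = W_map \<Delta> n cyc_minus_one ` carrier (W_quot_b \<Delta> n)"
proof -
  have h: "x = cyc_norm (cyc_mean x) + cyc_homotopy (cyc_minus_one x)"
    "x = cyc_minus_one (cyc_homotopy x) + cyc_mean (cyc_norm x)" if "x \<in> om_filtration 0" for x :: "'h weil"
    using om_filtration_homotopy[OF that] by (simp_all only: add.commute)
  have "{S \<in> carrier W.Q. quot_op cyc_minus_one S = om_filtration (Suc n)} = quot_op cyc_norm ` carrier W.Q"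
    by (rule W.exact_Q[OF W_maps(1-4), where L = cyc_mean and G = cyc_homotopy])
      (simp_all only: weil_sub_simps om_filtration_image cyc_minus_one_norm h(1)[symmetric])
  then show "a_kernel (W_quot_b \<Delta> n) (W_quot \<Delta> n) (W_map \<Delta> n cyc_minus_one)
     = W_map \<Delta> n cyc_norm ` carrier (W_quot \<Delta> n)"
    by (simp add: W_quot_eq(2-4) a_kernel_def' W.zero_Q)
  \<comment> \<open>The roles of L and G are exchanged: G gives the preimage under t - 1, L the
    error term in I(H)^(n+1).\<close>
  have "{S \<in> carrier W.Q. quot_op cyc_norm S = om_filtration (Suc n)} = quot_op cyc_minus_one ` carrier W.Q"
    by (rule W.exact_Q[OF W_maps(3,4,1,2), where L = cyc_homotopy and G = cyc_mean])
      (simp_all only: weil_sub_simps om_filtration_image cyc_norm_minus_one h(2)[symmetric])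
  then show "a_kernel (W_quot \<Delta> n) (W_quot_b \<Delta> n) (W_map \<Delta> n cyc_norm)
     = W_map \<Delta> n cyc_minus_one ` carrier (W_quot_b \<Delta> n)"
    by (simp add: W_quot_eq(2-4) a_kernel_def' W.zero_Q)
qed

text \<open>\<open>rcoset_mult\<close> is a union over all pairs of representatives. For x' = u + x
  and y' = v + y the difference x'y' - xy = uy' + xv lies in I(H)^(n+1), so all cosets in the union
  coincide.\<close>

lemma W_mult:
  assumes "x \<in> om_filtration 0" "y \<in> om_filtration 0"
  shows "W.proj x \<otimes>\<^bsub>W.Q\<^esub> W.proj y = W.proj (x * y)"
proof -
  have "W.proj (x' * y') = W.proj (x * y)" if "x' \<in> W.proj x" "y' \<in> W.proj y" for x' y'
  proof -
    obtain u v where u: "u \<in> om_filtration (Suc n)" "x' = u + x"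
      and v: "v \<in> om_filtration (Suc n)" "y' = v + y"
      using \<open>x' \<in> _\<close> \<open>y' \<in> _\<close> by (auto simp: a_r_coset_def')
    have y': "y' \<in> om_filtration 0"
      unfolding v(2) using v(1) assms(2) om_filtration_mono[of 0 "Suc n"]
      by (intro cvs.subspace_add csubspace_om_filtration) auto
    have "u * y' + x * v \<in> om_filtration (Suc n)"
      using om_filtration_mult[OF u(1) y'] om_filtration_mult[OF assms(1) v(1)]
      by (intro cvs.subspace_add csubspace_om_filtration) auto
    moreover have "x' * y' - x * y = u * y' + x * v" by (simp add: u(2) v(2) algebra_simps)
    moreover have "x' * y' \<in> om_filtration 0" "x * y \<in> om_filtration 0"
    proof -
      have "x' \<in> om_filtration 0"
        unfolding u(2) using u(1) assms(1) om_filtration_mono[of 0 "Suc n"]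
        by (intro cvs.subspace_add csubspace_om_filtration) auto
      then show "x' * y' \<in> om_filtration 0" "x * y \<in> om_filtration 0"
        using om_filtration_mult[of _ 0 _ 0] y' assms by auto
    qed
    ultimately show ?thesis
      by (subst W.proj_eq_iff) (simp_all add: minus_weil_sub csubspace_om_filtration)
  qed
  moreover have "x \<in> W.proj x" "y \<in> W.proj y" using W.a_rcos_self assms by auto
  ultimately have "(\<Union>a\<in>W.proj x. \<Union>b\<in>W.proj y. W.proj (a * b)) = W.proj (x * y)"
    by blast
  then show ?thesis by (simp add: quot_complex_def rcoset_mult_def)
qed

text \<open>A word of at least two letters is av with both factors in W(H), so (t - 1)(av) is minus
  a single commutator, whatever the letter a is.\<close>

lemma W_commutators:
  "graded_commutators (W_quot \<Delta> n) (carrier (W_quot \<Delta> n)) (carrier (W_quot \<Delta> n))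
     = W_map \<Delta> n cyc_minus_one ` carrier (W_quot_b \<Delta> n)"
  unfolding graded_commutators_def
proof (rule hull_unique)
  let ?gens = "{A \<otimes>\<^bsub>W_quot \<Delta> n\<^esub> B \<ominus>\<^bsub>W_quot \<Delta> n\<^esub> (-1) ^ (i * j) \<odot>\<^bsub>W_quot \<Delta> n\<^esub> (B \<otimes>\<^bsub>W_quot \<Delta> n\<^esub> A) | A B i j.
     A \<in> carrier (W_quot \<Delta> n) \<inter> homog (W_quot \<Delta> n) i \<and> B \<in> carrier (W_quot \<Delta> n) \<inter> homog (W_quot \<Delta> n) j}"
  let ?T = "W_map \<Delta> n cyc_minus_one ` carrier (W_quot_b \<Delta> n)"
  note F = cvs.subspace_scale[OF csubspace_om_filtration] cvs.subspace_neg[OF csubspace_om_filtration]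
  have m: "x * y \<in> om_filtration 0" if "x \<in> om_filtration 0" "y \<in> om_filtration 0" for x y :: "'h weil"
    using om_filtration_mult[OF that] by simp
  have comm: "W.proj a \<otimes>\<^bsub>W_quot \<Delta> n\<^esub> W.proj b \<ominus>\<^bsub>W_quot \<Delta> n\<^esub>
      c \<odot>\<^bsub>W_quot \<Delta> n\<^esub> (W.proj b \<otimes>\<^bsub>W_quot \<Delta> n\<^esub> W.proj a) = W.proj (a * b - c *\<^sub>C (b * a))"
    if "a \<in> om_filtration 0" "b \<in> om_filtration 0" for a b :: "'h weil" and c
  proof -
    have ab: "a * b \<in> om_filtration 0" "b * a \<in> om_filtration 0" "c *\<^sub>C (b * a) \<in> om_filtration 0"
      by (intro F m that)+
    have "W.proj (a * b - c *\<^sub>C (b * a)) = W.proj (a * b) \<ominus>\<^bsub>W.Q\<^esub> W.proj (c *\<^sub>C (b * a))"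
      using linear_map_minus[OF W.module W.module_Q W.linear_map_proj, of "a * b" "c *\<^sub>C (b * a)"] ab
      by (simp add: minus_weil_sub csubspace_om_filtration)
    also have "W.proj (c *\<^sub>C (b * a)) = c \<odot>\<^bsub>W.Q\<^esub> W.proj (b * a)"
      using W.smult_Q[of "b * a" c] ab by simp
    finally show ?thesis
      by (simp add: W_quot_eq(1) W_mult that)
  qed
  have T: "?T = W.proj ` cyc_minus_one ` om_filtration 0"
    unfolding W_quot_eq(3,4) by (auto simp: W.carrier_Q W.quot_map_proj[OF W_maps(1,2)] image_image)
  show "?gens \<subseteq> ?T"
  proof
    fix z assume "z \<in> ?gens"
    then obtain a b i j where *: "a \<in> weil_homog i \<inter> om_filtration 0" "b \<in> weil_homog j \<inter> om_filtration 0"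
      "z = W.proj a \<otimes>\<^bsub>W_quot \<Delta> n\<^esub> W.proj b \<ominus>\<^bsub>W_quot \<Delta> n\<^esub>
        (-1) ^ (i * j) \<odot>\<^bsub>W_quot \<Delta> n\<^esub> (W.proj b \<otimes>\<^bsub>W_quot \<Delta> n\<^esub> W.proj a)"
      by (auto simp: W_quot_eq(1) W.homog_Q)
    have "partial_norm a b \<in> om_filtration 0"
      unfolding om_filtration_def
      by (rule partial_norm_wspan[OF *(1,2)[THEN IntD2, unfolded om_filtration_def]])
        (auto simp: wdeg_append wdeg_rotate)
    then have "- partial_norm a b \<in> om_filtration 0" by (rule F)
    moreover have "cyc_minus_one (- partial_norm a b) = a * b - (-1) ^ (i * j) *\<^sub>C (b * a)"
      using cyc_minus_one_partial_norm[of a i b j] *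
        clinear_scale[OF clinear_cyc_minus_one, of "-1" "partial_norm a b"]
      by (simp add: cvs.scale_minus_left scaleC_one)
    ultimately have "W.proj (a * b - (-1) ^ (i * j) *\<^sub>C (b * a)) \<in> ?T"
      unfolding T by (metis imageI)
    then show "z \<in> ?T" unfolding *(3) comm[OF *(1,2)[THEN IntD2]] .
  qed
  show "submodule ?T complex_ring (W_quot \<Delta> n)"
    using submodule_image[OF W.module_Q W.module_Q W.linear_map_quot_map[OF W_maps(1,2)]]
    by (simp add: W_quot_eq(1,3,4))
  fix V assume gens: "?gens \<subseteq> V" and V: "submodule V complex_ring (W_quot \<Delta> n)"
  note V' = complex_submoduleD[OF W.module_Q V[unfolded W_quot_eq(1)]]
  \<comment> \<open>The preimage of V in W(H), where membership can be tested on words.\<close>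
  let ?V = "{x \<in> om_filtration 0. W.proj x \<in> V}"
  have sub: "csubspace ?V"
    unfolding cvs.subspace_def
  proof (intro conjI ballI allI)
    show "0 \<in> ?V"
      using V'(2) W.proj_zero by (simp add: W.zero_Q cvs.subspace_0[OF csubspace_om_filtration])
    show "x + y \<in> ?V" if "x \<in> ?V" "y \<in> ?V" for x y
      using that V'(3)[of "W.proj x" "W.proj y"] W.add_Q[of x y]
      by (auto intro: cvs.subspace_add[OF csubspace_om_filtration])
    show "c *\<^sub>C x \<in> ?V" if "x \<in> ?V" for x c
      using that V'(4)[of "W.proj x" c] W.smult_Q[of x c] by (auto intro: F)
  qed
  have "cyc_minus_one (word w) \<in> ?V" if w: "w \<noteq> []" for w :: "'h gen list"
  proof -
    obtain a v where av: "w = a # v" using w by (cases w) auto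
    have K: "cyc_minus_one (word w) = (-1) ^ (gdeg a * wdeg v) *\<^sub>C (word v * word [a]) - word [a] * word v"
      unfolding av word_Cons[of a v] by (rule cyc_minus_one_letter_mult[OF weil_homog_word[OF refl]])
    show ?thesis
    \<comment> \<open>For a one-letter word v would be the unit, which is not in W(H); but t - 1
      vanishes there.\<close>
    proof (cases "v = []")
      case True
      then show ?thesis using cvs.subspace_0[OF sub] K
        by (simp add: wdeg_def scaleC_one flip: one_weil_word)
    next
      case False
      have o: "word u \<in> om_filtration 0" if "u \<noteq> []" for u :: "'h gen list"
        unfolding om_filtration_def by (rule wspan_word) (simp add: that length_le_wdeg)
      have o': "word [a] \<in> om_filtration 0" "word v \<in> om_filtration 0" by (simp_all add: o False)
      have mem: "W.proj (word u) \<in> carrier (W_quot \<Delta> n) \<inter> homog (W_quot \<Delta> n) (wdeg u)"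
        if "u \<noteq> []" for u
        unfolding W_quot_eq(1) W.carrier_Q W.homog_Q weil_sub_simps
        by (intro IntI imageI weil_homog_word refl o that)
      have wa: "wdeg [a] = gdeg a" by (simp add: wdeg_def)
      have "W.proj (word [a] * word v - (-1) ^ (gdeg a * wdeg v) *\<^sub>C (word v * word [a])) \<in> ?gens"
        unfolding comm[OF o', symmetric]
        by (intro CollectI exI conjI, rule refl)
          (rule mem[of "[a]", unfolded wa, OF list.distinct(2)] mem[OF False])+
      from subsetD[OF gens this]
      have "word [a] * word v - (-1) ^ (gdeg a * wdeg v) *\<^sub>C (word v * word [a]) \<in> ?V"
        by (intro CollectI conjI cvs.subspace_diff[OF csubspace_om_filtration] F m o')
      from cvs.subspace_neg[OF sub this] show ?thesis unfolding K by simp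
    qed
  qed
  then have "cyc_minus_one x \<in> ?V" if "x \<in> om_filtration 0" for x
    using clinear_wspan[OF clinear_cyc_minus_one sub _ that[unfolded om_filtration_def]] by blast
  then show "?T \<subseteq> V" unfolding T by auto
qed

lemma W_exact:
  "exact_sequence
     (\<lambda>i. if even i then W_quot_b \<Delta> n else W_quot \<Delta> n)
     (\<lambda>i. if even i then W_map \<Delta> n cyc_minus_one else W_map \<Delta> n cyc_norm)"
  "exact_resolution (W_nat \<Delta> n) (descend (W_map \<Delta> n cyc_norm))
     (\<lambda>i. if even i then W_quot_b \<Delta> n else W_quot \<Delta> n)
     (\<lambda>i. if even i then W_map \<Delta> n cyc_minus_one else W_map \<Delta> n cyc_norm)"
proof -
  \<comment> \<open>The projections commute with t - 1 on W(H) and hence on the quotient, so the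
    commutator subspace is graded.\<close>
  have p: "quot_op (weil_projection k) ` W_map \<Delta> n cyc_minus_one ` carrier (W_quot_b \<Delta> n)
      \<subseteq> W_map \<Delta> n cyc_minus_one ` carrier (W_quot_b \<Delta> n)" for k
  proof -
    note q = W.quot_map_proj[OF W_maps(1,2)]
      W.quot_map_proj[OF W_lin[OF clinear_weil_projection weil_projection_om_filtration]]
    have "quot_op (weil_projection k) (quot_op cyc_minus_one (W.proj x))
        \<in> quot_op cyc_minus_one ` W.proj ` om_filtration 0" if x: "x \<in> om_filtration 0" for x
    proof -
      have "cyc_minus_one x \<in> om_filtration 0" "weil_projection k x \<in> om_filtration 0"
        using om_filtration_cyc(1)[OF x] subsetD[OF weil_projection_om_filtration imageI[OF x]] by auto
      then have "quot_op (weil_projection k) (quot_op cyc_minus_one (W.proj x))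
          = quot_op cyc_minus_one (W.proj (weil_projection k x))"
        using x by (simp add: q weil_projection_cyc_minus_one)
      then show ?thesis using \<open>weil_projection k x \<in> _\<close> by simp
    qed
    then show ?thesis by (auto simp: W_quot_eq(3,4) W.carrier_Q)
  qed
  have gp: "graded_projections (W_quot \<Delta> n) (\<lambda>k. quot_op (weil_projection k))"
    unfolding W_quot_eq(1)
    by (rule W.graded_projections_Q[OF graded_projections_om_filtration weil_projection_om_filtration])
  note * = W_cochain(2,1) W_chain_maps W_kernels gp p
  show "exact_sequence
     (\<lambda>i. if even i then W_quot_b \<Delta> n else W_quot \<Delta> n)
     (\<lambda>i. if even i then W_map \<Delta> n cyc_minus_one else W_map \<Delta> n cyc_norm)"
    by (rule periodic_exact(1)[OF *])
  show "exact_resolution (W_nat \<Delta> n) (descend (W_map \<Delta> n cyc_norm))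
     (\<lambda>i. if even i then W_quot_b \<Delta> n else W_quot \<Delta> n)
     (\<lambda>i. if even i then W_map \<Delta> n cyc_minus_one else W_map \<Delta> n cyc_norm)"
    unfolding W_nat_def W_commutators by (rule periodic_exact(2)[OF *])
qed

end

end

theorem corollary6p9:
  fixes \<Delta> :: "'h::complex_vector \<Rightarrow> ('h, 'h) tensor" and \<epsilon> :: "'h \<Rightarrow> complex" and n :: nat
  assumes "coalgebra \<Delta> \<epsilon>"
  shows "exact_sequence
           (\<lambda>i. if even i then W_quot_b \<Delta> n else W_quot \<Delta> n)
           (\<lambda>i. if even i then W_map \<Delta> n cyc_minus_one else W_map \<Delta> n cyc_norm)
       \<and> exact_resolution
           (W_nat \<Delta> n)
           (descend (W_map \<Delta> n cyc_norm))
           (\<lambda>i. if even i then W_quot_b \<Delta> n else W_quot \<Delta> n)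
           (\<lambda>i. if even i then W_map \<Delta> n cyc_minus_one else W_map \<Delta> n cyc_norm)
       \<and> exact_resolution
           (I_nat \<Delta> n)
           (descend cyc_norm)
           (\<lambda>i. if even i then I_pow_b \<Delta> n else I_pow \<Delta> n)
           (\<lambda>i. if even i then cyc_minus_one else cyc_norm)"
proof -
  interpret coalgebra \<Delta> \<epsilon> by (rule assms)
  show ?thesis using W_exact I_resolution by blast
qed

end
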